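(* Let $G\le\mathrm{Aut}(T)$ be a finitely generated branch group. Let $X$ be a compact space and $H\le\mathrm{Homeo}(X)$ a finitely generated group such that $d:=\sup_{x\in X}\mathrm{leud}(\widetilde{\Gamma}(H,x))$ is finite. Let $\rho:G\to H$ be an injective homomorphism and let $Y\subset X$ be the essential support of the $G$-action on $X$ induced by $\rho$. Then there exists an upper semi-continuous $G$-equivariant map $q:Y\to\partial T^{[d]}$. Moreover, if $d=1$, then the map $q:Y\to\partial T^{[1]}=\partial T$ is continuous.
   Context: $T$ is an infinite locally finite rooted tree, $\mathrm{Aut}(T)$ its root-fixing automorphisms, $\partial T$ its boundary. $\mathrm{Rist}_G(v)$ is the set of elements of $G$ acting trivially outside the subtree below vertex $v$, $\mathrm{Rist}_G(n)$ the subgroup generated by $\mathrm{Rist}_G(v)$ for $v$ at level $n$, $K'$ the derived subgroup. $G$ is a branch group if it is transitive on each level and $\mathrm{Rist}_G(n)$ has finite index in $G$ for all $n\ge1$. For a group $K$ acting on $X$, $\mathrm{supp}_X(K)$ is the closure of the set of points not fixed by $K$; the essential support of the $G$-action is $Y=\bigcap_{n\ge1}\mathrm{supp}_X(\mathrm{Rist}_G(n)')$. For $x\in X$, $H^0_x$ is the set of elements of $H$ acting trivially on a neighbourhood of $x$; fixing a finite symmetric generating set $S$ of $H$, the graph of germs $\widetilde{\Gamma}(H,x)$ has vertex set $H/H^0_x$ and an edge from $gH^0_x$ to $sgH^0_x$ for each $s\in S$. For a bounded degree graph $\Gamma$, $\mathrm{leud}(\Gamma)\in[0,\infty]$ is the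 supremum of all $d$ such that there exists a Lipschitz map $\mathbb{N}^d\to\Gamma$ whose fibres have uniformly bounded cardinality. For a compact space $Z$, $Z^{[d]}$ is the subspace of the space $\mathcal{F}(Z)$ of closed subsets (Hausdorff topology) consisting of non-empty sets of cardinality at most $d$. A map $q:Y\to\mathcal{F}(Z)$ is upper semi-continuous if for every compact (closed) $K\subseteq Z$ the set $\{y:q(y)\cap K=\varnothing\}$ is open. *)

theory Defs
  imports "HOL-Analysis.Analysis" "HOL-Algebra.Bij" "HOL-Algebra.Solvable_Groups"
    "HOL-Library.Extended_Nat"
begin

definition rooted_lf_tree :: "nat list set \<Rightarrow> bool" where
  "rooted_lf_tree V \<longleftrightarrow> [] \<in> V \<and> (\<forall>v\<in>V. \<forall>k. take k v \<in> V)
     \<and> (\<forall>v\<in>V. finite {i. v @ [i] \<in> V}) \<and> infinite V"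

definition level :: "nat list set \<Rightarrow> nat \<Rightarrow> nat list set" where
  "level V n = {v \<in> V. length v = n}"

definition tree_aut :: "nat list set \<Rightarrow> (nat list \<Rightarrow> nat list) \<Rightarrow> bool" where
  "tree_aut V g \<longleftrightarrow> g \<in> Bij V \<and> g [] = []
     \<and> (\<forall>v\<in>V. v \<noteq> [] \<longrightarrow> g (butlast v) = butlast (g v))"

definition boundary :: "nat list set \<Rightarrow> (nat \<Rightarrow> nat) set" where
  "boundary V = {\<xi>. \<forall>n. map \<xi> [0..<n] \<in> V}"

definition cylinder :: "nat list set \<Rightarrow> nat list \<Rightarrow> (nat \<Rightarrow> nat) set" where
  "cylinder V v = {\<xi> \<in> boundary V. map \<xi> [0..<length v] = v}"

definition boundary_top :: "nat list set \<Rightarrow> (nat \<Rightarrow> nat) topology" where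
  "boundary_top V = topology_generated_by {cylinder V v | v. v \<in> V}"

definition bd_act :: "(nat list \<Rightarrow> nat list) \<Rightarrow> (nat \<Rightarrow> nat) \<Rightarrow> (nat \<Rightarrow> nat)" where
  "bd_act g \<xi> = (\<lambda>n. g (map \<xi> [0..<Suc n]) ! n)"

definition rist :: "nat list set \<Rightarrow> (nat list \<Rightarrow> nat list) set \<Rightarrow> nat list \<Rightarrow> (nat list \<Rightarrow> nat list) set" where
  "rist V G v = {g \<in> G. \<forall>w\<in>V. take (length v) w \<noteq> v \<longrightarrow> g w = w}"

definition rist_level :: "nat list set \<Rightarrow> (nat list \<Rightarrow> nat list) set \<Rightarrow> nat \<Rightarrow> (nat list \<Rightarrow> nat list) set" where
  "rist_level V G n = generate (BijGroup V) (\<Union>v\<in>level V n. rist V G v)"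

definition branch_group :: "nat list set \<Rightarrow> (nat list \<Rightarrow> nat list) set \<Rightarrow> bool" where
  "branch_group V G \<longleftrightarrow>
     (\<forall>n. \<forall>u\<in>level V n. \<forall>w\<in>level V n. \<exists>g\<in>G. g u = w)
     \<and> (\<forall>n\<ge>1. finite (rcosets\<^bsub>(BijGroup V)\<lparr>carrier := G\<rparr>\<^esub> (rist_level V G n)))"

definition fin_gen :: "('a, 'b) monoid_scheme \<Rightarrow> 'a set \<Rightarrow> bool" where
  "fin_gen M K \<longleftrightarrow> (\<exists>S. finite S \<and> S \<subseteq> K \<and> generate M S = K)"

definition Homeo :: "'x topology \<Rightarrow> ('x \<Rightarrow> 'x) set" where
  "Homeo X = {h \<in> Bij (topspace X). homeomorphic_map X X h}"

definition germ_stab :: "'x topology \<Rightarrow> ('x \<Rightarrow> 'x) set \<Rightarrow> 'x \<Rightarrow> ('x \<Rightarrow> 'x) set" where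
  "germ_stab X H x = {h \<in> H. \<exists>U. openin X U \<and> x \<in> U \<and> (\<forall>y\<in>U. h y = y)}"

definition germ_vertices :: "'x topology \<Rightarrow> ('x \<Rightarrow> 'x) set \<Rightarrow> 'x \<Rightarrow> ('x \<Rightarrow> 'x) set set" where
  "germ_vertices X H x = {h <#\<^bsub>BijGroup (topspace X)\<^esub> germ_stab X H x | h. h \<in> H}"

definition germ_edges :: "'x topology \<Rightarrow> ('x \<Rightarrow> 'x) set \<Rightarrow> ('x \<Rightarrow> 'x) set \<Rightarrow> 'x
    \<Rightarrow> (('x \<Rightarrow> 'x) set \<times> ('x \<Rightarrow> 'x) set) set" where
  "germ_edges X H S x = {(h <#\<^bsub>BijGroup (topspace X)\<^esub> germ_stab X H x,
        (s \<otimes>\<^bsub>BijGroup (topspace X)\<^esub> h) <#\<^bsub>BijGroup (topspace X)\<^esub> germ_stab X H x) | h s. h \<in> H \<and> s \<in> S}"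

text \<open>Graph distance (infinite if not connected).\<close>
definition gdist :: "('v \<times> 'v) set \<Rightarrow> 'v \<Rightarrow> 'v \<Rightarrow> enat" where
  "gdist E u v = (INF n \<in> {n. (u, v) \<in> E ^^ n}. enat n)"

definition grid :: "nat \<Rightarrow> (nat \<Rightarrow> nat) set" where
  "grid d = {a. \<forall>i\<ge>d. a i = 0}"

definition l1dist :: "nat \<Rightarrow> (nat \<Rightarrow> nat) \<Rightarrow> (nat \<Rightarrow> nat) \<Rightarrow> nat" where
  "l1dist d a b = (\<Sum>i<d. nat \<bar>int (a i) - int (b i)\<bar>)"

definition leud :: "'v set \<Rightarrow> ('v \<times> 'v) set \<Rightarrow> enat" where
  "leud Vs E = Sup {enat d | d. \<exists>f. f ` grid d \<subseteq> Vs
      \<and> (\<exists>C::nat. \<forall>a\<in>grid d. \<forall>b\<in>grid d. gdist E (f a) (f b) \<le> enat (C * l1dist d a b))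
      \<and> (\<exists>M::nat. \<forall>v. finite {a \<in> grid d. f a = v} \<and> card {a \<in> grid d. f a = v} \<le> M)}"

definition supp_in :: "'x topology \<Rightarrow> ('g \<Rightarrow> 'x \<Rightarrow> 'x) \<Rightarrow> 'g set \<Rightarrow> 'x set" where
  "supp_in X act K = X closure_of {x \<in> topspace X. \<exists>k\<in>K. act k x \<noteq> x}"

definition ess_support :: "nat list set \<Rightarrow> (nat list \<Rightarrow> nat list) set \<Rightarrow> 'x topology
    \<Rightarrow> ((nat list \<Rightarrow> nat list) \<Rightarrow> 'x \<Rightarrow> 'x) \<Rightarrow> 'x set" where
  "ess_support V G X \<rho> = (\<Inter>n\<in>{1..}. supp_in X \<rho> (derived (BijGroup V) (rist_level V G n)))"

end

theory Submission
  imports Defs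
begin

text \<open>
  Write \<open>R v\<close> for the rigid stabiliser of the vertex \<open>v\<close>. The map sends \<open>y\<close> to the set of ends \<open>\<xi>\<close>
  such that \<open>y\<close> lies in the support of the derived subgroup of \<open>R (\<xi> n)\<close> for every prefix \<open>\<xi> n\<close> of
  \<open>\<xi>\<close>. By Koenig's lemma it is non-empty and upper semi-continuous on the essential support.

  For the cardinality bound let \<open>v\<^sub>1, \<dots>, v\<^sub>k\<close> be separating prefixes of \<open>k\<close> ends in the image of \<open>y\<close>, let
  \<open>K\<close> be the germ stabiliser of \<open>y\<close> in \<open>G\<close> and \<open>M\<^sub>i\<close> its projection to \<open>R v\<^sub>i\<close>. If every \<open>M\<^sub>i\<close> has infinite
  index, geodesic rays in the coset graphs of the commuting groups \<open>R v\<^sub>i\<close> combine to a Lipschitz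
  injection of a \<open>k\<close>-dimensional quadrant. Otherwise some \<open>M\<^sub>i\<close> has finite index, and some normal
  finite-index subgroup of \<open>G\<close> normalises \<open>K \<inter> R v\<^sub>i\<close>. If this intersection moved the corresponding
  end, double commutators would place the derived subgroup of a deeper rigid stabiliser in it,
  uniformly on a neighbourhood of \<open>y\<close>, since \<open>M\<^sub>i\<close> is finitely generated; this contradicts the choice
  of the end. Hence it fixes the end, and then a whole neighbourhood of it, so \<open>K\<close> meets some rigid
  stabiliser trivially; the latter contains \<open>k\<close> commuting infinite finitely generated subgroups.
\<close>

section \<open>Cosets and finite index\<close>

text \<open>Derived subgroups appear because an element moving a vertex yields, through double
  commutators, only commutators of the rigid stabiliser below that vertex. The obstacle is that the
  germ stabiliser \<open>K\<close> of \<open>y\<close> is merely a directed union of pointwise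
  stabilisers of neighbourhoods. Finding the derived subgroup of \<open>R w\<close> inside
  \<open>K\<close> would not contradict that \<open>y\<close> lies in its support, since the
  neighbourhood may shrink with the element; the inclusion is needed inside one pointwise
  stabiliser. Only finitely many elements can be placed there at once, so finite index has to be
  exploited through finite generation. When \<open>K\<close> meets some \<open>R w\<close>
  trivially, the ends are no longer used: distinct elements of \<open>R w\<close> have distinct germ
  cosets, and any number of incomparable vertices lies below \<open>w\<close>. That rigid
  stabilisers are nonabelian, hence infinite, is deduced from the existence of one end in the image
  of one point, because a trivial derived subgroup has empty support.\<close>

definition fin_index :: "('a, 'b) monoid_scheme \<Rightarrow> 'a set \<Rightarrow> 'a set \<Rightarrow> bool" where
  "fin_index M B A \<longleftrightarrow> (\<exists>T. finite T \<and> T \<subseteq> A \<and> (\<forall>a\<in>A. \<exists>t\<in>T. inv\<^bsub>M\<^esub> t \<otimes>\<^bsub>M\<^esub> a \<in> B))"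

context group
begin

lemma inv_mult_cancel_left:
  "x \<in> carrier G \<Longrightarrow> y \<in> carrier G \<Longrightarrow> inv x \<otimes> (x \<otimes> y) = y"
  "x \<in> carrier G \<Longrightarrow> y \<in> carrier G \<Longrightarrow> x \<otimes> (inv x \<otimes> y) = y"
  by (simp_all add: m_assoc [symmetric])

lemmas group_norm = m_assoc inv_mult_group inv_mult_cancel_left

lemma subgroup_in: "subgroup A G \<Longrightarrow> x \<in> A \<Longrightarrow> x \<in> carrier G"
  by (simp add: subgroup.mem_carrier)

lemma fin_index_mono:
  assumes "fin_index G B A" "B \<subseteq> B'"
  shows "fin_index G B' A"
  using assms unfolding fin_index_def by (meson subsetD)

lemma fin_index_trans:
  assumes "fin_index G B A" "fin_index G A K" and "subgroup K G" "A \<subseteq> K" "B \<subseteq> A"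
  shows "fin_index G B K"
proof -
  obtain T where T: "finite T" "T \<subseteq> A" "\<And>a. a \<in> A \<Longrightarrow> \<exists>t\<in>T. inv t \<otimes> a \<in> B"
    using assms(1) unfolding fin_index_def by blast
  obtain R where R: "finite R" "R \<subseteq> K" "\<And>a. a \<in> K \<Longrightarrow> \<exists>t\<in>R. inv t \<otimes> a \<in> A"
    using assms(2) unfolding fin_index_def by blast
  have K: "\<And>x. x \<in> K \<Longrightarrow> x \<in> carrier G"
    using assms(3) by (rule subgroup_in)
  show ?thesis
    unfolding fin_index_def
  proof (intro exI conjI ballI)
    show "finite ((\<lambda>(r, t). r \<otimes> t) ` (R \<times> T))"
      using R(1) T(1) by simp
    show "(\<lambda>(r, t). r \<otimes> t) ` (R \<times> T) \<subseteq> K"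
      using R(2) T(2) assms(3,4) by (auto simp: subgroup.m_closed subset_iff)
    fix a assume a: "a \<in> K"
    obtain r where r: "r \<in> R" "inv r \<otimes> a \<in> A"
      using R(3) [OF a] by blast
    obtain t where t: "t \<in> T" "inv t \<otimes> (inv r \<otimes> a) \<in> B"
      using T(3) [OF r(2)] by blast
    have "r \<in> carrier G" "t \<in> carrier G" "a \<in> carrier G"
      using K a r(1) t(1) R(2) T(2) assms(4) by auto
    then have "inv (r \<otimes> t) \<otimes> a = inv t \<otimes> (inv r \<otimes> a)"
      by (simp add: group_norm)
    then show "\<exists>x\<in>(\<lambda>(r, t). r \<otimes> t) ` (R \<times> T). inv x \<otimes> a \<in> B"
      using r t by force
  qed
qed

text \<open>Source of infinitely many elements in one coset; when \<open>B\<close> is a subgroup,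
  quotients of two of them lie in \<open>B\<close>.\<close>

lemma fin_index_pigeonhole:
  assumes "fin_index G B A" "infinite I" "f ` I \<subseteq> A"
  obtains t where "t \<in> A" "infinite {i \<in> I. inv t \<otimes> f i \<in> B}"
proof -
  obtain T where T: "finite T" "T \<subseteq> A" "\<And>a. a \<in> A \<Longrightarrow> \<exists>t\<in>T. inv t \<otimes> a \<in> B"
    using assms(1) unfolding fin_index_def by blast
  have "I \<subseteq> (\<Union>t\<in>T. {i \<in> I. inv t \<otimes> f i \<in> B})"
    using T(3) assms(3) by blast
  then have "\<not> (\<forall>t\<in>T. finite {i \<in> I. inv t \<otimes> f i \<in> B})"
    using T(1) assms(2) by (meson finite_UN_I finite_subset)
  then show ?thesis
    using that T(2) by blast
qed

text \<open>Inversion turns the right cosets of the branch condition into the left translates of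
  \<open>fin_index\<close>.\<close>

lemma fin_index_rcosets:
  assumes "finite (rcosets\<^bsub>G\<lparr>carrier := A\<rparr>\<^esub> B)" "subgroup A G" "subgroup B G" "B \<subseteq> A"
  shows "fin_index G B A"
proof -
  define \<R> where "\<R> = rcosets\<^bsub>G\<lparr>carrier := A\<rparr>\<^esub> B"
  \<comment> \<open>The inverse of the representative is taken from the coset: if
    \<open>inv t\<close> is of the form \<open>b \<otimes> inv a\<close>, then
    \<open>inv t \<otimes> a\<close> is \<open>b\<close>.\<close>
  define rep where "rep = (\<lambda>Q. SOME x. x \<in> A \<and> inv x \<in> Q)"
  have R: "Q \<in> \<R> \<longleftrightarrow> (\<exists>a\<in>A. Q = {b \<otimes> a | b. b \<in> B})" for Q
    unfolding \<R>_def RCOSETS_def r_coset_def by auto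
  have car: "\<And>x. x \<in> A \<Longrightarrow> x \<in> carrier G" "\<And>x. x \<in> B \<Longrightarrow> x \<in> carrier G"
    using assms subgroup_in by blast+
  have rep: "rep Q \<in> A \<and> inv (rep Q) \<in> Q" if "Q \<in> \<R>" for Q
  proof -
    have "\<exists>a\<in>A. Q = {b \<otimes> a | b. b \<in> B}"
      using that by (simp only: R)
    then obtain a where a: "a \<in> A" "Q = {b \<otimes> a | b. b \<in> B}"
      by blast
    have "a \<in> Q"
      using a car subgroup.one_closed [OF assms(3)] by (auto intro!: exI [of _ "\<one>"])
    then have "inv a \<in> A \<and> inv (inv a) \<in> Q"
      using a(1) car assms(2) by (simp add: subgroup.m_inv_closed)
    then show ?thesis unfolding rep_def by (rule someI)
  qed
  show ?thesis
    unfolding fin_index_def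
  proof (intro exI conjI ballI)
    show "finite (rep ` \<R>)"
      using assms(1) by (simp add: \<R>_def)
    show "rep ` \<R> \<subseteq> A"
      using rep by blast
    fix a assume a: "a \<in> A"
    define Q where "Q = {b \<otimes> inv a | b. b \<in> B}"
    have Q: "Q \<in> \<R>"
      unfolding R using subgroup.m_inv_closed [OF assms(2) a] by (auto simp: Q_def)
    have "inv (rep Q) \<in> Q"
      using rep [OF Q] by simp
    then obtain b where b: "b \<in> B" "inv (rep Q) = b \<otimes> inv a"
      unfolding Q_def by auto
    then have "inv (rep Q) \<otimes> a = b"
      using a car by (simp add: group_norm)
    then show "\<exists>t\<in>rep ` \<R>. inv t \<otimes> a \<in> B"
      using Q b(1) by auto
  qed
qed

text \<open>Words grow on the left, the direction in which the edges of germ graphs act. Symmetry of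
  \<open>S\<close> absorbs the case of an inverse generator.\<close>

lemma generate_left_induct [consumes 2, case_names sym one step]:
  assumes "a \<in> generate G S" "S \<subseteq> carrier G" "\<And>s. s \<in> S \<Longrightarrow> inv s \<in> S"
    and "P \<one>" and "\<And>s a. s \<in> S \<Longrightarrow> a \<in> generate G S \<Longrightarrow> P a \<Longrightarrow> P (s \<otimes> a)"
  shows "P a"
proof -
  \<comment> \<open>Quantifying over all \<open>x\<close> lets the product case compose the claims
    for its two factors.\<close>
  have "\<forall>x\<in>generate G S. P x \<longrightarrow> P (a \<otimes> x)"
    using assms(1)
  proof (induction a rule: generate.induct)
    case one
    show ?case using generate_in_carrier [OF assms(2)] by simp
  next
    case (incl h)
    then show ?case using assms by blast
  next
    case (inv h)
    then show ?case using assms by blast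
  next
    case (eng h1 h2)
    show ?case
    proof (intro ballI impI)
      fix x assume x: "x \<in> generate G S" "P x"
      have "h2 \<otimes> x \<in> generate G S"
        using eng x by (simp add: generate.eng)
      then have "P (h1 \<otimes> (h2 \<otimes> x))"
        using eng x by blast
      then show "P (h1 \<otimes> h2 \<otimes> x)"
        using eng x generate_in_carrier [OF assms(2)] by (simp add: m_assoc)
    qed
  qed
  then have "P (a \<otimes> \<one>)"
    using assms(4) generate.one by blast
  then show ?thesis
    using generate_in_carrier [OF assms(2,1)] by simp
qed

lemma fin_gen_symmetric:
  assumes "fin_gen G A" "subgroup A G"
  obtains S where "finite S" "S \<subseteq> A" "generate G S = A" "\<And>s. s \<in> S \<Longrightarrow> inv s \<in> S"
proof -
  obtain S where S: "finite S" "S \<subseteq> A" "generate G S = A"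
    using assms unfolding fin_gen_def by blast
  let ?S = "S \<union> m_inv G ` S"
  have sub: "?S \<subseteq> A"
    using S(2) assms(2) by (auto simp: subgroup.m_inv_closed)
  show ?thesis
  proof (rule that [of ?S])
    show "generate G ?S = A"
      using generate_subgroup_incl [OF sub assms(2)] mono_generate [of S ?S] S(3) by blast
    show "inv s \<in> ?S" if "s \<in> ?S" for s
      using that sub subgroup_in [OF assms(2)] by auto
    show "finite ?S" using S(1) by simp
    show "?S \<subseteq> A" by (rule sub)
  qed
qed

text \<open>Schreier's lemma for left cosets: when a generator is added on the left, the new and the
  old representative leave a factor in the finite set \<open>F\<close>.\<close>

lemma fin_gen_fin_index:
  assumes "fin_gen G A" "subgroup A G" "subgroup B G" "B \<subseteq> A" "fin_index G B A"
  shows "fin_gen G B"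
proof -
  obtain S where S: "finite S" "S \<subseteq> A" "generate G S = A" "\<And>s. s \<in> S \<Longrightarrow> inv s \<in> S"
    using fin_gen_symmetric [OF assms(1,2)] by metis
  obtain T0 where T0: "finite T0" "T0 \<subseteq> A" "\<And>a. a \<in> A \<Longrightarrow> \<exists>t\<in>T0. inv t \<otimes> a \<in> B"
    using assms(5) unfolding fin_index_def by blast
  \<comment> \<open>The unit represents the empty word with trivial remainder.\<close>
  define T where "T = insert \<one> T0"
  have T: "finite T" "T \<subseteq> A" "\<And>a. a \<in> A \<Longrightarrow> \<exists>t\<in>T. inv t \<otimes> a \<in> B"
    using T0 subgroup.one_closed [OF assms(2)] unfolding T_def by auto
  \<comment> \<open>Besides the Schreier elements, \<open>F\<close> contains the representatives
    lying in \<open>B\<close>: since \<open>T\<close> need not be minimal, an element of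
    \<open>B\<close> may be reached through a representative other than the unit.\<close>
  define F where "F = B \<inter> (T \<union> (\<lambda>(t, s, t'). inv t \<otimes> (s \<otimes> t')) ` (T \<times> S \<times> T))"
  have F: "finite F" "F \<subseteq> B"
    using T(1) S(1) unfolding F_def by auto
  have carA: "x \<in> A \<Longrightarrow> x \<in> carrier G" for x
    using assms(2) subgroup_in by blast
  have genF: "generate G F \<subseteq> B"
    using F(2) assms(3) by (rule generate_subgroup_incl)
  have dec: "\<exists>t\<in>T. inv t \<otimes> a \<in> generate G F" if "a \<in> A" for a
  proof -
    have "a \<in> generate G S" "S \<subseteq> carrier G"
      using that S carA by auto
    then show ?thesis
    proof (induction a rule: generate_left_induct)
      case (sym s)
      then show ?case by (rule S(4))
    next
      case one
      show ?case by (rule bexI [of _ \<one>]) (auto simp: generate.one T_def)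
    next
      case (step s a)
      then obtain t where t: "t \<in> T" "inv t \<otimes> a \<in> generate G F" by blast
      have car: "s \<in> carrier G" "t \<in> carrier G" "a \<in> carrier G"
        using step t(1) T(2) S carA by auto
      have "s \<otimes> t \<in> A"
        using step(1) t(1) S(2) T(2) assms(2) by (meson subgroup.m_closed subsetD)
      then obtain t' where t': "t' \<in> T" "inv t' \<otimes> (s \<otimes> t) \<in> B"
        using T(3) by blast
      then have "inv t' \<otimes> (s \<otimes> t) \<in> F"
        using step(1) t(1) unfolding F_def by (auto intro!: rev_image_eqI [of "(t', s, t)"])
      then have "inv t' \<otimes> (s \<otimes> t) \<otimes> (inv t \<otimes> a) \<in> generate G F"
        using t(2) by (simp add: generate.eng generate.incl)
      moreover have "t' \<in> carrier G"
        using t'(1) T(2) carA by auto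
      ultimately have "inv t' \<otimes> (s \<otimes> a) \<in> generate G F"
        using car by (simp add: group_norm)
      then show ?case using t'(1) by blast
    qed
  qed
  have "B \<subseteq> generate G F"
  proof
    fix b assume b: "b \<in> B"
    then obtain t where t: "t \<in> T" "inv t \<otimes> b \<in> generate G F"
      using dec assms(4) by blast
    have car: "t \<in> carrier G" "b \<in> carrier G"
      using t b T(2) carA assms(4) by auto
    have "b \<otimes> inv (inv t \<otimes> b) \<in> B"
      using b t(2) genF assms(3) by (meson subgroup.m_closed subgroup.m_inv_closed subsetD)
    then have "t \<in> B"
      using car by (simp add: group_norm)
    then have "t \<in> F"
      using t(1) unfolding F_def by blast
    then have "t \<otimes> (inv t \<otimes> b) \<in> generate G F"
      by (rule generate.eng [OF generate.incl t(2)])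
    then show "b \<in> generate G F"
      using car by (simp add: group_norm)
  qed
  then show ?thesis
    using F genF unfolding fin_gen_def by blast
qed

text \<open>The core is the intersection of the conjugates of \<open>B\<close>. Two elements that
  permute the finitely many cosets of \<open>B\<close> alike differ by an element of it.\<close>

lemma ex_normal_core:
  assumes "subgroup A G" "subgroup B G" "B \<subseteq> A" "fin_index G B A"
  obtains N where "subgroup N G" "N \<subseteq> B" "fin_index G N A"
    "\<And>a n. a \<in> A \<Longrightarrow> n \<in> N \<Longrightarrow> a \<otimes> n \<otimes> inv a \<in> N"
proof -
  define N where "N = {g \<in> A. \<forall>t\<in>A. inv t \<otimes> g \<otimes> t \<in> B}"
  have car: "\<And>x. x \<in> A \<Longrightarrow> x \<in> carrier G" "\<And>x. x \<in> B \<Longrightarrow> x \<in> carrier G"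
    using assms subgroup_in by blast+
  obtain T where T: "finite T" "T \<subseteq> A" "\<And>a. a \<in> A \<Longrightarrow> \<exists>t\<in>T. inv t \<otimes> a \<in> B"
    using assms(4) unfolding fin_index_def by blast
  \<comment> \<open>This encodes the action of \<open>g\<close> on cosets. It is set-valued because
    several elements of \<open>T\<close> may represent the same coset.\<close>
  define \<phi> where "\<phi> = (\<lambda>g. \<lambda>t\<in>T. {t' \<in> T. inv t' \<otimes> (g \<otimes> t) \<in> B})"
  define rep where "rep = (\<lambda>f. SOME g. g \<in> A \<and> \<phi> g = f)"
  have rep: "rep (\<phi> g) \<in> A" "\<phi> (rep (\<phi> g)) = \<phi> g" if "g \<in> A" for g
    using that unfolding rep_def by (metis (mono_tags, lifting) someI_ex)+
  have same: "inv g \<otimes> h \<in> N" if g: "g \<in> A" and h: "h \<in> A" and eq: "\<phi> g = \<phi> h" for g h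
  proof -
    have "inv x \<otimes> (inv g \<otimes> h) \<otimes> x \<in> B" if x: "x \<in> A" for x
    proof -
      obtain t where t: "t \<in> T" "inv t \<otimes> x \<in> B" using T(3) [OF x] by blast
      have tA: "t \<in> A" using t T by auto
      have "g \<otimes> t \<in> A" using g tA assms(1) by (simp add: subgroup.m_closed)
      then obtain t' where t': "t' \<in> T" "inv t' \<otimes> (g \<otimes> t) \<in> B" using T(3) by blast
      then have "t' \<in> \<phi> g t" using t(1) by (simp add: \<phi>_def)
      then have "t' \<in> \<phi> h t" by (simp only: eq)
      then have h': "inv t' \<otimes> (h \<otimes> t) \<in> B" using t(1) by (simp add: \<phi>_def)
      have t'A: "t' \<in> A" using t' T by auto
      \<comment> \<open>Both \<open>t'\<close> and \<open>t\<close> cancel in this quotient, leaving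
        the conjugate of \<open>inv g \<otimes> h\<close> by \<open>x\<close>.\<close>
      have "inv (inv t' \<otimes> (g \<otimes> t) \<otimes> (inv t \<otimes> x)) \<otimes> (inv t' \<otimes> (h \<otimes> t) \<otimes> (inv t \<otimes> x)) \<in> B"
        using t(2) t'(2) h' assms(2) by (simp add: subgroup.m_closed subgroup.m_inv_closed)
      then show ?thesis
        using car(1) [OF tA] car(1) [OF t'A] car(1) [OF g] car(1) [OF h] car(1) [OF x]
        by (simp add: group_norm)
    qed
    then show ?thesis
      using g h assms(1) by (simp add: N_def subgroup.m_closed subgroup.m_inv_closed)
  qed
  show ?thesis
  proof (rule that [of N])
    show "N \<subseteq> B"
    proof
      fix g assume "g \<in> N"
      then have "g \<in> A" "inv \<one> \<otimes> g \<otimes> \<one> \<in> B"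
        using subgroup.one_closed [OF assms(1)] unfolding N_def by blast+
      then show "g \<in> B" using car(1) by simp
    qed
    show "subgroup N G"
    proof (rule subgroupI)
      show "N \<subseteq> carrier G" using car by (auto simp: N_def)
      show "N \<noteq> {}"
        using subgroup.one_closed [OF assms(1)] subgroup.one_closed [OF assms(2)] car
        by (auto simp: N_def intro!: exI [of _ "\<one>"])
    next
      fix a assume a: "a \<in> N"
      have "inv t \<otimes> inv a \<otimes> t \<in> B" if t: "t \<in> A" for t
      proof -
        have "inv (inv t \<otimes> a \<otimes> t) \<in> B"
          using a t assms(2) by (simp add: N_def subgroup.m_inv_closed)
        then show ?thesis using a t car by (simp add: N_def group_norm)
      qed
      then show "inv a \<in> N" using a assms(1) by (simp add: N_def subgroup.m_inv_closed)
    next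
      fix a b assume ab: "a \<in> N" "b \<in> N"
      have "inv t \<otimes> (a \<otimes> b) \<otimes> t \<in> B" if t: "t \<in> A" for t
      proof -
        have "(inv t \<otimes> a \<otimes> t) \<otimes> (inv t \<otimes> b \<otimes> t) \<in> B"
          using ab t assms(2) by (simp add: N_def subgroup.m_closed)
        then show ?thesis using ab t car by (simp add: N_def group_norm)
      qed
      then show "a \<otimes> b \<in> N" using ab assms(1) by (simp add: N_def subgroup.m_closed)
    qed
    show "a \<otimes> n \<otimes> inv a \<in> N" if a: "a \<in> A" and n: "n \<in> N" for a n
    proof -
      have "inv t \<otimes> (a \<otimes> n \<otimes> inv a) \<otimes> t \<in> B" if t: "t \<in> A" for t
      proof -
        have "inv a \<otimes> t \<in> A" using a t assms(1) by (simp add: subgroup.m_closed subgroup.m_inv_closed)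
        then have "inv (inv a \<otimes> t) \<otimes> n \<otimes> (inv a \<otimes> t) \<in> B"
          using n by (simp add: N_def)
        then show ?thesis using a n t car by (simp add: N_def group_norm)
      qed
      then show ?thesis using a n assms(1) by (simp add: N_def subgroup.m_closed subgroup.m_inv_closed)
    qed
    show "fin_index G N A"
      unfolding fin_index_def
    proof (intro exI conjI ballI)
      have "\<phi> ` A \<subseteq> T \<rightarrow>\<^sub>E Pow T" by (auto simp: \<phi>_def)
      then show "finite (rep ` \<phi> ` A)"
        using T(1) by (meson finite_PiE finite_Pow_iff finite_imageI finite_subset)
      show "rep ` \<phi> ` A \<subseteq> A" using rep by auto
      fix a assume "a \<in> A"
      then show "\<exists>t\<in>rep ` \<phi> ` A. inv t \<otimes> a \<in> N"
        using same rep by (intro bexI [of _ "rep (\<phi> a)"]) auto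
    qed
  qed
qed

lemma derived_conj_subset:
  assumes "g \<in> carrier G" "A \<subseteq> carrier G" "B \<subseteq> carrier G"
    and "\<And>a. a \<in> A \<Longrightarrow> g \<otimes> a \<otimes> inv g \<in> B" and "x \<in> derived G A"
  shows "g \<otimes> x \<otimes> inv g \<in> derived G B"
proof -
  interpret conj: group_hom G G "\<lambda>a. g \<otimes> a \<otimes> inv g"
  proof
    show "(\<lambda>a. g \<otimes> a \<otimes> inv g) \<in> hom G G"
      using assms(1) by (intro homI) (simp_all add: group_norm)
  qed
  have "derived G ((\<lambda>a. g \<otimes> a \<otimes> inv g) ` A) \<subseteq> derived G B"
    using assms(4) by (intro mono_derived) auto
  then show ?thesis
    using conj.derived_img [OF assms(2)] assms(5) by auto
qed

text \<open>With \<open>[a,t]\<close> for the commutator, \<open>[ab,t]\<close> is the conjugate of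
  \<open>[b,t]\<close> by \<open>a\<close>, times \<open>[a,t]\<close>; so the first entry reduces
  to generators. Inverting a commutator swaps its entries, and the same reduction then handles the
  second.\<close>

lemma derived_generate_subset:
  assumes "S \<subseteq> carrier G" "subgroup D G"
    and norm: "\<And>g d. g \<in> generate G S \<Longrightarrow> d \<in> D \<Longrightarrow> g \<otimes> d \<otimes> inv g \<in> D"
    and comm: "\<And>s t. s \<in> S \<Longrightarrow> t \<in> S \<Longrightarrow> s \<otimes> t \<otimes> inv s \<otimes> inv t \<in> D"
  shows "derived G (generate G S) \<subseteq> D"
proof -
  have car: "\<And>x. x \<in> generate G S \<Longrightarrow> x \<in> carrier G" "\<And>x. x \<in> D \<Longrightarrow> x \<in> carrier G"
    using generate_in_carrier [OF assms(1)] subgroup_in [OF assms(2)] by blast+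
  have sub: "subgroup (generate G S) G"
    by (rule generate_is_subgroup [OF assms(1)])
  have left: "\<forall>g\<in>generate G S. g \<otimes> t \<otimes> inv g \<otimes> inv t \<in> D"
    if t: "t \<in> generate G S" and gen: "\<And>s. s \<in> S \<Longrightarrow> s \<otimes> t \<otimes> inv s \<otimes> inv t \<in> D" for t
  proof
    fix g assume "g \<in> generate G S"
    then show "g \<otimes> t \<otimes> inv g \<otimes> inv t \<in> D"
    proof (induction g rule: generate.induct)
      case one
      then show ?case using t car subgroup.one_closed [OF assms(2)] by simp
    next
      case (incl h)
      then show ?case using gen by blast
    next
      case (inv h)
      have h: "h \<in> carrier G" "inv h \<in> generate G S"
        using inv assms(1) by (auto intro: generate.inv)
      have "inv h \<otimes> inv (h \<otimes> t \<otimes> inv h \<otimes> inv t) \<otimes> inv (inv h) \<in> D"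
        using gen [OF inv] norm [OF h(2)] assms(2) by (simp add: subgroup.m_inv_closed)
      then show ?case using h t car by (simp add: group_norm)
    next
      case (eng a b)
      have "(a \<otimes> (b \<otimes> t \<otimes> inv b \<otimes> inv t) \<otimes> inv a) \<otimes> (a \<otimes> t \<otimes> inv a \<otimes> inv t) \<in> D"
        using eng norm assms(2) by (simp add: subgroup.m_closed)
      then show ?case using eng t car by (simp add: group_norm)
    qed
  qed
  have "g \<otimes> h \<otimes> inv g \<otimes> inv h \<in> D" if "g \<in> generate G S" "h \<in> generate G S" for g h
  proof -
    have "s \<otimes> h \<otimes> inv s \<otimes> inv h \<in> D" if s: "s \<in> S" for s
    proof -
      have sS: "s \<in> generate G S" using s by (rule generate.incl)
      have "h \<otimes> s \<otimes> inv h \<otimes> inv s \<in> D"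
        using left [OF sS] comm s \<open>h \<in> generate G S\<close> by blast
      then have "inv (h \<otimes> s \<otimes> inv h \<otimes> inv s) \<in> D"
        using assms(2) by (simp add: subgroup.m_inv_closed)
      then show ?thesis using sS \<open>h \<in> generate G S\<close> car by (simp add: group_norm)
    qed
    then show ?thesis using left that by blast
  qed
  then show ?thesis
    unfolding derived_def by (intro generate_subgroup_incl [OF _ assms(2)]) auto
qed

end

section \<open>Rays in coset graphs\<close>

text \<open>The \<open>k\<close>-fold ancestor, landing at level \<open>n\<close>; the parent map
  itself depends on the level.\<close>

primrec descend :: "(nat \<Rightarrow> 'a \<Rightarrow> 'a) \<Rightarrow> nat \<Rightarrow> nat \<Rightarrow> 'a \<Rightarrow> 'a" where
  "descend par 0 n y = y"
| "descend par (Suc k) n y = par n (descend par k (Suc n) y)"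

text \<open>The invariant along the branch is to be an ancestor of infinitely many of the chosen
  points \<open>z m\<close>; finiteness of the next level hands it on to a child.\<close>

lemma koenig:
  fixes P :: "nat \<Rightarrow> 'a set"
  assumes fin: "\<And>n. finite (P n)" and ne: "\<And>n. P n \<noteq> {}"
    and par: "\<And>n x. x \<in> P (Suc n) \<Longrightarrow> par n x \<in> P n"
  obtains s where "\<And>n. s n \<in> P n" "\<And>n. par n (s (Suc n)) = s n"
proof -
  define z where "z = (\<lambda>n. SOME y. y \<in> P n)"
  have z: "z n \<in> P n" for n
    unfolding z_def using ne [of n] by (simp add: some_in_eq)
  define e where "e = (\<lambda>m n. descend par (m - n) n (z m))"
  have dP: "descend par k n y \<in> P n" if "y \<in> P (n + k)" for k n y
    using that by (induction k arbitrary: n) (auto simp: par)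
  have eP: "e m n \<in> P n" if "n \<le> m" for m n
    using that dP z by (simp add: e_def)
  have eS: "e m n = par n (e m (Suc n))" if "n < m" for m n
  proof -
    have "m - n = Suc (m - Suc n)" using that by simp
    then show ?thesis by (simp add: e_def)
  qed
  define good where "good = (\<lambda>n x. infinite {m. n \<le> m \<and> e m n = x})"
  have pigeon: "\<exists>x\<in>P n. infinite {m \<in> I. e m n = x}" if "infinite I" "\<And>m. m \<in> I \<Longrightarrow> n \<le> m" for n I
  proof (rule ccontr)
    assume "\<not> ?thesis"
    then have "finite (\<Union>x\<in>P n. {m \<in> I. e m n = x})"
      using fin by blast
    moreover have "I \<subseteq> (\<Union>x\<in>P n. {m \<in> I. e m n = x})"
      using eP that(2) by auto
    ultimately show False
      using that(1) finite_subset by blast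
  qed
  have "\<exists>s. \<forall>n. good n (s n) \<and> par n (s (Suc n)) = s n"
  proof (rule dependent_nat_choice)
    have "infinite {0::nat..}" by (rule infinite_Ici)
    from pigeon [OF this, of 0] show "\<exists>x. good 0 x"
      unfolding good_def by auto
  next
    fix x n assume "good n x"
    \<comment> \<open>Dropping \<open>m = n\<close> keeps the set infinite and guarantees that each
      remaining point has an ancestor at level \<open>Suc n\<close>.\<close>
    then have inf: "infinite ({m. n \<le> m \<and> e m n = x} - {n})"
      unfolding good_def by simp
    obtain x' where x': "infinite {m \<in> {m. n \<le> m \<and> e m n = x} - {n}. e m (Suc n) = x'}"
      using pigeon [OF inf, of "Suc n"] by auto
    have "{m \<in> {m. n \<le> m \<and> e m n = x} - {n}. e m (Suc n) = x'} \<noteq> {}"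
      using x' by (rule infinite_imp_nonempty)
    then obtain m where m: "n \<le> m" "m \<noteq> n" "e m n = x" "e m (Suc n) = x'"
      by auto
    have "good (Suc n) x'"
      unfolding good_def by (rule infinite_super [OF _ x']) auto
    then show "\<exists>y. good (Suc n) y \<and> par n y = x"
      using m eS [of n m] by auto
  qed
  then obtain s where s: "\<And>n. good n (s n)" "\<And>n. par n (s (Suc n)) = s n"
    by blast
  have "s n \<in> P n" for n
  proof -
    have "{m. n \<le> m \<and> e m n = s n} \<noteq> {}"
      using s(1) [of n] unfolding good_def by (rule infinite_imp_nonempty)
    then show ?thesis using eP by force
  qed
  then show ?thesis using that s(2) by blast
qed

section \<open>Words in a generating set and geodesic rays in coset graphs\<close>

primrec word_sphere :: "('a, 'b) monoid_scheme \<Rightarrow> 'a set \<Rightarrow> nat \<Rightarrow> 'a set" where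
  "word_sphere M S 0 = {\<one>\<^bsub>M\<^esub>}"
| "word_sphere M S (Suc n) = (\<lambda>(s, a). s \<otimes>\<^bsub>M\<^esub> a) ` (S \<times> word_sphere M S n)"

text \<open>A \<open>word_sphere\<close> holds the products of exactly \<open>n\<close> factors,
  shortest or not, so spheres may overlap; the union is the usual ball of the word metric.\<close>

definition word_ball :: "('a, 'b) monoid_scheme \<Rightarrow> 'a set \<Rightarrow> nat \<Rightarrow> 'a set" where
  "word_ball M S n = (\<Union>m\<le>n. word_sphere M S m)"

primrec lprod :: "('a, 'b) monoid_scheme \<Rightarrow> (nat \<Rightarrow> 'a) \<Rightarrow> nat \<Rightarrow> 'a" where
  "lprod M \<delta> 0 = \<one>\<^bsub>M\<^esub>"
| "lprod M \<delta> (Suc n) = \<delta> n \<otimes>\<^bsub>M\<^esub> lprod M \<delta> n"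

lemma finite_word_sphere: "finite S \<Longrightarrow> finite (word_sphere M S n)"
  by (induction n) auto

lemma finite_word_ball: "finite S \<Longrightarrow> finite (word_ball M S n)"
  by (simp add: word_ball_def finite_word_sphere)

lemma word_ball_mono: "m \<le> n \<Longrightarrow> word_ball M S m \<subseteq> word_ball M S n"
  unfolding word_ball_def by (meson UN_mono atMost_subset_iff order_refl subsetI)

context group
begin

lemma word_sphere_in_generate: "word_sphere G S n \<subseteq> generate G S"
  by (induction n) (auto intro: generate.intros)

lemma word_ball_in_generate: "word_ball G S n \<subseteq> generate G S"
  using word_sphere_in_generate by (auto simp: word_ball_def)

lemma one_in_word_ball: "\<one> \<in> word_ball G S n"
  by (auto simp: word_ball_def intro: bexI [of _ 0])

lemma word_sphere_mult:
  assumes "S \<subseteq> carrier G" "x \<in> word_sphere G S m" "y \<in> word_sphere G S n"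
  shows "x \<otimes> y \<in> word_sphere G S (m + n)"
proof -
  have car: "\<And>k z. z \<in> word_sphere G S k \<Longrightarrow> z \<in> carrier G"
    using word_sphere_in_generate generate_in_carrier [OF assms(1)] by blast
  show ?thesis
    using assms(2)
  proof (induction m arbitrary: x)
    case 0
    then show ?case using assms(3) car by auto
  next
    case (Suc m)
    then obtain s a where sa: "s \<in> S" "a \<in> word_sphere G S m" "x = s \<otimes> a" by auto
    have "x \<otimes> y = s \<otimes> (a \<otimes> y)"
      using sa assms(1,3) car by (simp add: m_assoc subset_iff)
    then show ?case using sa Suc.IH by force
  qed
qed

lemma word_ball_mult:
  assumes "S \<subseteq> carrier G" "x \<in> word_ball G S m" "y \<in> word_ball G S n"
  shows "x \<otimes> y \<in> word_ball G S (m + n)"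
proof -
  obtain i j where "i \<le> m" "x \<in> word_sphere G S i" "j \<le> n" "y \<in> word_sphere G S j"
    using assms(2,3) by (auto simp: word_ball_def)
  then have "i + j \<le> m + n" "x \<otimes> y \<in> word_sphere G S (i + j)"
    using word_sphere_mult [OF assms(1)] by auto
  then show ?thesis by (auto simp: word_ball_def)
qed

lemma generate_word_ball:
  assumes "S \<subseteq> carrier G" "\<And>s. s \<in> S \<Longrightarrow> inv s \<in> S" "a \<in> generate G S"
  shows "\<exists>n. a \<in> word_ball G S n"
proof -
  have "\<exists>n. a \<in> word_sphere G S n"
    using assms(3,1)
  proof (induction rule: generate_left_induct)
    case (sym s)
    then show ?case by (rule assms(2))
  next
    case one
    show ?case by (rule exI [of _ 0]) simp
  next
    case (step s a)
    then obtain n where "a \<in> word_sphere G S n" by blast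
    then have "s \<otimes> a \<in> word_sphere G S (Suc n)" using step by force
    then show ?case by blast
  qed
  then show ?thesis by (auto simp: word_ball_def)
qed

lemma finite_subset_word_ball:
  assumes "S \<subseteq> carrier G" "\<And>s. s \<in> S \<Longrightarrow> inv s \<in> S" "finite F" "F \<subseteq> generate G S"
  shows "\<exists>n. F \<subseteq> word_ball G S n"
  using assms(3,4)
proof (induction F rule: finite_induct)
  case (insert x F)
  then obtain n where n: "F \<subseteq> word_ball G S n" by auto
  obtain m where m: "x \<in> word_ball G S m"
    using generate_word_ball [OF assms(1,2), of x] insert by auto
  have "insert x F \<subseteq> word_ball G S (max m n)"
    using m n word_ball_mono [of m "max m n" G S] word_ball_mono [of n "max m n" G S] by auto
  then show ?case by blast
qed simp

text \<open>Koenig's lemma is applied to shortest coset representatives. Distance from the base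
  coset is constant on cosets and equals \<open>n\<close> at \<open>\<gamma> n\<close>, so no coset
  is visited twice.\<close>

lemma ex_coset_ray:
  assumes "fin_gen G A" "subgroup A G" "subgroup B G" "B \<subseteq> A" "\<not> fin_index G B A"
  obtains F \<gamma> where "finite F" "F \<subseteq> A" "\<And>n. \<gamma> n \<in> A" "\<And>n. \<gamma> (Suc n) \<otimes> inv (\<gamma> n) \<in> F"
    "\<And>m n. inv (\<gamma> m) \<otimes> \<gamma> n \<in> B \<Longrightarrow> m = n"
proof -
  obtain S where S: "finite S" "S \<subseteq> A" "generate G S = A" "\<And>s. s \<in> S \<Longrightarrow> inv s \<in> S"
    using fin_gen_symmetric [OF assms(1,2)] by metis
  have car: "x \<in> A \<Longrightarrow> x \<in> carrier G" for x
    using assms(2) subgroup_in by blast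
  have Scar: "S \<subseteq> carrier G" using S(2) car by blast
  have RA: "word_ball G S n \<subseteq> A" for n
    using word_ball_in_generate S(3) by blast
  define near where "near = (\<lambda>n a. \<exists>t\<in>word_ball G S n. inv t \<otimes> a \<in> B)"
  \<comment> \<open>\<open>l a\<close> is the distance from \<open>B\<close> to the coset of
    \<open>a\<close> in the graph whose edges are left multiplications by \<open>S\<close>.\<close>
  define l where "l = (\<lambda>a. LEAST n. near n a)"
  have near: "near (l a) a" if "a \<in> A" for a
  proof -
    have "\<exists>n. a \<in> word_ball G S n"
      using that S(3,4) by (intro generate_word_ball [OF Scar]) auto
    then obtain n where "a \<in> word_ball G S n"
      by blast
    then have "near n a"
      unfolding near_def using that car subgroup.one_closed [OF assms(3)]
      by (intro bexI [of _ a]) auto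
    then show ?thesis unfolding l_def by (rule LeastI)
  qed
  have l_le: "l a \<le> n" if "near n a" for a n
    using that unfolding l_def by (rule Least_le)
  have l_ball: "l a \<le> n" if "a \<in> word_ball G S n" for a n
  proof (rule l_le)
    have "a \<in> carrier G" using that RA car by blast
    then show "near n a"
      unfolding near_def using that subgroup.one_closed [OF assms(3)]
      by (intro bexI [of _ a]) auto
  qed
  have l_coset: "l a = l b" if "a \<in> A" "b \<in> A" "inv a \<otimes> b \<in> B" for a b
  proof -
    have "near n b" if "near n a" for n
    proof -
      obtain t where t: "t \<in> word_ball G S n" "inv t \<otimes> a \<in> B"
        using \<open>near n a\<close> unfolding near_def by blast
      have "inv t \<otimes> a \<otimes> (inv a \<otimes> b) \<in> B"
        using t \<open>inv a \<otimes> b \<in> B\<close> assms(3) by (simp add: subgroup.m_closed)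
      moreover have "t \<in> carrier G" using t RA car by blast
      ultimately have "inv t \<otimes> b \<in> B"
        using \<open>a \<in> A\<close> \<open>b \<in> A\<close> car by (simp add: group_norm)
      then show ?thesis using t unfolding near_def by blast
    qed
    moreover have "near n a" if "near n b" for n
    proof -
      obtain t where t: "t \<in> word_ball G S n" "inv t \<otimes> b \<in> B"
        using \<open>near n b\<close> unfolding near_def by blast
      have "inv t \<otimes> b \<otimes> inv (inv a \<otimes> b) \<in> B"
        using t \<open>inv a \<otimes> b \<in> B\<close> assms(3) by (simp add: subgroup.m_closed subgroup.m_inv_closed)
      moreover have "t \<in> carrier G" using t RA car by blast
      ultimately have "inv t \<otimes> a \<in> B"
        using \<open>a \<in> A\<close> \<open>b \<in> A\<close> car by (simp add: group_norm)
      then show ?thesis using t unfolding near_def by blast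
    qed
    ultimately have "near n a \<longleftrightarrow> near n b" for n by blast
    then show ?thesis by (simp add: l_def)
  qed
  have l_step: "l (s \<otimes> a) \<le> Suc (l a)" if s: "s \<in> S" and a: "a \<in> A" for s a
  proof -
    obtain t where t: "t \<in> word_ball G S (l a)" "inv t \<otimes> a \<in> B"
      using near [OF a] unfolding near_def by blast
    have "s \<in> word_ball G S 1"
      using s Scar by (force simp: word_ball_def intro!: bexI [of _ 1])
    then have st: "s \<otimes> t \<in> word_ball G S (Suc (l a))"
      using word_ball_mult [OF Scar, of s 1 t "l a"] t(1) by simp
    have "s \<in> carrier G" "t \<in> carrier G" "a \<in> carrier G"
      using s a t Scar RA car by auto
    then have "inv (s \<otimes> t) \<otimes> (s \<otimes> a) = inv t \<otimes> a"
      by (simp add: group_norm)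
    then show ?thesis
      using st t(2) by (intro l_le) (auto simp: near_def intro!: bexI [of _ "s \<otimes> t"])
  qed
  \<comment> \<open>Elements of word length \<open>n\<close> that realise the distance of their
    coset from \<open>B\<close>.\<close>
  define P where "P = (\<lambda>n. {t \<in> word_ball G S n. l t = n})"
  have PA: "P n \<subseteq> A" for n using RA by (auto simp: P_def)
  have finP: "finite (P n)" for n
    using finite_word_ball [OF S(1)] unfolding P_def by (rule finite_subset [rotated]) blast
  have pred: "\<exists>a\<in>P n. \<exists>s\<in>S. t = s \<otimes> a" if t: "t \<in> P (Suc n)" for n t
  proof -
    obtain m where m: "m \<le> Suc n" "t \<in> word_sphere G S m"
      using t by (auto simp: P_def word_ball_def)
    have "m = Suc n"
    proof (rule ccontr)
      assume "m \<noteq> Suc n"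
      then have "t \<in> word_ball G S n" using m by (auto simp: word_ball_def)
      then have "l t \<le> n" by (rule l_ball)
      then show False using t by (simp add: P_def)
    qed
    then obtain s a where sa: "s \<in> S" "a \<in> word_sphere G S n" "t = s \<otimes> a" using m by auto
    then have a: "a \<in> word_ball G S n" by (auto simp: word_ball_def)
    then have "l a \<le> n" by (rule l_ball)
    moreover have "Suc n \<le> Suc (l a)"
      using l_step [OF sa(1)] a RA t sa(3) by (force simp: P_def)
    ultimately have "a \<in> P n" using a by (simp add: P_def)
    then show ?thesis using sa by blast
  qed
  define par where "par = (\<lambda>n t. SOME a. a \<in> P n \<and> (\<exists>s\<in>S. t = s \<otimes> a))"
  have par: "par n t \<in> P n \<and> (\<exists>s\<in>S. t = s \<otimes> par n t)" if t: "t \<in> P (Suc n)" for n t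
  proof -
    have "\<exists>a. a \<in> P n \<and> (\<exists>s\<in>S. t = s \<otimes> a)" using pred [OF t] by blast
    then show ?thesis unfolding par_def by (rule someI_ex)
  qed
  have neP: "P n \<noteq> {}" for n
  proof -
    \<comment> \<open>Balls are finite, so a bounded distance from \<open>B\<close> would make the
      index finite.\<close>
    have "\<exists>a\<in>A. \<not> near n a"
    proof (rule ccontr)
      assume "\<not> ?thesis"
      then have "fin_index G B A"
        unfolding fin_index_def near_def using finite_word_ball [OF S(1)] RA
        by (intro exI [of _ "word_ball G S n"]) simp
      then show False using assms(5) by blast
    qed
    then obtain a where a: "a \<in> A" "\<not> near n a" by blast
    have na: "n \<le> l a"
    proof (rule ccontr)
      assume "\<not> n \<le> l a"
      then have "near n a"
        using near [OF a(1)] word_ball_mono [of "l a" n G S] unfolding near_def by auto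
      then show False using a by blast
    qed
    obtain t where t: "t \<in> word_ball G S (l a)" "inv t \<otimes> a \<in> B"
      using near [OF a(1)] unfolding near_def by blast
    have "P (l a) \<noteq> {}"
      using l_coset [of t a] t a(1) RA by (auto simp: P_def)
    \<comment> \<open>A shortest representative exists at level \<open>l a\<close>, which is at
      least \<open>n\<close>; taking parents brings it down to level \<open>n\<close>.\<close>
    with na show ?thesis
      by (induction n rule: inc_induct) (use par in blast)+
  qed
  obtain \<gamma> where \<gamma>: "\<And>n. \<gamma> n \<in> P n" "\<And>n. par n (\<gamma> (Suc n)) = \<gamma> n"
    using koenig [of P par] finP neP par by metis
  show ?thesis
  proof (rule that [of S \<gamma>])
    show "\<gamma> (Suc n) \<otimes> inv (\<gamma> n) \<in> S" for n
    proof -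
      obtain s where s: "s \<in> S" "\<gamma> (Suc n) = s \<otimes> \<gamma> n"
        using par [OF \<gamma>(1) [of "Suc n"]] \<gamma>(2) by auto
      have "s \<in> carrier G" "\<gamma> n \<in> carrier G" using s \<gamma>(1) PA Scar car by blast+
      then show ?thesis using s by (simp add: m_assoc)
    qed
    show "m = n" if "inv (\<gamma> m) \<otimes> \<gamma> n \<in> B" for m n
    proof -
      have "l (\<gamma> m) = l (\<gamma> n)" using l_coset that \<gamma>(1) PA by blast
      then show ?thesis using \<gamma>(1) by (auto simp: P_def)
    qed
  qed (use S(1,2) \<gamma>(1) PA in blast)+
qed

section \<open>Lipschitz maps from quadrants to coset graphs\<close>

lemma relpow_word_sphere:
  assumes "subgroup H G" "S \<subseteq> H" "x \<in> word_sphere G S n" "h \<in> H"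
  shows "(h <# K, (x \<otimes> h) <# K) \<in> {(h <# K, (s \<otimes> h) <# K) | h s. h \<in> H \<and> s \<in> S} ^^ n"
  using assms(3)
proof (induction n arbitrary: x)
  case 0
  then show ?case using assms subgroup_in by auto
next
  case (Suc n)
  then obtain s a where sa: "s \<in> S" "a \<in> word_sphere G S n" "x = s \<otimes> a" by auto
  have "a \<in> H"
    using sa(2) word_sphere_in_generate generate_subgroup_incl [OF assms(2,1)] by blast
  then have ah: "a \<otimes> h \<in> H" "x \<otimes> h = s \<otimes> (a \<otimes> h)"
    using assms sa subgroup_in [OF assms(1)] by (auto simp: m_assoc subgroup.m_closed subset_iff)
  then show ?case
    using Suc.IH [OF sa(2)] sa(1) by (auto intro!: relpow_Suc_I)
qed

lemma l_coset_eqD: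
  assumes "subgroup K G" "g \<in> carrier G" "h \<in> carrier G" "g <# K = h <# K"
  shows "inv g \<otimes> h \<in> K"
proof -
  have "h \<in> h <# K"
    using subgroup.one_closed [OF assms(1)] assms(3) unfolding l_coset_def
    by (auto intro!: bexI [of _ \<one>])
  then obtain k where "k \<in> K" "h = g \<otimes> k"
    using assms(4) unfolding l_coset_def by auto
  then show ?thesis
    using assms(1,2) subgroup_in by (simp add: group_norm)
qed

text \<open>A grid point is sent to the coset of the product of the \<open>\<gamma> i (a i)\<close>.
  Since different rays commute, a change of coordinates multiplies the product on the left by a word
  of length linear in the \<open>l1dist\<close>. The hypothesis \<open>inj\<close> makes all fibres
  on the grid have at most one point.\<close>

lemma leud_ge:
  assumes H: "subgroup H G" and S: "S \<subseteq> H" "\<And>s. s \<in> S \<Longrightarrow> inv s \<in> S" "generate G S = H"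
    and K: "subgroup K G"
    and F: "\<And>i. i < k \<Longrightarrow> finite (F i)" "\<And>i. i < k \<Longrightarrow> F i \<subseteq> H"
    and \<gamma>: "\<And>i n. \<gamma> i n \<in> H" "\<And>i n. i < k \<Longrightarrow> \<gamma> i (Suc n) \<otimes> inv (\<gamma> i n) \<in> F i"
    and comm: "\<And>i j m n. i < k \<Longrightarrow> j < k \<Longrightarrow> i \<noteq> j \<Longrightarrow> \<gamma> i m \<otimes> \<gamma> j n = \<gamma> j n \<otimes> \<gamma> i m"
    and inj: "\<And>a b i. inv (lprod G (\<lambda>i. \<gamma> i (a i)) k) \<otimes> lprod G (\<lambda>i. \<gamma> i (b i)) k \<in> K
                \<Longrightarrow> i < k \<Longrightarrow> a i = b i"
  shows "enat k \<le> leud {h <# K | h. h \<in> H} {(h <# K, (s \<otimes> h) <# K) | h s. h \<in> H \<and> s \<in> S}"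
proof -
  let ?E = "{(h <# K, (s \<otimes> h) <# K) | h s. h \<in> H \<and> s \<in> S}"
  have car: "x \<in> H \<Longrightarrow> x \<in> carrier G" for x using H subgroup_in by blast
  have Scar: "S \<subseteq> carrier G" using S(1) car by blast
  \<comment> \<open>Inverses are included because coordinates may also decrease.\<close>
  define F' where "F' = (\<Union>i<k. F i \<union> m_inv G ` F i)"
  have "finite F'" "F' \<subseteq> generate G S"
    using F S(3) subgroup.m_inv_closed [OF H] by (auto simp: F'_def)
  \<comment> \<open>\<open>C\<close> bounds the word length of one step along any of the rays and
    becomes the Lipschitz constant.\<close>
  then obtain C where C: "F' \<subseteq> word_ball G S C"
    using finite_subset_word_ball [OF Scar S(2)] by blast
  have up: "\<gamma> i (n + m) \<otimes> inv (\<gamma> i n) \<in> word_ball G S (C * m)" if i: "i < k" for i m n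
  proof (induction m)
    case 0
    then show ?case using car \<gamma>(1) one_in_word_ball by simp
  next
    case (Suc m)
    have "\<gamma> i (Suc (n + m)) \<otimes> inv (\<gamma> i (n + m)) \<in> word_ball G S C"
      using C \<gamma>(2) [OF i] i by (auto simp: F'_def)
    from word_ball_mult [OF Scar this Suc]
    show ?case using car \<gamma>(1) by (simp add: group_norm)
  qed
  have down: "\<gamma> i n \<otimes> inv (\<gamma> i (n + m)) \<in> word_ball G S (C * m)" if i: "i < k" for i m n
  proof (induction m)
    case 0
    then show ?case using car \<gamma>(1) one_in_word_ball by simp
  next
    case (Suc m)
    have "inv (\<gamma> i (Suc (n + m)) \<otimes> inv (\<gamma> i (n + m))) \<in> word_ball G S C"
      using C \<gamma>(2) [OF i] i by (auto simp: F'_def)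
    from word_ball_mult [OF Scar Suc this]
    show ?case using car \<gamma>(1) by (simp add: group_norm add.commute)
  qed
  have step: "\<gamma> i b \<otimes> inv (\<gamma> i a) \<in> word_ball G S (C * nat \<bar>int a - int b\<bar>)" if i: "i < k" for i a b
  proof (cases "a \<le> b")
    case True
    then show ?thesis using up [OF i, of a "b - a"] by (simp add: nat_diff_distrib)
  next
    case False
    then have "b + (a - b) = a" "nat \<bar>int a - int b\<bar> = a - b" by auto
    then show ?thesis using down [OF i, of b "a - b"] by metis
  qed
  define P where "P = (\<lambda>a. lprod G (\<lambda>i. \<gamma> i (a i)))"
  have PH: "P a j \<in> H" for a j
    unfolding P_def by (induction j) (auto simp: \<gamma>(1) subgroup.m_closed [OF H] subgroup.one_closed [OF H])
  have Pcar: "P a j \<in> carrier G" "\<gamma> i n \<in> carrier G" for a j i n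
    using PH \<gamma>(1) car by auto
  have Pcomm: "P a j \<otimes> \<gamma> i n = \<gamma> i n \<otimes> P a j" if "j \<le> i" "i < k" for a i j n
    using that(1)
  proof (induction j)
    case 0
    then show ?case using Pcar by (simp add: P_def)
  next
    case (Suc j)
    have "P a (Suc j) \<otimes> \<gamma> i n = \<gamma> j (a j) \<otimes> (P a j \<otimes> \<gamma> i n)"
      using Pcar by (simp add: P_def [abs_def] m_assoc)
    also have "\<dots> = (\<gamma> j (a j) \<otimes> \<gamma> i n) \<otimes> P a j"
      using Suc Pcar by (simp add: m_assoc)
    also have "\<dots> = \<gamma> i n \<otimes> P a (Suc j)"
      using comm [of j i "a j" n] Suc.prems that(2) Pcar by (simp add: P_def [abs_def] m_assoc)
    finally show ?case .
  qed
  \<comment> \<open>Commutation brings the two values of each coordinate together, so the lengths of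
    the separate increments add up.\<close>
  have dist: "P b j \<otimes> inv (P a j) \<in> word_ball G S (C * l1dist j a b)" if "j \<le> k" for a b j
    using that
  proof (induction j)
    case 0
    show ?case using one_in_word_ball by (simp add: P_def)
  next
    case (Suc j)
    let ?t = "P b j \<otimes> inv (P a j)"
    have j: "j < k" using Suc by simp
    have "inv (P a j) \<otimes> inv (\<gamma> j (a j)) = inv (\<gamma> j (a j)) \<otimes> inv (P a j)"
      using Pcomm [of j j a "a j"] Pcar j by (metis inv_mult_group order_refl)
    moreover have "P b j \<otimes> inv (\<gamma> j (a j)) = inv (\<gamma> j (a j)) \<otimes> P b j"
    proof -
      have "P b j = inv (\<gamma> j (a j)) \<otimes> (P b j \<otimes> \<gamma> j (a j))"
        using Pcomm [of j j b "a j"] Pcar j by (simp add: group_norm)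
      then have "P b j \<otimes> inv (\<gamma> j (a j)) = inv (\<gamma> j (a j)) \<otimes> (P b j \<otimes> \<gamma> j (a j)) \<otimes> inv (\<gamma> j (a j))"
        by simp
      then show ?thesis using Pcar by (simp add: m_assoc)
    qed
    ultimately have "P b (Suc j) \<otimes> inv (P a (Suc j)) = (\<gamma> j (b j) \<otimes> inv (\<gamma> j (a j))) \<otimes> ?t"
      using Pcar by (simp add: P_def [abs_def] inv_mult_group m_assoc [symmetric]) (simp add: m_assoc)
    moreover have "(\<gamma> j (b j) \<otimes> inv (\<gamma> j (a j))) \<otimes> ?t
        \<in> word_ball G S (C * nat \<bar>int (a j) - int (b j)\<bar> + C * l1dist j a b)"
      using Suc step [OF j] by (intro word_ball_mult [OF Scar]) auto
    ultimately show ?case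
      by (simp add: l1dist_def algebra_simps)
  qed
  define f where "f = (\<lambda>a. P a k <# K)"
  have lip: "gdist ?E (f a) (f b) \<le> enat (C * l1dist k a b)" for a b
  proof -
    obtain n where n: "n \<le> C * l1dist k a b" "P b k \<otimes> inv (P a k) \<in> word_sphere G S n"
      using dist [of k b a] by (auto simp: word_ball_def)
    have "(P b k \<otimes> inv (P a k)) \<otimes> P a k = P b k"
      using Pcar by (simp add: m_assoc)
    then have "(f a, f b) \<in> ?E ^^ n"
      using relpow_word_sphere [OF H S(1) n(2) PH [of a k], of K] by (simp add: f_def)
    then have "gdist ?E (f a) (f b) \<le> enat n"
      unfolding gdist_def by (intro INF_lower) simp
    then show ?thesis
      using n(1) by (meson enat_ord_simps(1) order_trans)
  qed
  have f_inj: "a = b" if "a \<in> grid k" "b \<in> grid k" "f a = f b" for a b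
  proof
    fix i
    have "inv (P a k) \<otimes> P b k \<in> K"
      using that(3) Pcar by (intro l_coset_eqD [OF K]) (auto simp: f_def)
    \<comment> \<open>Coordinates from \<open>k\<close> on vanish on the grid.\<close>
    then show "a i = b i"
      using inj [of a b i] that(1,2) by (cases "i < k") (auto simp: P_def grid_def)
  qed
  have fib: "finite {a \<in> grid k. f a = v} \<and> card {a \<in> grid k. f a = v} \<le> 1" for v
  proof (cases "{a \<in> grid k. f a = v} = {}")
    case True
    show ?thesis unfolding True by simp
  next
    case False
    then obtain a where "a \<in> grid k" "f a = v" by auto
    then have "{a \<in> grid k. f a = v} = {a}" using f_inj by auto
    then show ?thesis by simp
  qed
  show ?thesis
    unfolding leud_def
  proof (rule Sup_upper, intro CollectI exI conjI)
    show "f ` grid k \<subseteq> {h <# K | h. h \<in> H}"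
      using PH by (auto simp: f_def)
    show "\<forall>a\<in>grid k. \<forall>b\<in>grid k. gdist ?E (f a) (f b) \<le> enat (C * l1dist k a b)"
      using lip by blast
    show "\<forall>v. finite {a \<in> grid k. f a = v} \<and> card {a \<in> grid k. f a = v} \<le> 1"
      using fib by blast
  qed simp
qed

end

section \<open>Rigid stabilisers\<close>

text \<open>The ambient group is a structure parameter, identified with \<open>BijGroup V\<close> by
  an equation, so that the group notation needs no subscripts.\<close>

locale tree_group = group B for B (structure) +
  fixes V :: "nat list set" and G :: "(nat list \<Rightarrow> nat list) set"
  assumes B_eq: "B = BijGroup V"
    and tree: "rooted_lf_tree V"
    and subgroup_G: "subgroup G B"
    and aut_G: "\<And>g. g \<in> G \<Longrightarrow> tree_aut V g"
begin

abbreviation R :: "nat list \<Rightarrow> (nat list \<Rightarrow> nat list) set" where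
  "R v \<equiv> rist V G v"

definition below :: "nat list \<Rightarrow> nat list \<Rightarrow> bool" where
  "below v x \<longleftrightarrow> x \<in> V \<and> take (length v) x = v"

text \<open>The counterpart of \<open>R v\<close>: the two commute and intersect trivially, so their
  product is direct.\<close>

definition fixing :: "nat list \<Rightarrow> (nat list \<Rightarrow> nat list) set" where
  "fixing v = {g \<in> G. \<forall>x. below v x \<longrightarrow> g x = x}"

definition incomparable :: "nat list \<Rightarrow> nat list \<Rightarrow> bool" where
  "incomparable u v \<longleftrightarrow> take (length v) u \<noteq> v \<and> take (length u) v \<noteq> u"

lemma carrier_B: "carrier B = Bij V"
  by (simp add: B_eq BijGroup_def)

lemma G_carrier: "g \<in> G \<Longrightarrow> g \<in> carrier B"
  using subgroup_G by (rule subgroup_in)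

lemma G_closed:
  "g \<in> G \<Longrightarrow> h \<in> G \<Longrightarrow> g \<otimes> h \<in> G" "g \<in> G \<Longrightarrow> inv g \<in> G" "\<one> \<in> G"
  using subgroup_G by (simp_all add: subgroup.m_closed subgroup.m_inv_closed subgroup.one_closed)

lemma one_app: "x \<in> V \<Longrightarrow> \<one> x = x"
  by (simp add: B_eq BijGroup_def)

lemma mult_app: "g \<in> carrier B \<Longrightarrow> h \<in> carrier B \<Longrightarrow> x \<in> V \<Longrightarrow> (g \<otimes> h) x = g (h x)"
  by (simp add: B_eq BijGroup_def compose_def)

lemma app_V: "g \<in> carrier B \<Longrightarrow> x \<in> V \<Longrightarrow> g x \<in> V"
  by (metis carrier_B Bij_imp_funcset funcset_mem)

lemma inv_app:
  assumes "g \<in> carrier B" "x \<in> V"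
  shows "(inv g) (g x) = x" "g ((inv g) x) = x"
  using mult_app [of "inv g" g x] mult_app [of g "inv g" x] assms by (simp_all add: one_app)

lemma B_ext: "g \<in> carrier B \<Longrightarrow> h \<in> carrier B \<Longrightarrow> (\<And>x. x \<in> V \<Longrightarrow> g x = h x) \<Longrightarrow> g = h"
  by (metis Bij_imp_extensional carrier_B extensionalityI)

lemma app_inj: "g \<in> carrier B \<Longrightarrow> x \<in> V \<Longrightarrow> y \<in> V \<Longrightarrow> g x = g y \<longleftrightarrow> x = y"
  by (metis inv_app(1))

lemma take_V: "x \<in> V \<Longrightarrow> take k x \<in> V"
  using tree by (simp add: rooted_lf_tree_def)

lemma Nil_V: "[] \<in> V"
  using tree by (simp add: rooted_lf_tree_def)

lemma butlast_app: "g \<in> G \<Longrightarrow> x \<in> V \<Longrightarrow> x \<noteq> [] \<Longrightarrow> g (butlast x) = butlast (g x)"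
  using aut_G by (auto simp: tree_aut_def)

lemma Nil_app: "g \<in> G \<Longrightarrow> g [] = []"
  using aut_G by (auto simp: tree_aut_def)

lemma length_app:
  assumes "g \<in> G" "x \<in> V"
  shows "length (g x) = length x"
  using assms(2)
proof (induction x rule: rev_induct)
  case Nil
  then show ?case using Nil_app assms(1) by simp
next
  case (snoc i x)
  have x: "x \<in> V" using take_V [OF snoc(2), of "length x"] by simp
  have "g (x @ [i]) \<noteq> []"
    using app_inj [OF G_carrier [OF assms(1)] snoc(2) Nil_V] Nil_app [OF assms(1)] by simp
  moreover have "length (butlast (g (x @ [i]))) = length x"
    using butlast_app [OF assms(1) snoc(2)] snoc(1) [OF x] by simp
  ultimately show ?case by (cases "g (x @ [i])" rule: rev_cases) auto
qed

lemma take_app: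
  assumes "g \<in> G" "x \<in> V"
  shows "g (take k x) = take k (g x)"
  using assms(2)
proof (induction x rule: rev_induct)
  case Nil
  then show ?case using Nil_app [OF assms(1)] by simp
next
  case (snoc i x)
  have x: "x \<in> V" using take_V [OF snoc(2), of "length x"] by simp
  have len: "length (g (x @ [i])) = Suc (length x)"
    using length_app [OF assms(1) snoc(2)] by simp
  show ?case
  proof (cases "k \<le> length x")
    case True
    have "take k (g (x @ [i])) = take k (butlast (g (x @ [i])))"
      using True len by (simp add: take_butlast)
    then show ?thesis
      using True snoc(1) [OF x] butlast_app [OF assms(1) snoc(2)] by simp
  qed (use len in simp)
qed

lemma below_refl: "v \<in> V \<Longrightarrow> below v v"
  by (simp add: below_def)

lemma below_V: "below v x \<Longrightarrow> x \<in> V"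
  by (simp add: below_def)

lemma below_length: "below v x \<Longrightarrow> length v \<le> length x"
  by (metis below_def nle_le take_all)

lemma below_trans: "below u v \<Longrightarrow> below v x \<Longrightarrow> below u x"
  by (metis below_def below_length min.absorb1 take_take)

lemma below_app:
  assumes "g \<in> G" "v \<in> V" "x \<in> V"
  shows "below (g v) (g x) \<longleftrightarrow> below v x"
proof -
  have "take (length (g v)) (g x) = g (take (length v) x)"
    using assms by (simp add: length_app take_app)
  then show ?thesis
    using assms app_inj [OF G_carrier [OF assms(1)] take_V [OF assms(3)] assms(2)]
    by (simp add: below_def app_V G_carrier)
qed

lemma R_iff: "g \<in> R v \<longleftrightarrow> g \<in> G \<and> (\<forall>x\<in>V. \<not> below v x \<longrightarrow> g x = x)"
  by (auto simp: rist_def below_def)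

lemma R_G: "a \<in> R v \<Longrightarrow> a \<in> G"
  by (simp add: rist_def)

lemma R_carrier: "a \<in> R v \<Longrightarrow> a \<in> carrier B"
  by (simp add: R_G G_carrier)

lemma fixing_G: "c \<in> fixing v \<Longrightarrow> c \<in> G"
  by (simp add: fixing_def)

lemma fixing_carrier: "c \<in> fixing v \<Longrightarrow> c \<in> carrier B"
  by (simp add: fixing_G G_carrier)

lemma subgroup_fixing_set:
  assumes "\<And>x. P x \<Longrightarrow> x \<in> V"
  shows "subgroup {g \<in> G. \<forall>x. P x \<longrightarrow> g x = x} B"
proof (rule subgroupI)
  show "{g \<in> G. \<forall>x. P x \<longrightarrow> g x = x} \<noteq> {}"
    using G_closed(3) one_app assms by blast
  fix a b assume "a \<in> {g \<in> G. \<forall>x. P x \<longrightarrow> g x = x}" "b \<in> {g \<in> G. \<forall>x. P x \<longrightarrow> g x = x}"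
  then show "a \<otimes> b \<in> {g \<in> G. \<forall>x. P x \<longrightarrow> g x = x}"
    using assms by (simp add: G_closed mult_app G_carrier)
next
  fix a assume a: "a \<in> {g \<in> G. \<forall>x. P x \<longrightarrow> g x = x}"
  then have "(inv a) x = x" if "P x" for x
    using inv_app(1) [of a x] assms that by (simp add: G_carrier)
  then show "inv a \<in> {g \<in> G. \<forall>x. P x \<longrightarrow> g x = x}"
    using a by (simp add: G_closed)
qed (auto simp: G_carrier)

lemma subgroup_fixing: "subgroup (fixing v) B"
  unfolding fixing_def by (rule subgroup_fixing_set) (rule below_V)

lemma subgroup_R: "subgroup (R v) B"
proof -
  have "R v = {g \<in> G. \<forall>x. x \<in> V \<and> \<not> below v x \<longrightarrow> g x = x}"
    by (auto simp: R_iff)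
  then show ?thesis
    using subgroup_fixing_set [of "\<lambda>x. x \<in> V \<and> \<not> below v x"] by simp
qed

lemma R_closed:
  "g \<in> R v \<Longrightarrow> h \<in> R v \<Longrightarrow> g \<otimes> h \<in> R v" "g \<in> R v \<Longrightarrow> inv g \<in> R v" "\<one> \<in> R v"
  using subgroup_R by (simp_all add: subgroup.m_closed subgroup.m_inv_closed subgroup.one_closed)

lemma fixing_closed:
  "g \<in> fixing v \<Longrightarrow> h \<in> fixing v \<Longrightarrow> g \<otimes> h \<in> fixing v"
  "g \<in> fixing v \<Longrightarrow> inv g \<in> fixing v" "\<one> \<in> fixing v"
  using subgroup_fixing
  by (simp_all add: subgroup.m_closed subgroup.m_inv_closed subgroup.one_closed)

text \<open>A vertex outside the subtree is fixed by \<open>a\<close>, so if \<open>a x\<close> were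
  outside, injectivity would force \<open>a x = x\<close>.\<close>

lemma R_below:
  assumes "a \<in> R v" "below v x"
  shows "below v (a x)"
proof (rule ccontr)
  assume n: "\<not> below v (a x)"
  have x: "x \<in> V" "a x \<in> V" using assms app_V R_carrier below_V by auto
  then have "a (a x) = a x" using n assms(1) by (simp add: R_iff)
  then have "a x = x" using app_inj R_carrier [OF assms(1)] x by simp
  then show False using n assms(2) by simp
qed

lemma R_app_self:
  assumes "a \<in> R v" "v \<in> V"
  shows "a v = v"
proof -
  have "below v (a v)" using R_below assms below_refl by simp
  then show ?thesis
    using length_app [OF R_G [OF assms(1)] assms(2)] by (simp add: below_def)
qed

lemma R_eqI:
  assumes "a \<in> R v" "b \<in> R v" "\<And>x. below v x \<Longrightarrow> a x = b x"
  shows "a = b"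
proof (rule B_ext)
  show "a x = b x" if "x \<in> V" for x
    using that assms by (cases "below v x") (auto simp: R_iff)
qed (use assms R_carrier in auto)

lemma R_ne_one_moves:
  assumes "a \<in> R v" "a \<noteq> \<one>"
  obtains x where "below v x" "a x \<noteq> x"
  using R_eqI [OF assms(1) R_closed(3)] assms(2) one_app below_V by metis

lemma R_Int_fixing: "a \<in> R v \<Longrightarrow> a \<in> fixing v \<Longrightarrow> a = \<one>"
  by (rule R_eqI [of a v]) (auto simp: fixing_def R_closed one_app below_V)

text \<open>Both elements preserve the subtree below \<open>v\<close> and its complement, and on
  each of these pieces one of them is the identity.\<close>

lemma R_fixing_commute:
  assumes "a \<in> R v" "c \<in> fixing v"
  shows "a \<otimes> c = c \<otimes> a"
proof (rule B_ext)
  have car: "a \<in> carrier B" "c \<in> carrier B"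
    using assms R_carrier fixing_carrier by auto
  then show "a \<otimes> c \<in> carrier B" "c \<otimes> a \<in> carrier B" by auto
  fix x assume x: "x \<in> V"
  show "(a \<otimes> c) x = (c \<otimes> a) x"
  proof (cases "below v x")
    case True
    then show ?thesis
      using x assms R_below [OF assms(1) True] car by (simp add: mult_app fixing_def)
  next
    case False
    have "\<not> below v (c x)"
    proof
      assume b: "below v (c x)"
      then have "c (c x) = c x" using assms(2) by (simp add: fixing_def)
      then have "c x = x" using app_inj car x app_V by simp
      then show False using b False by simp
    qed
    then show ?thesis
      using x False assms(1) car by (simp add: mult_app R_iff app_V)
  qed
qed

lemma R_mono:
  assumes "below v w"
  shows "R w \<subseteq> R v"
  using below_trans [OF assms] unfolding R_iff subset_iff by blast

lemma incomparable_R_fixing: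
  assumes "incomparable u v"
  shows "R u \<subseteq> fixing v"
proof
  fix a assume a: "a \<in> R u"
  have "a x = x" if x: "below v x" for x
  proof -
    have "\<not> below u x"
    proof
      assume "below u x"
      then have "take (length v) u = v \<or> take (length u) v = u"
        using x by (metis below_def min.absorb1 nle_le take_take)
      then show False using assms by (auto simp: incomparable_def)
    qed
    then show ?thesis using a x below_V by (simp add: R_iff)
  qed
  then show "a \<in> fixing v" using R_G [OF a] by (simp add: fixing_def)
qed

lemma incomparable_same_length:
  "length u = length v \<Longrightarrow> u \<noteq> v \<Longrightarrow> incomparable u v"
  by (simp add: incomparable_def)

lemma R_conj:
  assumes "g \<in> G" "v \<in> V" "a \<in> R v"
  shows "g \<otimes> a \<otimes> inv g \<in> R (g v)"
proof -
  have car: "g \<in> carrier B" "a \<in> carrier B" using assms G_carrier R_carrier by auto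
  have "(g \<otimes> a \<otimes> inv g) x = x" if x: "x \<in> V" "\<not> below (g v) x" for x
  proof -
    have y: "(inv g) x \<in> V" "g ((inv g) x) = x"
      using x car by (auto simp: app_V inv_app)
    then have "\<not> below v ((inv g) x)"
      using below_app [OF assms(1,2) y(1)] x(2) by simp
    then have "a ((inv g) x) = (inv g) x" using assms(3) y(1) by (simp add: R_iff)
    then show ?thesis using car x(1) y by (simp add: mult_app app_V)
  qed
  then show ?thesis
    using assms R_G by (simp add: R_iff G_closed)
qed

lemma derived_R_conj:
  assumes "g \<in> G" "v \<in> V" "x \<in> derived B (R v)"
  shows "g \<otimes> x \<otimes> inv g \<in> derived B (R (g v))"
  using R_carrier R_conj [OF assms(1,2)] assms(1,3)
  by (intro derived_conj_subset [of g "R v" "R (g v)"]) (auto simp: G_carrier)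

text \<open>The conjugate of \<open>a\<close> is supported below \<open>g w\<close>, another vertex
  of the same level, so below \<open>w\<close> the commutator sees only
  \<open>inv a\<close>.\<close>

lemma commutator_fixing:
  assumes "g \<in> G" "w \<in> V" "g w \<noteq> w" "a \<in> R w"
  obtains k where "k \<in> fixing w" "g \<otimes> a \<otimes> inv g \<otimes> inv a = inv a \<otimes> k"
proof -
  have "g \<otimes> a \<otimes> inv g \<in> R (g w)"
    using assms by (simp add: R_conj)
  moreover have "R (g w) \<subseteq> fixing w"
    using assms by (intro incomparable_R_fixing incomparable_same_length) (auto simp: length_app)
  ultimately have k: "g \<otimes> a \<otimes> inv g \<in> fixing w" by blast
  then have "g \<otimes> a \<otimes> inv g \<otimes> inv a = inv a \<otimes> (g \<otimes> a \<otimes> inv g)"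
    using R_fixing_commute [OF R_closed(2) [OF assms(4)] k] by simp
  then show ?thesis using that k by blast
qed

text \<open>The double commutator trick: on the subtree at a moved vertex, \<open>[l, a]\<close> acts as
  \<open>a\<close> inverse.\<close>

lemma double_commutator:
  assumes "subgroup L B" "L \<subseteq> G" "subgroup N B" "l \<in> L" "u \<in> V" "l u \<noteq> u"
    and norm: "\<And>n x. n \<in> N \<Longrightarrow> x \<in> L \<Longrightarrow> n \<otimes> x \<otimes> inv n \<in> L"
  shows "derived B (N \<inter> R u) \<subseteq> L"
proof -
  have comm: "a \<otimes> b \<otimes> inv a \<otimes> inv b \<in> L"
    if a: "a \<in> N" "a \<in> R u" and b: "b \<in> N" "b \<in> R u" for a b
  proof -
    have car: "a \<in> carrier B" "b \<in> carrier B" "l \<in> carrier B"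
      using a b assms(1,4) R_carrier subgroup_in by auto
    \<comment> \<open>Starting from \<open>inv a\<close> makes \<open>p\<close> agree with
      \<open>a\<close> below \<open>u\<close>, hence \<open>p\<close> and \<open>a\<close> have the
      same commutator with \<open>b\<close>.\<close>
    define p where "p = l \<otimes> inv a \<otimes> inv l \<otimes> a"
    have "inv a \<in> R u" using a by (simp add: R_closed)
    then obtain k where k: "k \<in> fixing u" "p = a \<otimes> k"
      using commutator_fixing [of l u "inv a"] assms(2,4,5,6) car unfolding p_def by auto
    have kcar: "k \<in> carrier B" using k fixing_carrier by auto
    have "inv a \<in> N" using a assms(3) by (simp add: subgroup.m_inv_closed)
    then have "l \<otimes> (inv a \<otimes> inv l \<otimes> inv (inv a)) \<in> L"
      using norm assms(1,4) by (simp add: subgroup.m_closed subgroup.m_inv_closed)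
    then have pL: "p \<in> L" using car by (simp add: p_def group_norm)
    then have "p \<otimes> (b \<otimes> inv p \<otimes> inv b) \<in> L"
      using norm [OF b(1)] assms(1) by (simp add: subgroup.m_closed subgroup.m_inv_closed)
    moreover have "p \<otimes> (b \<otimes> inv p \<otimes> inv b) = a \<otimes> (k \<otimes> b) \<otimes> inv k \<otimes> inv a \<otimes> inv b"
      using car kcar by (simp add: k(2) group_norm)
    moreover have "\<dots> = a \<otimes> b \<otimes> inv a \<otimes> inv b"
      using car kcar by (simp add: R_fixing_commute [OF b(2) k(1), symmetric] group_norm)
    ultimately show ?thesis by simp
  qed
  then show ?thesis
    unfolding derived_def using assms(1) by (intro generate_subgroup_incl) auto
qed

text \<open>Only those elements of \<open>K\<close> are projected that split inside
  \<open>G\<close>; an automorphism fixing \<open>v\<close> need not do so.\<close>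

definition rist_proj :: "(nat list \<Rightarrow> nat list) set \<Rightarrow> nat list \<Rightarrow> (nat list \<Rightarrow> nat list) set" where
  "rist_proj K v = {a \<in> R v. \<exists>c\<in>fixing v. a \<otimes> c \<in> K}"

lemma subgroup_rist_proj:
  assumes "subgroup K B"
  shows "subgroup (rist_proj K v) B"
proof (rule subgroupI)
  show "rist_proj K v \<subseteq> carrier B" using R_carrier by (auto simp: rist_proj_def)
  have "\<one> \<otimes> \<one> \<in> K" using subgroup.one_closed [OF assms] by simp
  then have "\<one> \<in> rist_proj K v"
    unfolding rist_proj_def using R_closed(3) fixing_closed(3) by blast
  then show "rist_proj K v \<noteq> {}" by blast
next
  fix a assume "a \<in> rist_proj K v"
  then obtain c where c: "a \<in> R v" "c \<in> fixing v" "a \<otimes> c \<in> K"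
    unfolding rist_proj_def by blast
  have "inv (a \<otimes> c) \<in> K" using c assms by (simp add: subgroup.m_inv_closed)
  moreover have "inv (a \<otimes> c) = inv a \<otimes> inv c"
    using R_fixing_commute [OF c(1,2)] c R_carrier fixing_carrier by (simp add: inv_mult_group)
  ultimately show "inv a \<in> rist_proj K v"
    unfolding rist_proj_def using c R_closed fixing_closed by auto
next
  fix a b assume "a \<in> rist_proj K v" "b \<in> rist_proj K v"
  then obtain c d where c: "a \<in> R v" "c \<in> fixing v" "a \<otimes> c \<in> K"
    and d: "b \<in> R v" "d \<in> fixing v" "b \<otimes> d \<in> K"
    unfolding rist_proj_def by blast
  have car: "a \<in> carrier B" "b \<in> carrier B" "c \<in> carrier B" "d \<in> carrier B"
    using c d R_carrier fixing_carrier by auto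
  have "a \<otimes> b \<otimes> (c \<otimes> d) = a \<otimes> (b \<otimes> c) \<otimes> d"
    using car by (simp add: m_assoc)
  also have "\<dots> = (a \<otimes> c) \<otimes> (b \<otimes> d)"
    using car by (simp add: R_fixing_commute [OF d(1) c(2)] m_assoc)
  finally have "a \<otimes> b \<otimes> (c \<otimes> d) \<in> K" using c d assms by (simp add: subgroup.m_closed)
  then show "a \<otimes> b \<in> rist_proj K v"
    unfolding rist_proj_def using c d R_closed fixing_closed by blast
qed

text \<open>The factor \<open>c\<close> commutes with \<open>R v\<close>, so \<open>a\<close> acts
  on \<open>K \<inter> R v\<close> by conjugation just as the element \<open>a \<otimes> c\<close>
  of \<open>K\<close> does.\<close>

lemma rist_proj_normalises:
  assumes "subgroup K B" "a \<in> rist_proj K v" "l \<in> K \<inter> R v"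
  shows "a \<otimes> l \<otimes> inv a \<in> K \<inter> R v"
proof -
  obtain c where c: "a \<in> R v" "c \<in> fixing v" "a \<otimes> c \<in> K"
    using assms(2) unfolding rist_proj_def by blast
  have car: "a \<in> carrier B" "c \<in> carrier B" "l \<in> carrier B"
    using c assms R_carrier fixing_carrier by auto
  have "(a \<otimes> c) \<otimes> l \<otimes> inv (a \<otimes> c) \<in> K"
    using c assms by (simp add: subgroup.m_closed subgroup.m_inv_closed)
  moreover have "(a \<otimes> c) \<otimes> l \<otimes> inv (a \<otimes> c) = a \<otimes> (c \<otimes> l) \<otimes> inv c \<otimes> inv a"
    using car by (simp add: group_norm)
  moreover have "c \<otimes> l = l \<otimes> c"
    using R_fixing_commute [of l v c] c assms(3) by simp
  ultimately have "a \<otimes> (l \<otimes> c) \<otimes> inv c \<otimes> inv a \<in> K"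
    by simp
  moreover have "a \<otimes> (l \<otimes> c) \<otimes> inv c \<otimes> inv a = a \<otimes> l \<otimes> inv a"
    using car by (simp add: group_norm)
  ultimately show ?thesis
    using c assms(3) R_closed by simp
qed

end

section \<open>Branch groups\<close>

locale branch_tree_group = tree_group +
  assumes fin_gen_G: "fin_gen B G" and branch: "branch_group V G"
begin

lemma transitive:
  assumes "u \<in> V" "w \<in> V" "length u = length w"
  obtains g where "g \<in> G" "g u = w"
proof -
  have "u \<in> level V (length w)" "w \<in> level V (length w)"
    using assms by (auto simp: level_def)
  then show ?thesis
    using branch that unfolding branch_group_def by blast
qed

lemma R_subset_rist_level: "v \<in> level V n \<Longrightarrow> R v \<subseteq> rist_level V G n"
  unfolding rist_level_def by (auto intro: generate.incl)

lemma rist_union_carrier: "(\<Union>v\<in>level V n. R v) \<subseteq> carrier B"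
  using R_carrier by blast

lemma rist_level_generate: "rist_level V G n = generate B (\<Union>v\<in>level V n. R v)"
  by (simp add: rist_level_def B_eq)

lemma subgroup_rist_level: "subgroup (rist_level V G n) B"
  unfolding rist_level_generate by (rule generate_is_subgroup [OF rist_union_carrier])

lemma rist_level_subset_G: "rist_level V G n \<subseteq> G"
  unfolding rist_level_generate
  by (rule generate_subgroup_incl [OF _ subgroup_G]) (use R_G in blast)

lemma fin_index_rist_level: "1 \<le> n \<Longrightarrow> fin_index B (rist_level V G n) G"
  using branch unfolding branch_group_def
  by (intro fin_index_rcosets subgroup_G subgroup_rist_level rist_level_subset_G) (simp add: B_eq)

text \<open>Because the two factors commute, splitting is multiplicative. Keeping the first factor
  in the subgroup generated by the \<open>\<alpha> s\<close> is what transfers finite generation to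
  \<open>R v\<close>.\<close>

lemma generate_R_fixing_decomp:
  assumes "g \<in> generate B S"
    and dec: "\<And>s. s \<in> S \<Longrightarrow> \<alpha> s \<in> R v \<and> \<kappa> s \<in> fixing v \<and> s = \<alpha> s \<otimes> \<kappa> s"
  shows "\<exists>a\<in>generate B (\<alpha> ` S). \<exists>c\<in>fixing v. g = a \<otimes> c"
proof -
  have sub: "generate B (\<alpha> ` S) \<subseteq> R v"
    using dec by (intro generate_subgroup_incl subgroup_R) auto
  show ?thesis
    using assms(1)
  proof (induction g rule: generate.induct)
    case one
    show ?case
      by (intro bexI [of _ \<one>]) (auto simp: fixing_closed intro: generate.one)
  next
    case (incl h)
    then show ?case
      using dec [OF incl] by (auto intro: generate.incl)
  next
    case (inv h)
    have h: "\<alpha> h \<in> R v" "\<kappa> h \<in> fixing v" "h = \<alpha> h \<otimes> \<kappa> h" using dec [OF inv] by auto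
    have "inv h = inv (\<kappa> h \<otimes> \<alpha> h)"
      using h(3) R_fixing_commute [OF h(1,2)] by simp
    also have "\<dots> = inv (\<alpha> h) \<otimes> inv (\<kappa> h)"
      using h(1,2) R_carrier fixing_carrier by (intro inv_mult_group) auto
    finally show ?case
      using inv h by (intro bexI [of _ "inv (\<alpha> h)"] bexI [of _ "inv (\<kappa> h)"])
        (auto simp: fixing_closed intro: generate.inv)
  next
    case (eng g h)
    then obtain a c b d where ac: "a \<in> generate B (\<alpha> ` S)" "c \<in> fixing v" "g = a \<otimes> c"
      and bd: "b \<in> generate B (\<alpha> ` S)" "d \<in> fixing v" "h = b \<otimes> d"
      by blast
    have car: "a \<in> carrier B" "b \<in> carrier B" "c \<in> carrier B" "d \<in> carrier B"
      using ac bd sub R_carrier fixing_carrier by auto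
    have "b \<otimes> c = c \<otimes> b" using R_fixing_commute ac bd sub by blast
    then have "a \<otimes> c \<otimes> (b \<otimes> d) = a \<otimes> (b \<otimes> c) \<otimes> d"
      using car by (simp add: m_assoc)
    also have "\<dots> = (a \<otimes> b) \<otimes> (c \<otimes> d)"
      using car by (simp add: m_assoc)
    finally show ?case
      unfolding ac(3) bd(3)
      by (intro bexI [of _ "a \<otimes> b"] bexI [of _ "c \<otimes> d"])
        (use ac bd fixing_closed(1) generate.eng in auto)
  qed
qed

lemma rist_level_decomp:
  assumes "v \<in> level V n" "g \<in> rist_level V G n"
  obtains a c where "a \<in> R v" "c \<in> fixing v" "g = a \<otimes> c"
proof -
  let ?S = "\<Union>u\<in>level V n. R u"
  \<comment> \<open>A generator of the level group lies in \<open>R v\<close> or in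
    \<open>fixing v\<close>; the unit serves as the other factor.\<close>
  define \<alpha> where "\<alpha> = (\<lambda>s. if s \<in> R v then s else \<one>)"
  define \<kappa> where "\<kappa> = (\<lambda>s. if s \<in> R v then \<one> else s)"
  have dec: "\<alpha> s \<in> R v \<and> \<kappa> s \<in> fixing v \<and> s = \<alpha> s \<otimes> \<kappa> s" if s: "s \<in> ?S" for s
  proof (cases "s \<in> R v")
    case True
    then show ?thesis using R_carrier by (simp add: \<alpha>_def \<kappa>_def fixing_closed)
  next
    case False
    then obtain u where u: "u \<in> level V n" "s \<in> R u" "u \<noteq> v" using s by blast
    then have "R u \<subseteq> fixing v"
      using assms(1) by (intro incomparable_R_fixing incomparable_same_length) (auto simp: level_def)
    then show ?thesis
      using u False R_carrier by (auto simp: \<alpha>_def \<kappa>_def R_closed)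
  qed
  have "generate B (\<alpha> ` ?S) \<subseteq> R v"
    using dec by (intro generate_subgroup_incl subgroup_R) auto
  moreover have "\<exists>a\<in>generate B (\<alpha> ` ?S). \<exists>c\<in>fixing v. g = a \<otimes> c"
    using assms(2) dec unfolding rist_level_generate by (rule generate_R_fixing_decomp)
  ultimately show ?thesis using that by blast
qed

text \<open>\<open>R v\<close> is a direct factor of \<open>rist_level V G (length v)\<close>, which
  is finitely generated as a subgroup of finite index in \<open>G\<close>; the projected generators
  generate it.\<close>

lemma fin_gen_R:
  assumes "v \<in> V" "v \<noteq> []"
  shows "fin_gen B (R v)"
proof -
  let ?n = "length v"
  have v: "v \<in> level V ?n" "1 \<le> ?n" using assms by (auto simp: level_def Suc_le_eq)
  have "fin_gen B (rist_level V G ?n)"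
    using fin_gen_G subgroup_G subgroup_rist_level rist_level_subset_G fin_index_rist_level [OF v(2)]
    by (rule fin_gen_fin_index)
  then obtain S where S: "finite S" "S \<subseteq> rist_level V G ?n" "generate B S = rist_level V G ?n"
    unfolding fin_gen_def by blast
  have "\<forall>s\<in>S. \<exists>p. fst p \<in> R v \<and> snd p \<in> fixing v \<and> s = fst p \<otimes> snd p"
    using S(2) rist_level_decomp [OF v(1)] by (metis fst_conv snd_conv subsetD)
  from bchoice [OF this]
  obtain p where p: "\<And>s. s \<in> S \<Longrightarrow> fst (p s) \<in> R v \<and> snd (p s) \<in> fixing v \<and> s = fst (p s) \<otimes> snd (p s)"
    by blast
  let ?F = "(\<lambda>s. fst (p s)) ` S"
  have F: "?F \<subseteq> R v" using p by auto
  have sub: "generate B ?F \<subseteq> R v"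
    using F subgroup_R by (rule generate_subgroup_incl)
  have "R v \<subseteq> generate B ?F"
  proof
    fix a assume a: "a \<in> R v"
    then have "a \<in> generate B S" using R_subset_rist_level [OF v(1)] S(3) by auto
    then obtain a' c where ac: "a' \<in> generate B ?F" "c \<in> fixing v" "a = a' \<otimes> c"
      using generate_R_fixing_decomp [of a S "\<lambda>s. fst (p s)" v "\<lambda>s. snd (p s)"] p by blast
    then have car: "a' \<in> R v" "a' \<in> carrier B" "c \<in> carrier B"
      using sub R_carrier fixing_carrier by auto
    have "inv a' \<otimes> a \<in> R v" using a car by (simp add: R_closed)
    then have "c \<in> R v" using ac car by (simp add: group_norm)
    then have "c = \<one>" using ac R_Int_fixing by blast
    then show "a \<in> generate B ?F" using ac car by simp
  qed
  then show ?thesis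
    unfolding fin_gen_def using S(1) F sub by blast
qed

text \<open>The normaliser of \<open>L\<close> contains \<open>M\<close> and everything commuting with \<open>R v\<close>, hence has finite
  index in \<open>G\<close>; take its normal core.\<close>

lemma normaliser_core:
  assumes v: "v \<in> V" "v \<noteq> []" and L: "subgroup L B" "L \<subseteq> R v"
    and M: "subgroup M B" "M \<subseteq> R v" "fin_index B M (R v)"
    and norm: "\<And>m l. m \<in> M \<Longrightarrow> l \<in> L \<Longrightarrow> m \<otimes> l \<otimes> inv m \<in> L"
  obtains N where "subgroup N B" "N \<subseteq> G" "fin_index B N G"
    "\<And>g n. g \<in> G \<Longrightarrow> n \<in> N \<Longrightarrow> g \<otimes> n \<otimes> inv g \<in> N"
    "\<And>n l. n \<in> N \<Longrightarrow> l \<in> L \<Longrightarrow> n \<otimes> l \<otimes> inv n \<in> L"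
proof -
  \<comment> \<open>Both directions are required, because conjugation could map \<open>L\<close>
    properly into itself.\<close>
  define Z where "Z = {g \<in> G. (\<forall>l\<in>L. g \<otimes> l \<otimes> inv g \<in> L) \<and> (\<forall>l\<in>L. inv g \<otimes> l \<otimes> g \<in> L)}"
  have Lcar: "l \<in> carrier B" if "l \<in> L" for l using that L subgroup_in by blast
  have Z: "subgroup Z B"
  proof (rule subgroupI)
    show "Z \<subseteq> carrier B" using G_carrier by (auto simp: Z_def)
    have "\<one> \<in> Z" using Lcar by (simp add: Z_def G_closed)
    then show "Z \<noteq> {}" by blast
  next
    fix a assume "a \<in> Z"
    then show "inv a \<in> Z" using G_carrier by (simp add: Z_def G_closed)
  next
    fix a b assume ab: "a \<in> Z" "b \<in> Z"
    then have car: "a \<in> carrier B" "b \<in> carrier B" using G_carrier by (auto simp: Z_def)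
    have "a \<otimes> b \<otimes> l \<otimes> inv (a \<otimes> b) \<in> L" "inv (a \<otimes> b) \<otimes> l \<otimes> (a \<otimes> b) \<in> L" if l: "l \<in> L" for l
    proof -
      have "a \<otimes> (b \<otimes> l \<otimes> inv b) \<otimes> inv a \<in> L" "inv b \<otimes> (inv a \<otimes> l \<otimes> a) \<otimes> b \<in> L"
        using ab l by (auto simp: Z_def)
      then show "a \<otimes> b \<otimes> l \<otimes> inv (a \<otimes> b) \<in> L" "inv (a \<otimes> b) \<otimes> l \<otimes> (a \<otimes> b) \<in> L"
        using car Lcar [OF l] by (simp_all add: group_norm)
    qed
    then show "a \<otimes> b \<in> Z" using ab by (simp add: Z_def G_closed)
  qed
  have MZ: "M \<subseteq> Z"
  proof
    fix m assume m: "m \<in> M"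
    have "inv m \<otimes> l \<otimes> m \<in> L" if "l \<in> L" for l
      using norm [OF subgroup.m_inv_closed [OF M(1) m] that] m M(1) subgroup_in by simp
    then show "m \<in> Z" using norm m M(2) R_G by (auto simp: Z_def)
  qed
  have CZ: "fixing v \<subseteq> Z"
  proof
    fix c assume c: "c \<in> fixing v"
    have *: "k \<otimes> l \<otimes> inv k = l" if "l \<in> L" "k \<in> fixing v" for k l
    proof -
      have "k \<otimes> l = l \<otimes> k"
        using R_fixing_commute [of l v k] that L(2) by auto
      then show ?thesis
        using Lcar [OF that(1)] fixing_carrier [OF that(2)] by (simp add: m_assoc)
    qed
    have "inv c \<otimes> l \<otimes> c = l" if "l \<in> L" for l
      using * [OF that fixing_closed(2) [OF c]] c fixing_carrier by simp
    then show "c \<in> Z" using * c fixing_G by (simp add: Z_def)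
  qed
  let ?n = "length v"
  have lv: "v \<in> level V ?n" "1 \<le> ?n" using v by (auto simp: level_def Suc_le_eq)
  obtain T where T: "finite T" "T \<subseteq> R v" "\<And>a. a \<in> R v \<Longrightarrow> \<exists>t\<in>T. inv t \<otimes> a \<in> M"
    using M(3) unfolding fin_index_def by blast
  \<comment> \<open>Representatives of \<open>R v\<close> modulo \<open>M\<close> also serve for the
    level group, since the remaining factor in \<open>fixing v\<close> lies in
    \<open>Z\<close>.\<close>
  have "fin_index B (Z \<inter> rist_level V G ?n) (rist_level V G ?n)"
    unfolding fin_index_def
  proof (intro exI conjI ballI)
    show T': "T \<subseteq> rist_level V G ?n" using T(2) R_subset_rist_level [OF lv(1)] by blast
    fix g assume g: "g \<in> rist_level V G ?n"
    then obtain a c where ac: "a \<in> R v" "c \<in> fixing v" "g = a \<otimes> c"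
      using rist_level_decomp [OF lv(1)] by blast
    then obtain t where t: "t \<in> T" "inv t \<otimes> a \<in> M" using T(3) by blast
    have car: "t \<in> carrier B" "a \<in> carrier B" "c \<in> carrier B"
      using t ac T(2) R_carrier fixing_carrier by auto
    have "inv t \<otimes> a \<otimes> c \<in> Z" using t ac MZ CZ Z by (meson subgroup.m_closed subsetD)
    moreover have "inv t \<otimes> g \<in> rist_level V G ?n"
      using g t T' subgroup_rist_level by (meson subgroup.m_closed subgroup.m_inv_closed subsetD)
    ultimately have "inv t \<otimes> g \<in> Z \<inter> rist_level V G ?n"
      using car ac(3) by (simp add: m_assoc)
    then show "\<exists>t\<in>T. inv t \<otimes> g \<in> Z \<inter> rist_level V G ?n" using t by blast
  qed (rule T(1))
  then have "fin_index B (Z \<inter> rist_level V G ?n) G"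
    using fin_index_rist_level [OF lv(2)] subgroup_G rist_level_subset_G
    by (rule fin_index_trans) auto
  then have "fin_index B Z G"
    by (rule fin_index_mono) auto
  moreover have "Z \<subseteq> G" by (auto simp: Z_def)
  ultimately obtain N where N: "subgroup N B" "N \<subseteq> Z" "fin_index B N G"
    "\<And>g n. g \<in> G \<Longrightarrow> n \<in> N \<Longrightarrow> g \<otimes> n \<otimes> inv g \<in> N"
    using ex_normal_core [OF subgroup_G Z] by metis
  show ?thesis
  proof (rule that [OF N(1) _ N(3,4)])
    show "N \<subseteq> G" using N(2) by (auto simp: Z_def)
    show "n \<otimes> l \<otimes> inv n \<in> L" if "n \<in> N" "l \<in> L" for n l
      using that N(2) unfolding Z_def by blast
  qed
qed

end

text \<open>The extra assumption is available as soon as some \<open>q y\<close> contains an end,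
  which is the only situation in which a bound has to be proved.\<close>

locale nonabelian_branch_tree_group = branch_tree_group +
  assumes nonabelian: "\<And>v. v \<in> V \<Longrightarrow> \<exists>a\<in>R v. \<exists>b\<in>R v. a \<otimes> b \<noteq> b \<otimes> a"
begin

lemma R_moves:
  assumes "v \<in> V"
  obtains a x where "a \<in> R v" "below v x" "a x \<noteq> x"
proof -
  obtain a b where ab: "a \<in> R v" "b \<in> R v" "a \<otimes> b \<noteq> b \<otimes> a"
    using nonabelian [OF assms] by blast
  then have "a \<noteq> \<one>" using R_carrier by auto
  then show ?thesis using R_ne_one_moves [OF ab(1)] that ab(1) by metis
qed

text \<open>Descent on the cardinality: an element of \<open>R v\<close> that moves \<open>x\<close>
  below \<open>v\<close> is not in \<open>R x\<close>, whose elements fix \<open>x\<close>, so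
  \<open>R x\<close> is strictly smaller.\<close>

lemma infinite_R:
  assumes "v \<in> V"
  shows "infinite (R v)"
proof
  assume "finite (R v)"
  then show False
    using assms
  proof (induction "card (R v)" arbitrary: v rule: less_induct)
    case less
    obtain a x where ax: "a \<in> R v" "below v x" "a x \<noteq> x"
      using R_moves [OF less(3)] by blast
    have x: "x \<in> V" using ax below_V by blast
    have "a \<notin> R x" using R_app_self x ax(3) by blast
    then have "R x \<subset> R v" using R_mono [OF ax(2)] ax(1) by blast
    then have "card (R x) < card (R v)" "finite (R x)"
      using less(2) by (auto intro: psubset_card_mono finite_subset)
    then show False using less(1) x by blast
  qed
qed

text \<open>A moved vertex \<open>x\<close> and its image are incomparable; all but one of the
  vertices are found below \<open>x\<close>, and the image is the last.\<close>

lemma ex_incomparable_below: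
  fixes k :: nat
  assumes "w \<in> V"
  shows "\<exists>u. (\<forall>i<k. below w (u i)) \<and> (\<forall>i<k. \<forall>j<k. i \<noteq> j \<longrightarrow> incomparable (u i) (u j))"
  using assms
proof (induction k arbitrary: w)
  case (Suc k)
  obtain a x where ax: "a \<in> R w" "below w x" "a x \<noteq> x"
    using R_moves [OF Suc(2)] by blast
  have x: "x \<in> V" using ax below_V by blast
  have len: "length (a x) = length x" using length_app [OF R_G [OF ax(1)] x] .
  obtain u where u: "\<And>i. i < k \<Longrightarrow> below x (u i)"
    "\<And>i j. i < k \<Longrightarrow> j < k \<Longrightarrow> i \<noteq> j \<Longrightarrow> incomparable (u i) (u j)"
    using Suc.IH [OF x] by blast
  have inc: "incomparable (u i) (a x)" "incomparable (a x) (u i)" if "i < k" for i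
  proof -
    have "take (length x) (u i) = x" "length x \<le> length (u i)"
      using u(1) [OF that] below_length by (auto simp: below_def)
    then have "take (length (a x)) (u i) \<noteq> a x" "take (length (u i)) (a x) \<noteq> u i"
      using ax(3) len by auto
    then show "incomparable (u i) (a x)" "incomparable (a x) (u i)"
      by (auto simp: incomparable_def)
  qed
  show ?case
  proof (intro exI conjI allI impI)
    fix i assume "i < Suc k"
    then show "below w ((u(k := a x)) i)"
      using u(1) ax R_below below_trans by (auto simp: less_Suc_eq)
  next
    fix i j assume "i < Suc k" "j < Suc k" "i \<noteq> j"
    then show "incomparable ((u(k := a x)) i) ((u(k := a x)) j)"
      using u(2) inc by (auto simp: less_Suc_eq)
  qed
qed simp

text \<open>Deep enough in the tree, passing to \<open>N\<close> loses no commutators. The derived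
  subgroup \<open>D\<close> of \<open>N \<inter> R u\<close> moves some vertex, the double
  commutator places the derived rigid stabiliser of that vertex in \<open>D\<close>, and
  transitivity covers its whole level below \<open>u\<close>.\<close>

lemma derived_finite_index:
  assumes N: "subgroup N B" "N \<subseteq> G" "fin_index B N G"
    "\<And>g n. g \<in> G \<Longrightarrow> n \<in> N \<Longrightarrow> g \<otimes> n \<otimes> inv g \<in> N"
    and u: "u \<in> V"
  obtains p where "length u \<le> p"
    "\<And>w. below u w \<Longrightarrow> length w = p \<Longrightarrow> derived B (R w) \<subseteq> derived B (N \<inter> R u)"
proof -
  \<comment> \<open>Two elements of the infinite group \<open>R u\<close> in one coset of
    \<open>N\<close> give a nontrivial element of \<open>N \<inter> R u\<close>.\<close>
  obtain t where t: "t \<in> G" "infinite {a \<in> R u. inv t \<otimes> a \<in> N}"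
    using fin_index_pigeonhole [OF N(3) infinite_R [OF u], of "\<lambda>a. a"] R_G by auto
  then obtain a where a: "a \<in> R u" "inv t \<otimes> a \<in> N"
    by (metis (mono_tags, lifting) empty_Collect_eq finite.emptyI)
  have "infinite ({a \<in> R u. inv t \<otimes> a \<in> N} - {a})" using t(2) by simp
  then have "{a \<in> R u. inv t \<otimes> a \<in> N} - {a} \<noteq> {}" by (rule infinite_imp_nonempty)
  then obtain b where b: "b \<in> R u" "inv t \<otimes> b \<in> N" "b \<noteq> a" by blast
  have car: "a \<in> carrier B" "b \<in> carrier B" "t \<in> carrier B"
    using a b t R_carrier G_carrier by auto
  define g where "g = inv a \<otimes> b"
  have "inv (inv t \<otimes> a) \<otimes> (inv t \<otimes> b) \<in> N"
    using a b N(1) by (simp add: subgroup.m_closed subgroup.m_inv_closed)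
  then have gN: "g \<in> N" using car by (simp add: g_def group_norm)
  have gR: "g \<in> R u" using a b by (simp add: g_def R_closed)
  have "g \<noteq> \<one>"
  proof
    assume "g = \<one>"
    then have "a \<otimes> (inv a \<otimes> b) = a \<otimes> \<one>" by (simp add: g_def)
    then show False using car b(3) by (simp add: group_norm)
  qed
  then obtain w0 where w0: "below u w0" "g w0 \<noteq> w0"
    using R_ne_one_moves [OF gR] by blast
  have w0V: "w0 \<in> V" using w0 below_V by blast
  obtain a b where ab: "a \<in> R w0" "b \<in> R w0" "a \<otimes> b \<noteq> b \<otimes> a"
    using nonabelian [OF w0V] by blast
  define D where "D = derived B (N \<inter> R u)"
  \<comment> \<open>\<open>com a\<close> is a substitute for \<open>a\<close> in \<open>N\<close>:
    normality puts it there, and below \<open>w0\<close> it acts as \<open>a\<close>. Two elements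
    that do not commute thus have substitutes that do not commute.\<close>
  define com where "com = (\<lambda>a. g \<otimes> inv a \<otimes> inv g \<otimes> inv (inv a))"
  have com: "com a \<in> N \<inter> R u \<and> (\<forall>x. below w0 x \<longrightarrow> com a x = a x)" if a: "a \<in> R w0" for a
  proof -
    have car: "a \<in> carrier B" "g \<in> carrier B" using a gR R_carrier by auto
    have aRu: "a \<in> R u" using a R_mono [OF w0(1)] by blast
    obtain k where k: "k \<in> fixing w0" "com a = inv (inv a) \<otimes> k"
      unfolding com_def using commutator_fixing [OF R_G [OF gR] w0V w0(2) R_closed(2) [OF a]] by blast
    have "inv a \<otimes> inv g \<otimes> inv (inv a) \<in> N"
      using gN N(1) R_G [OF R_closed(2) [OF a]] by (intro N(4)) (auto simp: subgroup.m_inv_closed)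
    then have "g \<otimes> (inv a \<otimes> inv g \<otimes> inv (inv a)) \<in> N"
      using gN N(1) by (simp add: subgroup.m_closed)
    then have "com a \<in> N" using car by (simp add: com_def m_assoc)
    moreover have "com a \<in> R u" using gR aRu by (simp add: com_def R_closed)
    moreover have "com a x = a x" if "below w0 x" for x
      using k car that below_V fixing_carrier [OF k(1)] by (simp add: mult_app fixing_def)
    ultimately show ?thesis by blast
  qed
  have comcar: "com a \<in> carrier B" "com b \<in> carrier B" "a \<in> carrier B" "b \<in> carrier B"
    using com ab R_carrier by blast+
  have nc: "com a \<otimes> com b \<noteq> com b \<otimes> com a"
  proof
    assume eq: "com a \<otimes> com b = com b \<otimes> com a"
    have "a \<otimes> b = b \<otimes> a"
    proof (rule R_eqI)
      fix x assume x: "below w0 x"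
      have "(com a \<otimes> com b) x = (a \<otimes> b) x" "(com b \<otimes> com a) x = (b \<otimes> a) x"
        using x com ab R_below comcar below_V by (simp_all add: mult_app)
      then show "(a \<otimes> b) x = (b \<otimes> a) x" using eq by simp
    qed (use ab R_closed in auto)
    then show False using ab(3) by blast
  qed
  define d where "d = com a \<otimes> com b \<otimes> inv (com a) \<otimes> inv (com b)"
  have NRcar: "N \<inter> R u \<subseteq> carrier B" using R_carrier by blast
  have subD: "subgroup D B"
    unfolding D_def by (rule derived_is_subgroup [OF NRcar])
  have NR: "subgroup (N \<inter> R u) B"
    using N(1) subgroup_R by (rule subgroups_Inter_pair)
  have DR: "D \<subseteq> N \<inter> R u"
    unfolding D_def using NR by (intro derived_incl) auto
  have dD: "d \<in> D"
    unfolding D_def derived_def d_def using com ab by (intro generate.incl) blast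
  have "d \<noteq> \<one>"
  proof
    assume "d = \<one>"
    then have "d \<otimes> (com b \<otimes> com a) = com b \<otimes> com a" using comcar by simp
    then show False using nc comcar by (simp add: d_def group_norm)
  qed
  then obtain w1 where w1: "below u w1" "d w1 \<noteq> w1"
    using R_ne_one_moves [of d u] dD DR by blast
  have w1V: "w1 \<in> V" using w1 below_V by blast
  have stab: "g \<otimes> x \<otimes> inv g \<in> D" if g: "g \<in> G" "g u = u" and x: "x \<in> D" for g x
  proof -
    have "g \<otimes> y \<otimes> inv g \<in> N \<inter> R u" if "y \<in> N \<inter> R u" for y
      using that N(4) R_conj [OF g(1) u] g by auto
    then show ?thesis
      unfolding D_def using x NRcar G_carrier [OF g(1)]
      by (intro derived_conj_subset [of g "N \<inter> R u"]) (auto simp: D_def)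
  qed
  \<comment> \<open>\<open>R w1\<close> itself takes the place of the normalising group: it is
    contained in \<open>R u\<close>, which normalises \<open>D\<close>.\<close>
  have "derived B (R w1 \<inter> R w1) \<subseteq> D"
  proof (rule double_commutator [OF subD _ subgroup_R dD w1V w1(2)])
    show "D \<subseteq> G" using DR R_G by blast
    fix n x assume n: "n \<in> R w1" and x: "x \<in> D"
    then have "n \<in> R u" using R_mono [OF w1(1)] by blast
    then show "n \<otimes> x \<otimes> inv n \<in> D" using stab x R_G R_app_self u by blast
  qed
  then have w1D: "derived B (R w1) \<subseteq> D" by simp
  show ?thesis
  proof (rule that [of "length w1"])
    show "length u \<le> length w1" using below_length [OF w1(1)] .
    fix w assume w: "below u w" "length w = length w1"
    then obtain g where g: "g \<in> G" "g w1 = w" using transitive w1V below_V by metis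
    \<comment> \<open>An element carrying \<open>w1\<close> to \<open>w\<close> fixes their common
      prefix \<open>u\<close>, hence normalises \<open>D\<close>.\<close>
    have "g (take (length u) w1) = take (length u) w"
      using take_app [OF g(1) w1V] g(2) by simp
    then have gu: "g u = u" using w w1 by (simp add: below_def)
    have gcar: "g \<in> carrier B" using g G_carrier by blast
    have gw: "(inv g) w = w1" using inv_app(1) [OF gcar w1V] g(2) by simp
    show "derived B (R w) \<subseteq> derived B (N \<inter> R u)"
    proof
      fix x assume x: "x \<in> derived B (R w)"
      then have xcar: "x \<in> carrier B" using derived_in_carrier [of "R w"] R_carrier by blast
      have "inv g \<otimes> x \<otimes> inv (inv g) \<in> derived B (R ((inv g) w))"
        using derived_R_conj [of "inv g" w x] g(1) x w below_V by (simp add: G_closed)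
      then have "inv g \<otimes> x \<otimes> inv (inv g) \<in> D" using w1D gw by auto
      then have "g \<otimes> (inv g \<otimes> x \<otimes> inv (inv g)) \<otimes> inv g \<in> D" using stab g gu by blast
      then show "x \<in> derived B (N \<inter> R u)"
        using gcar xcar by (simp add: D_def group_norm)
    qed
  qed
qed

end

section \<open>A lower bound for the Euclidean dimension of germ graphs\<close>

context tree_group
begin

lemma lprod_closed: "(\<And>i. i < k \<Longrightarrow> \<delta> i \<in> K) \<Longrightarrow> subgroup K B \<Longrightarrow> lprod B \<delta> k \<in> K"
  by (induction k) (auto simp: subgroup.m_closed subgroup.one_closed)

lemma lprod_fixing:
  assumes "\<And>j. j < m \<Longrightarrow> \<delta> j \<in> R (u j)" "\<And>j. j < m \<Longrightarrow> incomparable (u j) v"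
  shows "lprod B \<delta> m \<in> fixing v"
  using assms incomparable_R_fixing by (intro lprod_closed subgroup_fixing) blast

text \<open>All factors other than \<open>\<delta> i\<close> lie in \<open>fixing (u i)\<close>, so
  \<open>\<delta> i\<close> can be moved to the front.\<close>

lemma lprod_factor:
  assumes inc: "\<And>i j. i < k \<Longrightarrow> j < k \<Longrightarrow> i \<noteq> j \<Longrightarrow> incomparable (u i) (u j)"
    and \<delta>: "\<And>i. i < k \<Longrightarrow> \<delta> i \<in> R (u i)" and i: "i < k"
  obtains c where "c \<in> fixing (u i)" "lprod B \<delta> k = \<delta> i \<otimes> c"
proof -
  have "\<exists>c\<in>fixing (u i). lprod B \<delta> m = \<delta> i \<otimes> c" if "i < m" "m \<le> k" for m
    using that
  proof (induction m)
    case (Suc m)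
    show ?case
    proof (cases "i = m")
      case True
      have "lprod B \<delta> m \<in> fixing (u i)"
        using Suc.prems True \<delta> inc by (intro lprod_fixing [where u = u]) auto
      then show ?thesis using True by auto
    next
      case False
      then obtain c where c: "c \<in> fixing (u i)" "lprod B \<delta> m = \<delta> i \<otimes> c"
        using Suc by auto
      have m: "\<delta> m \<in> fixing (u i)"
        using incomparable_R_fixing [OF inc [of m i]] \<delta> [of m] Suc.prems False i by auto
      have "\<delta> m \<otimes> (\<delta> i \<otimes> c) = (\<delta> m \<otimes> \<delta> i) \<otimes> c"
        using c m \<delta> [OF i] fixing_carrier R_carrier by (simp add: m_assoc)
      also have "\<dots> = \<delta> i \<otimes> (\<delta> m \<otimes> c)"
        using c m \<delta> [OF i] fixing_carrier R_carrier R_fixing_commute [OF \<delta> [OF i] m]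
        by (simp add: m_assoc flip: R_fixing_commute)
      finally show ?thesis
        using c m fixing_closed by auto
    qed
  qed simp
  then show ?thesis using i that by blast
qed

text \<open>Rigid stabilisers of incomparable vertices commute, so multiplying out is a homomorphism
  on their direct product.\<close>

lemma lprod_inv_mult:
  assumes inc: "\<And>i j. i < k \<Longrightarrow> j < k \<Longrightarrow> i \<noteq> j \<Longrightarrow> incomparable (u i) (u j)"
    and \<alpha>: "\<And>i. i < k \<Longrightarrow> \<alpha> i \<in> R (u i)" and \<beta>: "\<And>i. i < k \<Longrightarrow> \<beta> i \<in> R (u i)"
  shows "inv (lprod B \<alpha> k) \<otimes> lprod B \<beta> k = lprod B (\<lambda>i. inv (\<alpha> i) \<otimes> \<beta> i) k"
proof -
  have "inv (lprod B \<alpha> m) \<otimes> lprod B \<beta> m = lprod B (\<lambda>i. inv (\<alpha> i) \<otimes> \<beta> i) m" if "m \<le> k" for m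
    using that
  proof (induction m)
    case (Suc m)
    let ?P = "lprod B \<alpha> m" and ?Q = "lprod B \<beta> m" and ?d = "inv (\<alpha> m) \<otimes> \<beta> m"
    have R: "\<alpha> m \<in> R (u m)" "\<beta> m \<in> R (u m)" using \<alpha> \<beta> Suc by auto
    have P: "?P \<in> fixing (u m)" "?Q \<in> fixing (u m)"
      using Suc.prems \<alpha> \<beta> inc by (auto intro!: lprod_fixing [where u = u])
    have car: "\<alpha> m \<in> carrier B" "\<beta> m \<in> carrier B" "?P \<in> carrier B" "?Q \<in> carrier B"
      using R P R_carrier fixing_carrier by auto
    have comm: "?d \<otimes> inv ?P = inv ?P \<otimes> ?d"
      using R P by (intro R_fixing_commute [of _ "u m"]) (auto simp: R_closed fixing_closed)
    have "inv (lprod B \<alpha> (Suc m)) \<otimes> lprod B \<beta> (Suc m) = (inv ?P \<otimes> ?d) \<otimes> ?Q"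
      using car by (simp add: group_norm)
    also have "\<dots> = ?d \<otimes> (inv ?P \<otimes> ?Q)"
      unfolding comm [symmetric] using car by (simp add: m_assoc)
    finally show ?case using Suc by simp
  qed simp
  then show ?thesis by simp
qed

end

context branch_tree_group
begin

text \<open>By \<open>prod\<close>, a product of elements of the \<open>R (u i)\<close> can fall
  into \<open>KH\<close> only if each factor is in its \<open>M i\<close>. Rays that separate the
  cosets of every \<open>M i\<close> therefore jointly separate the cosets of
  \<open>KH\<close>.\<close>

lemma leud_ge_rist:
  fixes BX :: "'x monoid" and k :: nat
  assumes BX: "group BX" and H: "subgroup H BX"
    and S: "S \<subseteq> H" "\<And>s. s \<in> S \<Longrightarrow> inv\<^bsub>BX\<^esub> s \<in> S" "generate BX S = H"
    and KH: "subgroup KH BX" and \<rho>: "\<rho> \<in> hom (B\<lparr>carrier := G\<rparr>) (BX\<lparr>carrier := H\<rparr>)"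
    and u: "\<And>i. i < k \<Longrightarrow> u i \<in> V \<and> u i \<noteq> []"
    and inc: "\<And>i j. i < k \<Longrightarrow> j < k \<Longrightarrow> i \<noteq> j \<Longrightarrow> incomparable (u i) (u j)"
    and M: "\<And>i. i < k \<Longrightarrow> subgroup (M i) B \<and> M i \<subseteq> R (u i) \<and> \<not> fin_index B (M i) (R (u i))"
    and prod: "\<And>\<delta> i. (\<And>i. i < k \<Longrightarrow> \<delta> i \<in> R (u i)) \<Longrightarrow> \<rho> (lprod B \<delta> k) \<in> KH \<Longrightarrow> i < k \<Longrightarrow> \<delta> i \<in> M i"
  shows "enat k \<le> leud {h <#\<^bsub>BX\<^esub> KH | h. h \<in> H}
      {(h <#\<^bsub>BX\<^esub> KH, (s \<otimes>\<^bsub>BX\<^esub> h) <#\<^bsub>BX\<^esub> KH) | h s. h \<in> H \<and> s \<in> S}"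
proof -
  interpret BX: group BX by (rule BX)
  have hom: "\<rho> (g \<otimes> h) = \<rho> g \<otimes>\<^bsub>BX\<^esub> \<rho> h" if "g \<in> G" "h \<in> G" for g h
    using \<rho> that by (auto simp: hom_def)
  have \<rho>H: "\<rho> g \<in> H" if "g \<in> G" for g
    using \<rho> that by (auto simp: hom_def)
  have \<rho>car: "\<rho> g \<in> carrier BX" if "g \<in> G" for g
    using \<rho>H [OF that] H BX.subgroup_in by blast
  have \<rho>one: "\<rho> \<one> = \<one>\<^bsub>BX\<^esub>"
  proof -
    have "\<rho> \<one> \<otimes>\<^bsub>BX\<^esub> \<rho> \<one> = \<rho> \<one>" using hom [of \<one> \<one>] G_closed(3) G_carrier by simp
    then show ?thesis using \<rho>car [OF G_closed(3)] by simp
  qed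
  have \<rho>inv: "\<rho> (inv g) = inv\<^bsub>BX\<^esub> (\<rho> g)" if "g \<in> G" for g
  proof -
    have "\<rho> (inv g) \<otimes>\<^bsub>BX\<^esub> \<rho> g = \<one>\<^bsub>BX\<^esub>"
      using hom [OF G_closed(2) [OF that] that] that G_carrier \<rho>one by simp
    then show ?thesis
      using BX.inv_equality \<rho>car that G_closed(2) by metis
  qed
  have "\<exists>F \<gamma>. i < k \<longrightarrow> finite F \<and> F \<subseteq> R (u i) \<and> (\<forall>n. \<gamma> n \<in> R (u i)) \<and> (\<forall>n. \<gamma> (Suc n) \<otimes> inv (\<gamma> n) \<in> F)
      \<and> (\<forall>m n. inv (\<gamma> m) \<otimes> \<gamma> n \<in> M i \<longrightarrow> m = n)" for i
  proof (cases "i < k")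
    case True
    have "u i \<in> V" "u i \<noteq> []" "subgroup (M i) B" "M i \<subseteq> R (u i)" "\<not> fin_index B (M i) (R (u i))"
      using u M True by auto
    then obtain F \<gamma> where "finite F" "F \<subseteq> R (u i)" "\<And>n. \<gamma> n \<in> R (u i)" "\<And>n. \<gamma> (Suc n) \<otimes> inv (\<gamma> n) \<in> F"
      "\<And>m n. inv (\<gamma> m) \<otimes> \<gamma> n \<in> M i \<Longrightarrow> m = n"
      using ex_coset_ray [OF fin_gen_R subgroup_R] by metis
    then show ?thesis by blast
  qed simp
  then obtain F \<gamma>0 where ray: "\<And>i. i < k \<Longrightarrow> finite (F i) \<and> F i \<subseteq> R (u i) \<and> (\<forall>n. \<gamma>0 i n \<in> R (u i))
      \<and> (\<forall>n. \<gamma>0 i (Suc n) \<otimes> inv (\<gamma>0 i n) \<in> F i) \<and> (\<forall>m n. inv (\<gamma>0 i m) \<otimes> \<gamma>0 i n \<in> M i \<longrightarrow> m = n)"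
    by metis
  \<comment> \<open>The default \<open>\<one>\<close> keeps all values in \<open>G\<close>, also for
    indices beyond \<open>k\<close>, as \<open>leud_ge\<close> requires.\<close>
  define \<gamma> where "\<gamma> = (\<lambda>i n. if i < k then \<gamma>0 i n else \<one>)"
  have \<gamma>R: "\<gamma> i n \<in> R (u i)" if "i < k" for i n using ray that by (simp add: \<gamma>_def)
  have \<gamma>G: "\<gamma> i n \<in> G" for i n
    using \<gamma>R R_G G_closed(3) by (cases "i < k") (auto simp: \<gamma>_def)
  have lprodG: "lprod B (\<lambda>i. \<gamma> i (a i)) m \<in> G" for a m
    using \<gamma>G subgroup_G by (intro lprod_closed)
  have \<rho>lprod: "lprod BX (\<lambda>i. \<rho> (\<gamma> i (a i))) m = \<rho> (lprod B (\<lambda>i. \<gamma> i (a i)) m)" for a m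
    by (induction m) (auto simp: \<rho>one hom \<gamma>G lprodG)
  show ?thesis
  proof (rule BX.leud_ge [OF H S KH])
    show "finite (\<rho> ` F i)" "\<rho> ` F i \<subseteq> H" if "i < k" for i
      using ray [OF that] \<rho>H R_G by blast+
    show "\<rho> (\<gamma> i n) \<in> H" for i n using \<gamma>G \<rho>H by blast
    show "\<rho> (\<gamma> i (Suc n)) \<otimes>\<^bsub>BX\<^esub> inv\<^bsub>BX\<^esub> \<rho> (\<gamma> i n) \<in> \<rho> ` F i" if "i < k" for i n
    proof -
      have "\<rho> (\<gamma> i (Suc n)) \<otimes>\<^bsub>BX\<^esub> inv\<^bsub>BX\<^esub> \<rho> (\<gamma> i n) = \<rho> (\<gamma> i (Suc n) \<otimes> inv (\<gamma> i n))"
        using \<gamma>G by (simp add: hom \<rho>inv G_closed)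
      then show ?thesis using ray [OF that] that by (simp add: \<gamma>_def)
    qed
    show "\<rho> (\<gamma> i m) \<otimes>\<^bsub>BX\<^esub> \<rho> (\<gamma> j n) = \<rho> (\<gamma> j n) \<otimes>\<^bsub>BX\<^esub> \<rho> (\<gamma> i m)"
      if "i < k" "j < k" "i \<noteq> j" for i j m n
    proof -
      have "\<gamma> j n \<in> fixing (u i)"
        using incomparable_R_fixing [of "u j" "u i"] inc [of j i] \<gamma>R [of j n] that by auto
      then have "\<gamma> i m \<otimes> \<gamma> j n = \<gamma> j n \<otimes> \<gamma> i m"
        by (intro R_fixing_commute [of _ "u i"] \<gamma>R that)
      then show ?thesis using \<gamma>G by (simp flip: hom)
    qed
    show "a i = b i"
      if K: "inv\<^bsub>BX\<^esub> lprod BX (\<lambda>i. \<rho> (\<gamma> i (a i))) k \<otimes>\<^bsub>BX\<^esub> lprod BX (\<lambda>i. \<rho> (\<gamma> i (b i))) k \<in> KH"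
        and i: "i < k" for a b i
    proof -
      have "inv\<^bsub>BX\<^esub> lprod BX (\<lambda>i. \<rho> (\<gamma> i (a i))) k \<otimes>\<^bsub>BX\<^esub> lprod BX (\<lambda>i. \<rho> (\<gamma> i (b i))) k
          = \<rho> (inv (lprod B (\<lambda>i. \<gamma> i (a i)) k) \<otimes> lprod B (\<lambda>i. \<gamma> i (b i)) k)"
        using lprodG by (simp add: \<rho>lprod hom \<rho>inv G_closed)
      also have "inv (lprod B (\<lambda>i. \<gamma> i (a i)) k) \<otimes> lprod B (\<lambda>i. \<gamma> i (b i)) k
          = lprod B (\<lambda>i. inv (\<gamma> i (a i)) \<otimes> \<gamma> i (b i)) k"
        by (rule lprod_inv_mult [of k u]) (use inc \<gamma>R in auto)
      finally have "\<rho> (lprod B (\<lambda>i. inv (\<gamma> i (a i)) \<otimes> \<gamma> i (b i)) k) \<in> KH"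
        using K by simp
      then have "inv (\<gamma> i (a i)) \<otimes> \<gamma> i (b i) \<in> M i"
        using prod [of "\<lambda>i. inv (\<gamma> i (a i)) \<otimes> \<gamma> i (b i)" i] i \<gamma>R by (simp add: R_closed)
      then show ?thesis using ray [OF i] i by (simp add: \<gamma>_def)
    qed
  qed
qed

end

context nonabelian_branch_tree_group
begin

text \<open>\<open>K\<close> plays the role of a germ stabiliser, the directed union of the pointwise stabilisers \<open>\<U>\<close>
  of neighbourhoods. Passing to a member of \<open>\<U>\<close> is possible since the projection of \<open>K\<close>, having
  finite index, is finitely generated.\<close>

lemma ex_free_rist:
  fixes \<xi> :: "nat \<Rightarrow> nat"
  assumes \<xi>: "\<And>n. map \<xi> [0..<n] \<in> V" and K: "subgroup K B" "K \<subseteq> G"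
    and directed: "\<And>F. finite F \<Longrightarrow> F \<subseteq> K \<Longrightarrow> \<exists>K0\<in>\<U>. F \<subseteq> K0"
    and \<U>: "\<And>K0. K0 \<in> \<U> \<Longrightarrow> subgroup K0 B \<and> K0 \<subseteq> K"
    and nonlocal: "\<And>K0 p. K0 \<in> \<U> \<Longrightarrow> \<not> derived B (R (map \<xi> [0..<p])) \<subseteq> K0"
    and n: "1 \<le> n" and v: "v = map \<xi> [0..<n]"
    and fi: "fin_index B (rist_proj K v) (R v)"
  obtains w where "w \<in> V" "w \<noteq> []" "K \<inter> R w \<subseteq> {\<one>}"
proof -
  define pre where "pre = (\<lambda>n. map \<xi> [0..<n])"
  have pre: "pre m \<in> V" "length (pre m) = m" for m using \<xi> by (simp_all add: pre_def)
  have pre_take: "take m (pre p) = pre (min m p)" for m p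
    by (simp add: pre_def take_map take_upt min_def)
  have pre_below: "below (pre m) (pre p)" if "m \<le> p" for m p
    using that pre by (simp add: below_def pre_take)
  have vV: "v \<in> V" "v \<noteq> []" using \<xi> n v by auto
  define M where "M = rist_proj K v"
  have M: "subgroup M B" "M \<subseteq> R v" "fin_index B M (R v)"
    using subgroup_rist_proj [OF K(1)] fi by (auto simp: M_def rist_proj_def)
  have "fin_gen B M"
    using fin_gen_R [OF vV] subgroup_R M by (rule fin_gen_fin_index)
  then obtain F where F: "finite F" "F \<subseteq> M" "generate B F = M"
    unfolding fin_gen_def by blast
  have "\<forall>f\<in>F. \<exists>c. c \<in> fixing v \<and> f \<otimes> c \<in> K"
    using F(2) by (auto simp: M_def rist_proj_def)
  from bchoice [OF this]
  obtain c where c: "\<And>f. f \<in> F \<Longrightarrow> c f \<in> fixing v \<and> f \<otimes> c f \<in> K" by blast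
  show ?thesis
  proof (cases "\<exists>l\<in>K \<inter> R v. \<exists>m. l (pre m) \<noteq> pre m")
    case True
    then obtain l m where l: "l \<in> K" "l \<in> R v" "l (pre m) \<noteq> pre m" by blast
    have "finite (insert l ((\<lambda>f. f \<otimes> c f) ` F))" "insert l ((\<lambda>f. f \<otimes> c f) ` F) \<subseteq> K"
      using F(1) c l by auto
    \<comment> \<open>One member of \<open>\<U>\<close> contains \<open>l\<close> and lifts of all
      generators of \<open>M\<close>, so its own projection already contains
      \<open>M\<close>.\<close>
    then obtain K0 where K0: "K0 \<in> \<U>" "insert l ((\<lambda>f. f \<otimes> c f) ` F) \<subseteq> K0"
      using directed by blast
    have sub: "subgroup K0 B" using \<U> K0 by blast
    have "F \<subseteq> rist_proj K0 v"
    proof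
      fix f assume "f \<in> F"
      then have "f \<in> R v" "c f \<in> fixing v" "f \<otimes> c f \<in> K0"
        using F(2) M(2) K0(2) c by auto
      then show "f \<in> rist_proj K0 v" by (auto simp: rist_proj_def)
    qed
    then have MK0: "M \<subseteq> rist_proj K0 v"
      unfolding F(3) [symmetric] by (rule generate_subgroup_incl) (rule subgroup_rist_proj [OF sub])
    define L where "L = K0 \<inter> R v"
    have L: "subgroup L B" "L \<subseteq> R v"
      unfolding L_def using subgroups_Inter_pair [OF sub subgroup_R] by auto
    have norm: "m \<otimes> l \<otimes> inv m \<in> L" if "m \<in> M" "l \<in> L" for m l
      using that rist_proj_normalises [OF sub] MK0 unfolding L_def by blast
    obtain N where N: "subgroup N B" "N \<subseteq> G" "fin_index B N G"
      "\<And>g n. g \<in> G \<Longrightarrow> n \<in> N \<Longrightarrow> g \<otimes> n \<otimes> inv g \<in> N"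
      "\<And>n l. n \<in> N \<Longrightarrow> l \<in> L \<Longrightarrow> n \<otimes> l \<otimes> inv n \<in> L"
      using normaliser_core [OF vV L M norm] by metis
    have "derived B (N \<inter> R (pre m)) \<subseteq> L"
      using l K0(2) L R_G N
      by (intro double_commutator [where l = l]) (auto simp: L_def pre)
    moreover obtain p where p: "length (pre m) \<le> p"
      "\<And>w. below (pre m) w \<Longrightarrow> length w = p \<Longrightarrow> derived B (R w) \<subseteq> derived B (N \<inter> R (pre m))"
      using derived_finite_index [OF N(1-4) pre(1)] by metis
    \<comment> \<open>The vertex \<open>pre p\<close> lies on the end itself, which is what
      \<open>nonlocal\<close> speaks about.\<close>
    ultimately have "derived B (R (pre p)) \<subseteq> L"
      using p(2) [of "pre p"] pre_below [of m p] pre(2) by auto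
    then show ?thesis
      using nonlocal [OF K0(1), of p] unfolding L_def pre_def by blast
  next
    case False
    define L where "L = K \<inter> R v"
    have L: "subgroup L B" "L \<subseteq> R v"
      unfolding L_def using subgroups_Inter_pair [OF K(1) subgroup_R] by auto
    have fixL: "l (pre m) = pre m" if "l \<in> L" for l m using False that by (auto simp: L_def)
    have norm: "m \<otimes> l \<otimes> inv m \<in> L" if "m \<in> M" "l \<in> L" for m l
      using that rist_proj_normalises [OF K(1)] unfolding L_def M_def by blast
    obtain N where N: "subgroup N B" "N \<subseteq> G" "fin_index B N G"
      "\<And>g n. g \<in> G \<Longrightarrow> n \<in> N \<Longrightarrow> g \<otimes> n \<otimes> inv g \<in> N"
      "\<And>n l. n \<in> N \<Longrightarrow> l \<in> L \<Longrightarrow> n \<otimes> l \<otimes> inv n \<in> L"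
      using normaliser_core [OF vV L M norm] by metis
    \<comment> \<open>As \<open>N\<close> normalises \<open>L\<close>, fixing \<open>\<xi>\<close>
      implies fixing every translate of it under \<open>N\<close>.\<close>
    have fixN: "l (h (pre m)) = h (pre m)" if l: "l \<in> L" and h: "h \<in> N" for l h m
    proof -
      have car: "l \<in> carrier B" "h \<in> carrier B" using l h L N(2) R_carrier G_carrier by auto
      have "inv h \<in> N" using h N(1) by (simp add: subgroup.m_inv_closed)
      then have "inv h \<otimes> l \<otimes> h \<in> L" using N(5) [of "inv h" l] l car by simp
      then have "(inv h \<otimes> l \<otimes> h) (pre m) = pre m" by (rule fixL)
      then have "(h \<otimes> (inv h \<otimes> l \<otimes> h)) (pre m) = h (pre m)"
        using car pre(1) by (simp add: mult_app)
      then show ?thesis using car pre(1) by (simp add: group_norm mult_app)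
    qed
    have "\<exists>p\<ge>n. K \<inter> R (pre p) \<subseteq> {\<one>}"
    proof (rule ccontr)
      assume "\<not> ?thesis"
      then have nontriv: "\<exists>l. l \<in> K \<inter> R (pre p) \<and> l \<noteq> \<one>" if "n \<le> p" for p
        using that by blast
      \<comment> \<open>If \<open>K\<close> met every \<open>R (pre p)\<close> nontrivially, there
        would be moved vertices below each \<open>pre p\<close>; by transitivity each is a translate
        of a prefix of \<open>\<xi>\<close> under some \<open>g p\<close>.\<close>
      have "\<forall>p\<in>{n..}. \<exists>g. g \<in> G \<and> (\<exists>l\<in>L. \<exists>m. below (pre p) (g (pre m)) \<and> l (g (pre m)) \<noteq> g (pre m))"
      proof
        fix p assume "p \<in> {n..}"
        then have p: "n \<le> p" by simp
        obtain l where l: "l \<in> K" "l \<in> R (pre p)" "l \<noteq> \<one>" using nontriv [OF p] by blast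
        have "R (pre p) \<subseteq> R v" unfolding v using pre_below [OF p] by (intro R_mono) (simp add: pre_def)
        then have lL: "l \<in> L" using l by (auto simp: L_def)
        obtain x where x: "below (pre p) x" "l x \<noteq> x" using R_ne_one_moves [OF l(2,3)] by blast
        obtain g where "g \<in> G" "g (pre (length x)) = x"
          using transitive [OF pre(1) below_V [OF x(1)], of "length x"] pre(2) by auto
        then show "\<exists>g. g \<in> G \<and> (\<exists>l\<in>L. \<exists>m. below (pre p) (g (pre m)) \<and> l (g (pre m)) \<noteq> g (pre m))"
          using lL x by metis
      qed
      from bchoice [OF this]
      obtain g where g: "\<And>p. n \<le> p \<Longrightarrow> g p \<in> G"
        "\<And>p. n \<le> p \<Longrightarrow> \<exists>l\<in>L. \<exists>m. below (pre p) (g p (pre m)) \<and> l (g p (pre m)) \<noteq> g p (pre m)"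
        by auto
      have "g ` {n..} \<subseteq> G" using g(1) by auto
      then obtain t where t: "t \<in> G" "infinite {p \<in> {n..}. inv t \<otimes> g p \<in> N}"
        by (rule fin_index_pigeonhole [OF N(3) infinite_Ici])
      then obtain p where p: "n \<le> p" "inv t \<otimes> g p \<in> N"
        using infinite_imp_nonempty [OF t(2)] by auto
      obtain l m where lm: "l \<in> L" "below (pre p) (g p (pre m))" "l (g p (pre m)) \<noteq> g p (pre m)"
        using g(2) [OF p(1)] by blast
      \<comment> \<open>With \<open>q\<close> at least \<open>m\<close>, the element
        \<open>g q\<close> fixes \<open>pre q\<close> and hence \<open>pre m\<close>. Lying in the
        coset of \<open>g p\<close>, it shows that the moved vertex \<open>g p (pre m)\<close> is a
        translate of \<open>pre m\<close> under \<open>N\<close>.\<close>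
      obtain q where q: "m \<le> q" "n \<le> q" "inv t \<otimes> g q \<in> N"
        using t(2) unfolding infinite_nat_iff_unbounded_le by auto
      have gp: "g p \<in> carrier B" "g q \<in> carrier B" "t \<in> carrier B" using g(1) p q t G_carrier by auto
      obtain m' where m': "below (pre q) (g q (pre m'))" using g(2) [OF q(2)] by blast
      have "take q (g q (pre m')) = pre q" "q \<le> m'"
        using m' below_length [OF m'] length_app [OF g(1) [OF q(2)] pre(1)] pre(2)
        by (auto simp: below_def)
      then have "g q (pre q) = pre q"
        using take_app [OF g(1) [OF q(2)] pre(1), of q m'] by (simp add: pre_take min_def)
      then have gq: "g q (pre m) = pre m"
        using take_app [OF g(1) [OF q(2)] pre(1), of m q] q(1) by (simp add: pre_take min_def)
      \<comment> \<open>This is \<open>g p \<otimes> inv (g q)\<close>, written as a conjugate to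
        make its membership in the normal subgroup \<open>N\<close> visible.\<close>
      define h where "h = t \<otimes> ((inv t \<otimes> g p) \<otimes> inv (inv t \<otimes> g q)) \<otimes> inv t"
      have hN: "h \<in> N"
        unfolding h_def using p q N(1) by (intro N(4) t(1)) (simp add: subgroup.m_closed subgroup.m_inv_closed)
      have "h \<otimes> g q = g p" using gp by (simp add: h_def group_norm)
      then have "h (g q (pre m)) = g p (pre m)"
        using gp(2) hN N(2) G_carrier pre(1) by (metis mult_app subsetD)
      then have "h (pre m) = g p (pre m)" using gq by simp
      then show False using fixN [OF lm(1) hN, of m] lm(3) by simp
    qed
    then obtain p where p: "n \<le> p" "K \<inter> R (pre p) \<subseteq> {\<one>}" by blast
    have "pre p \<noteq> []" using p(1) n by (simp add: pre_def)
    then show ?thesis using that p(2) pre(1) by blast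
  qed
qed

text \<open>The topology of the space is reduced to the family \<open>\<U>\<close>:
  \<open>directed\<close> says that finitely many germ relations hold on a common neighbourhood, and
  \<open>nonlocal\<close> that no neighbourhood is fixed by a whole derived rigid stabiliser along
  one of the ends.\<close>

lemma leud_ge_ends:
  fixes BX :: "'x monoid" and k :: nat and \<xi> :: "nat \<Rightarrow> nat \<Rightarrow> nat"
  assumes BX: "group BX" and H: "subgroup H BX"
    and S: "S \<subseteq> H" "\<And>s. s \<in> S \<Longrightarrow> inv\<^bsub>BX\<^esub> s \<in> S" "generate BX S = H"
    and KH: "subgroup KH BX" and \<rho>: "\<rho> \<in> hom (B\<lparr>carrier := G\<rparr>) (BX\<lparr>carrier := H\<rparr>)"
    and K: "K = {g \<in> G. \<rho> g \<in> KH}" "subgroup K B"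
    and directed: "\<And>F. finite F \<Longrightarrow> F \<subseteq> K \<Longrightarrow> \<exists>K0\<in>\<U>. F \<subseteq> K0"
    and \<U>: "\<And>K0. K0 \<in> \<U> \<Longrightarrow> subgroup K0 B \<and> K0 \<subseteq> K"
    and \<xi>: "\<And>i n. i < k \<Longrightarrow> map (\<xi> i) [0..<n] \<in> V"
    and nonlocal: "\<And>K0 p i. i < k \<Longrightarrow> K0 \<in> \<U> \<Longrightarrow> \<not> derived B (R (map (\<xi> i) [0..<p])) \<subseteq> K0"
    and n: "1 \<le> n" and sep: "inj_on (\<lambda>i. map (\<xi> i) [0..<n]) {..<k}"
  shows "enat k \<le> leud {h <#\<^bsub>BX\<^esub> KH | h. h \<in> H}
      {(h <#\<^bsub>BX\<^esub> KH, (s \<otimes>\<^bsub>BX\<^esub> h) <#\<^bsub>BX\<^esub> KH) | h s. h \<in> H \<and> s \<in> S}"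
proof (cases "\<exists>i<k. fin_index B (rist_proj K (map (\<xi> i) [0..<n])) (R (map (\<xi> i) [0..<n]))")
  case False
  define u where "u = (\<lambda>i. map (\<xi> i) [0..<n])"
  have inc: "incomparable (u i) (u j)" if "i < k" "j < k" "i \<noteq> j" for i j
    using that sep by (intro incomparable_same_length) (auto simp: u_def inj_on_def)
  show ?thesis
  proof (rule leud_ge_rist [OF BX H S KH \<rho>, where u = u and M = "\<lambda>i. rist_proj K (u i)"])
    show "u i \<in> V \<and> u i \<noteq> []" if "i < k" for i using that \<xi> n by (simp add: u_def)
    show "incomparable (u i) (u j)" if "i < k" "j < k" "i \<noteq> j" for i j using inc that .
    show "subgroup (rist_proj K (u i)) B \<and> rist_proj K (u i) \<subseteq> R (u i)
        \<and> \<not> fin_index B (rist_proj K (u i)) (R (u i))" if "i < k" for i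
      using that False subgroup_rist_proj [OF K(2)] by (auto simp: u_def rist_proj_def)
    show "\<delta> i \<in> rist_proj K (u i)"
      if \<delta>: "\<And>i. i < k \<Longrightarrow> \<delta> i \<in> R (u i)" and K': "\<rho> (lprod B \<delta> k) \<in> KH" and i: "i < k" for \<delta> i
    proof -
      have "lprod B \<delta> k \<in> G" using \<delta> R_G subgroup_G by (intro lprod_closed) blast
      then have "lprod B \<delta> k \<in> K" using K' K(1) by simp
      moreover obtain c where "c \<in> fixing (u i)" "lprod B \<delta> k = \<delta> i \<otimes> c"
        using lprod_factor [of k u \<delta> i] inc \<delta> i by metis
      ultimately show ?thesis using \<delta> [OF i] by (auto simp: rist_proj_def)
    qed
  qed
next
  case True
  then obtain i where i: "i < k" "fin_index B (rist_proj K (map (\<xi> i) [0..<n])) (R (map (\<xi> i) [0..<n]))"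
    by blast
  have KG: "K \<subseteq> G" using K(1) by auto
  obtain w where w: "w \<in> V" "w \<noteq> []" "K \<inter> R w \<subseteq> {\<one>}"
    using ex_free_rist [OF \<xi> [OF i(1)] K(2) KG directed \<U> nonlocal [OF i(1)] n refl i(2)] by metis
  obtain u where u: "\<And>i. i < k \<Longrightarrow> below w (u i)"
    "\<And>i j. i < k \<Longrightarrow> j < k \<Longrightarrow> i \<noteq> j \<Longrightarrow> incomparable (u i) (u j)"
    using ex_incomparable_below [OF w(1), of k] by blast
  \<comment> \<open>The given ends are replaced by \<open>k\<close> fresh vertices below
    \<open>w\<close>, with trivial groups \<open>M i\<close>.\<close>
  show ?thesis
  proof (rule leud_ge_rist [OF BX H S KH \<rho>, where u = u and M = "\<lambda>i. {\<one>}"])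
    show "u i \<in> V \<and> u i \<noteq> []" if "i < k" for i
      using u(1) [OF that] below_V below_length w(2) by fastforce
    show "incomparable (u i) (u j)" if "i < k" "j < k" "i \<noteq> j" for i j using u(2) that .
    show "subgroup {\<one>} B \<and> {\<one>} \<subseteq> R (u i) \<and> \<not> fin_index B {\<one>} (R (u i))" if i: "i < k" for i
    proof (intro conjI notI)
      show "subgroup {\<one>} B" by (rule triv_subgroup)
      show "{\<one>} \<subseteq> R (u i)" using R_closed(3) by simp
      assume "fin_index B {\<one>} (R (u i))"
      then obtain T where T: "finite T" "T \<subseteq> R (u i)" "\<And>a. a \<in> R (u i) \<Longrightarrow> \<exists>t\<in>T. inv t \<otimes> a \<in> {\<one>}"
        unfolding fin_index_def by blast
      have "R (u i) \<subseteq> T"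
      proof
        fix a assume a: "a \<in> R (u i)"
        then obtain t where t: "t \<in> T" "inv t \<otimes> a = \<one>" using T(3) by blast
        have "t \<in> carrier B" "a \<in> carrier B" using t a T(2) R_carrier by auto
        then have "t \<otimes> (inv t \<otimes> a) = a" by (simp add: group_norm)
        then show "a \<in> T" using t \<open>t \<in> carrier B\<close> by simp
      qed
      then show False
        using infinite_R [of "u i"] T(1) finite_subset below_V [OF u(1) [OF i]] by blast
    qed
    show "\<delta> i \<in> {\<one>}"
      if \<delta>: "\<And>i. i < k \<Longrightarrow> \<delta> i \<in> R (u i)" and K': "\<rho> (lprod B \<delta> k) \<in> KH" and i: "i < k" for \<delta> i
    proof -
      have "\<delta> j \<in> R w" if "j < k" for j using \<delta> [OF that] R_mono [OF u(1) [OF that]] by blast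
      then have Rw: "lprod B \<delta> k \<in> R w" using subgroup_R by (intro lprod_closed) blast
      then have "lprod B \<delta> k \<in> K" using K' K(1) R_G by simp
      then have one: "lprod B \<delta> k = \<one>" using Rw w(3) by blast
      obtain c where c: "c \<in> fixing (u i)" "lprod B \<delta> k = \<delta> i \<otimes> c"
        using lprod_factor [of k u \<delta> i] u(2) \<delta> i by metis
      have car: "\<delta> i \<in> carrier B" "c \<in> carrier B" using \<delta> [OF i] c R_carrier fixing_carrier by auto
      \<comment> \<open>The product is trivial, so its factor \<open>\<delta> i\<close> lies in
        \<open>R (u i)\<close> and in \<open>fixing (u i)\<close>.\<close>
      have "\<delta> i = inv c"
        using inv_equality [of "\<delta> i" c] c one car by simp
      then show ?thesis using R_Int_fixing [OF \<delta> [OF i]] fixing_closed(2) [OF c(1)] by simp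
    qed
  qed
qed

end

section \<open>The boundary map\<close>

lemma prefixes_eq_imp_eq:
  fixes \<xi> \<eta> :: "nat \<Rightarrow> nat"
  assumes "\<And>n. map \<xi> [0..<n] = map \<eta> [0..<n]"
  shows "\<xi> = \<eta>"
proof
  fix n
  have "map \<xi> [0..<Suc n] = map \<eta> [0..<Suc n]" by (rule assms)
  then show "\<xi> n = \<eta> n" by simp
qed

lemma ex_separating_level:
  fixes A :: "(nat \<Rightarrow> nat) set"
  assumes "finite A"
  obtains n where "1 \<le> n" "inj_on (\<lambda>\<xi>. map \<xi> [0..<n]) A"
proof -
  \<comment> \<open>The first index of disagreement; for equal sequences the value is unspecified
    and can only raise the bound.\<close>
  define D where "D = (\<lambda>p :: (nat \<Rightarrow> nat) \<times> (nat \<Rightarrow> nat). LEAST i. fst p i \<noteq> snd p i)"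
  \<comment> \<open>\<open>insert 0\<close> covers the empty set \<open>A\<close>, and
    \<open>Suc\<close> places every disagreement strictly before \<open>n\<close>.\<close>
  define n where "n = Suc (Max (insert 0 (D ` (A \<times> A))))"
  have D: "D p < n" if "p \<in> A \<times> A" for p
    using assms that by (auto simp: n_def less_Suc_eq_le intro!: Max_ge)
  have "\<xi> = \<eta>" if "\<xi> \<in> A" "\<eta> \<in> A" "map \<xi> [0..<n] = map \<eta> [0..<n]" for \<xi> \<eta>
  proof (rule ccontr)
    assume "\<xi> \<noteq> \<eta>"
    then obtain i where "\<xi> i \<noteq> \<eta> i" by blast
    then have "\<xi> (D (\<xi>, \<eta>)) \<noteq> \<eta> (D (\<xi>, \<eta>))"
      unfolding D_def by (simp add: LeastI [of "\<lambda>i. \<xi> i \<noteq> \<eta> i"])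
    moreover have "D (\<xi>, \<eta>) < n" using D that by blast
    ultimately show False using that(3) by simp
  qed
  then show ?thesis
    by (intro that [of n]) (auto simp: n_def inj_on_def)
qed

section \<open>The cylinder topology on the boundary\<close>

lemma boundary_prefix: "\<xi> \<in> boundary V \<Longrightarrow> map \<xi> [0..<n] \<in> V"
  by (simp add: boundary_def)

lemma openin_boundary_top_cylinder: "v \<in> V \<Longrightarrow> openin (boundary_top V) (cylinder V v)"
  unfolding boundary_top_def by (auto intro: topology_generated_by_Basis)

text \<open>Cylinders are given only as a subbase; they behave as a base because the cylinders along
  one end are nested.\<close>

lemma openin_boundary_top_prefix:
  assumes "openin (boundary_top V) U" "\<xi> \<in> U"
  shows "\<exists>n. cylinder V (map \<xi> [0..<n]) \<subseteq> U"
proof -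
  have "generate_topology_on {cylinder V v | v. v \<in> V} U"
    using assms(1) by (simp add: boundary_top_def openin_topology_generated_by)
  then show ?thesis
    using assms(2)
  proof (induction U rule: generate_topology_on.induct)
    case (Int a b)
    then obtain m n where mn: "cylinder V (map \<xi> [0..<m]) \<subseteq> a" "cylinder V (map \<xi> [0..<n]) \<subseteq> b"
      by blast
    have cyl: "cylinder V (map \<xi> [0..<max m n]) \<subseteq> cylinder V (map \<xi> [0..<i])" if "i \<le> max m n" for i
    proof
      fix \<eta> assume "\<eta> \<in> cylinder V (map \<xi> [0..<max m n])"
      then have \<eta>: "\<eta> \<in> boundary V" "map \<eta> [0..<max m n] = map \<xi> [0..<max m n]"
        by (auto simp: cylinder_def)
      then have "take i (map \<eta> [0..<max m n]) = take i (map \<xi> [0..<max m n])"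
        by (simp only: \<eta>(2))
      then have "map \<eta> [0..<i] = map \<xi> [0..<i]" using that by (simp add: take_map)
      then show "\<eta> \<in> cylinder V (map \<xi> [0..<i])" using \<eta> by (simp add: cylinder_def)
    qed
    show ?case
      using mn cyl [of m] cyl [of n] by (intro exI [of _ "max m n"]) auto
  next
    case (UN K)
    then show ?case by blast
  next
    case (Basis s)
    then obtain v where v: "s = cylinder V v" by blast
    then have "map \<xi> [0..<length v] = v" using Basis by (simp add: cylinder_def)
    then show ?case using v by (intro exI [of _ "length v"]) simp
  qed simp
qed

context tree_group
begin

lemma topspace_boundary_top: "topspace (boundary_top V) = boundary V"
proof -
  have "cylinder V [] = boundary V" by (auto simp: cylinder_def)
  then show ?thesis
    using Nil_V by (fastforce simp: boundary_top_def topology_generated_by_topspace cylinder_def)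
qed

lemma closedin_boundary_prefix:
  assumes "closedin (boundary_top V) K" "\<xi> \<in> boundary V"
    and "\<And>n. \<exists>\<eta>\<in>K. map \<eta> [0..<n] = map \<xi> [0..<n]"
  shows "\<xi> \<in> K"
proof (rule ccontr)
  assume "\<xi> \<notin> K"
  have K: "openin (boundary_top V) (boundary V - K)" "K \<subseteq> boundary V"
    using assms(1) by (auto simp: closedin_def topspace_boundary_top)
  then obtain n where n: "cylinder V (map \<xi> [0..<n]) \<subseteq> boundary V - K"
    using openin_boundary_top_prefix assms(2) \<open>\<xi> \<notin> K\<close> by blast
  obtain \<eta> where "\<eta> \<in> K" "map \<eta> [0..<n] = map \<xi> [0..<n]" using assms(3) by blast
  then have "\<eta> \<in> cylinder V (map \<xi> [0..<n])" using K(2) by (auto simp: cylinder_def)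
  then show False using n \<open>\<eta> \<in> K\<close> by blast
qed

lemma finite_level: "finite (level V n)"
proof (induction n)
  case 0
  have "level V 0 \<subseteq> {[]}" by (auto simp: level_def)
  then show ?case by (rule finite_subset) simp
next
  case (Suc n)
  have "level V (Suc n) \<subseteq> (\<Union>v\<in>level V n. (\<lambda>i. v @ [i]) ` {i. v @ [i] \<in> V})"
  proof
    fix w assume w: "w \<in> level V (Suc n)"
    then obtain v i where vi: "w = v @ [i]"
      by (cases w rule: rev_cases) (auto simp: level_def)
    moreover have "v \<in> level V n"
      using w take_V [of w n] by (auto simp: vi level_def)
    ultimately show "w \<in> (\<Union>v\<in>level V n. (\<lambda>i. v @ [i]) ` {i. v @ [i] \<in> V})"
      using w by (auto simp: level_def)
  qed
  moreover have "finite (\<Union>v\<in>level V n. (\<lambda>i. v @ [i]) ` {i. v @ [i] \<in> V})"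
    using Suc tree by (auto simp: rooted_lf_tree_def level_def)
  ultimately show ?case by (rule finite_subset)
qed

text \<open>This takes the place of compactness of the boundary: a condition that passes to prefixes
  and is met on every level holds along a whole end.\<close>

lemma ex_boundary_point:
  assumes ne: "\<And>n. \<exists>v\<in>level V n. P v"
    and prefix: "\<And>v. v \<in> V \<Longrightarrow> v \<noteq> [] \<Longrightarrow> P v \<Longrightarrow> P (butlast v)"
  obtains \<xi> where "\<xi> \<in> boundary V" "\<And>n. P (map \<xi> [0..<n])"
proof -
  define Q where "Q = (\<lambda>n. {v \<in> level V n. P v})"
  have "finite (Q n)" "Q n \<noteq> {}" for n
    using finite_level ne by (auto simp: Q_def)
  moreover have "butlast v \<in> Q n" if "v \<in> Q (Suc n)" for n v
  proof -
    have v: "v \<in> V" "length v = Suc n" "P v" using that by (auto simp: Q_def level_def)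
    have "butlast v \<in> V" using take_V [OF v(1), of n] v(2) by (simp add: butlast_conv_take)
    moreover have "v \<noteq> []" using v(2) by auto
    ultimately show ?thesis using prefix v by (simp add: Q_def level_def)
  qed
  ultimately obtain s where s: "\<And>n. s n \<in> Q n" "\<And>n. butlast (s (Suc n)) = s n"
    using koenig [of Q "\<lambda>_. butlast"] by metis
  define \<xi> where "\<xi> = (\<lambda>n. s (Suc n) ! n)"
  have pre: "map \<xi> [0..<n] = s n" for n
  proof (induction n)
    case 0
    then show ?case using s(1) [of 0] by (simp add: Q_def level_def)
  next
    case (Suc n)
    have len: "length (s (Suc n)) = Suc n" using s(1) [of "Suc n"] by (simp add: Q_def level_def)
    then have "s (Suc n) = butlast (s (Suc n)) @ [last (s (Suc n))]"
      by (intro append_butlast_last_id [symmetric]) auto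
    also have "\<dots> = s n @ [s (Suc n) ! n]"
      using len s(2) by (simp add: last_conv_nth length_0_conv [symmetric] del: length_0_conv)
    finally show ?case using Suc by (simp add: \<xi>_def)
  qed
  show ?thesis
  proof (rule that [of \<xi>])
    show "\<xi> \<in> boundary V" using pre s(1) by (auto simp: boundary_def Q_def level_def)
    show "P (map \<xi> [0..<n])" for n using pre s(1) by (simp add: Q_def)
  qed
qed

text \<open>Each letter of \<open>bd_act g \<xi>\<close> is read from the image of a different
  prefix; the letters fit together because \<open>g\<close> commutes with truncation.\<close>

lemma prefix_bd_act:
  assumes "g \<in> G" "\<xi> \<in> boundary V"
  shows "map (bd_act g \<xi>) [0..<n] = g (map \<xi> [0..<n])"
proof (rule nth_equalityI)
  have V: "map \<xi> [0..<m] \<in> V" for m using boundary_prefix [OF assms(2)] .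
  show "length (map (bd_act g \<xi>) [0..<n]) = length (g (map \<xi> [0..<n]))"
    using length_app [OF assms(1) V] by simp
  fix i assume "i < length (map (bd_act g \<xi>) [0..<n])"
  then have i: "i < n" by simp
  have "g (map \<xi> [0..<Suc i]) = take (Suc i) (g (map \<xi> [0..<n]))"
    using take_app [OF assms(1) V, of "Suc i" n] i by (simp add: take_map del: upt_Suc)
  then show "map (bd_act g \<xi>) [0..<n] ! i = g (map \<xi> [0..<n]) ! i"
    using i by (simp add: bd_act_def del: upt_Suc)
qed

lemma bd_act_boundary:
  assumes "g \<in> G" "\<xi> \<in> boundary V"
  shows "bd_act g \<xi> \<in> boundary V"
proof -
  have "map (bd_act g \<xi>) [0..<n] \<in> V" for n
    unfolding prefix_bd_act [OF assms]
    by (rule app_V [OF G_carrier [OF assms(1)] boundary_prefix [OF assms(2)]])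
  then show ?thesis by (simp add: boundary_def)
qed

lemma bd_act_inv:
  assumes "g \<in> G" "\<xi> \<in> boundary V"
  shows "bd_act g (bd_act (inv g) \<xi>) = \<xi>"
proof (rule prefixes_eq_imp_eq)
  fix n
  show "map (bd_act g (bd_act (inv g) \<xi>)) [0..<n] = map \<xi> [0..<n]"
    using assms inv_app(2) [OF G_carrier boundary_prefix]
    by (simp add: prefix_bd_act bd_act_boundary G_closed)
qed

end

locale tree_action = branch_tree_group +
  fixes X :: "'x topology" and H :: "('x \<Rightarrow> 'x) set" and S :: "('x \<Rightarrow> 'x) set"
    and \<rho> :: "(nat list \<Rightarrow> nat list) \<Rightarrow> 'x \<Rightarrow> 'x"
  assumes subgroup_H: "subgroup H (BijGroup (topspace X))" and H_homeo: "H \<subseteq> Homeo X"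
    and S: "S \<subseteq> H" "\<And>s. s \<in> S \<Longrightarrow> inv\<^bsub>BijGroup (topspace X)\<^esub> s \<in> S"
      "generate (BijGroup (topspace X)) S = H"
    and \<rho>_hom: "\<rho> \<in> hom (B\<lparr>carrier := G\<rparr>) ((BijGroup (topspace X))\<lparr>carrier := H\<rparr>)"
begin

definition sp :: "nat list \<Rightarrow> 'x set" where
  "sp v = supp_in X \<rho> (derived B (R v))"

definition q :: "'x \<Rightarrow> (nat \<Rightarrow> nat) set" where
  "q y = {\<xi> \<in> boundary V. \<forall>n. y \<in> sp (map \<xi> [0..<n])}"

definition pointwise_stab :: "'x set \<Rightarrow> (nat list \<Rightarrow> nat list) set" where
  "pointwise_stab U = {g \<in> G. \<forall>x\<in>U. \<rho> g x = x}"

section \<open>The action on the space\<close>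

lemma group_BX: "group (BijGroup (topspace X))"
  by (rule group_BijGroup)

lemma \<rho>_H: "g \<in> G \<Longrightarrow> \<rho> g \<in> H"
  using \<rho>_hom by (auto simp: hom_def)

lemma \<rho>_Bij: "g \<in> G \<Longrightarrow> \<rho> g \<in> Bij (topspace X)"
  using \<rho>_H H_homeo by (auto simp: Homeo_def)

lemma \<rho>_homeo: "g \<in> G \<Longrightarrow> homeomorphic_map X X (\<rho> g)"
  using \<rho>_H H_homeo by (auto simp: Homeo_def)

lemma \<rho>_topspace: "g \<in> G \<Longrightarrow> x \<in> topspace X \<Longrightarrow> \<rho> g x \<in> topspace X"
  using \<rho>_Bij Bij_imp_funcset by blast

lemma \<rho>_mult:
  assumes "g \<in> G" "h \<in> G" "x \<in> topspace X"
  shows "\<rho> (g \<otimes> h) x = \<rho> g (\<rho> h x)"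
proof -
  have "\<rho> (g \<otimes> h) = \<rho> g \<otimes>\<^bsub>BijGroup (topspace X)\<^esub> \<rho> h"
    using assms \<rho>_hom by (simp add: hom_def)
  then show ?thesis
    using assms \<rho>_Bij by (simp add: BijGroup_def compose_def)
qed

lemma \<rho>_one:
  assumes "x \<in> topspace X"
  shows "\<rho> \<one> x = x"
proof -
  have "\<rho> \<one> (\<rho> \<one> x) = \<rho> \<one> x"
    using \<rho>_mult [OF G_closed(3) G_closed(3) assms] by simp
  then show ?thesis
    using \<rho>_Bij [OF G_closed(3)] \<rho>_topspace [OF G_closed(3)] assms
    by (auto simp: Bij_def bij_betw_def inj_on_def)
qed

lemma \<rho>_inv:
  assumes "g \<in> G" "x \<in> topspace X"
  shows "\<rho> (inv g) (\<rho> g x) = x" "\<rho> g (\<rho> (inv g) x) = x"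
  using assms \<rho>_mult [of "inv g" g x] \<rho>_mult [of g "inv g" x] \<rho>_one
  by (simp_all add: G_closed G_carrier)

lemma subgroup_pointwise_stab:
  assumes "U \<subseteq> topspace X"
  shows "subgroup (pointwise_stab U) B"
proof (rule subgroupI)
  show "pointwise_stab U \<subseteq> carrier B" using G_carrier by (auto simp: pointwise_stab_def)
  have "\<one> \<in> pointwise_stab U" using assms \<rho>_one G_closed by (auto simp: pointwise_stab_def)
  then show "pointwise_stab U \<noteq> {}" by blast
next
  fix a assume a: "a \<in> pointwise_stab U"
  have "\<rho> (inv a) x = x" if "x \<in> U" for x
    using \<rho>_inv(1) [of a x] a that assms by (auto simp: pointwise_stab_def)
  then show "inv a \<in> pointwise_stab U" using a by (simp add: pointwise_stab_def G_closed)
next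
  fix a b assume "a \<in> pointwise_stab U" "b \<in> pointwise_stab U"
  then show "a \<otimes> b \<in> pointwise_stab U"
    using assms by (auto simp: pointwise_stab_def \<rho>_mult G_closed subset_iff)
qed

section \<open>Supports of derived rigid stabilisers\<close>

lemma supp_in_iff:
  "y \<in> supp_in X \<rho> A \<longleftrightarrow>
    y \<in> topspace X \<and> (\<forall>U. openin X U \<longrightarrow> y \<in> U \<longrightarrow> (\<exists>g\<in>A. \<exists>x\<in>U. \<rho> g x \<noteq> x))"
proof -
  have "(\<exists>x. x \<in> {x \<in> topspace X. \<exists>k\<in>A. \<rho> k x \<noteq> x} \<and> x \<in> U) \<longleftrightarrow> (\<exists>g\<in>A. \<exists>x\<in>U. \<rho> g x \<noteq> x)"
    if "openin X U" for U
    using openin_subset [OF that] by blast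
  then show ?thesis
    unfolding supp_in_def in_closure_of by blast
qed

lemma supp_in_mono: "A \<subseteq> A' \<Longrightarrow> supp_in X \<rho> A \<subseteq> supp_in X \<rho> A'"
  unfolding supp_in_def by (rule closure_of_mono) blast

lemma sp_mono: "below u v \<Longrightarrow> sp v \<subseteq> sp u"
  unfolding sp_def by (intro supp_in_mono mono_derived R_mono)

lemma sp_topspace: "sp v \<subseteq> topspace X"
  unfolding sp_def supp_in_def by (rule closure_of_subset_topspace)

lemma closedin_sp: "closedin X (sp v)"
  unfolding sp_def supp_in_def by (rule closedin_closure_of)

lemma derived_R_G: "derived B (R v) \<subseteq> G"
  using R_G by (intro derived_incl subgroup_G) blast

text \<open>This is the form in which membership in \<open>sp\<close> later yields the hypothesis
  \<open>nonlocal\<close>.\<close>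

lemma sp_iff:
  "y \<in> sp v \<longleftrightarrow> y \<in> topspace X \<and>
    (\<forall>U. openin X U \<longrightarrow> y \<in> U \<longrightarrow> \<not> derived B (R v) \<subseteq> pointwise_stab U)"
proof -
  have "(\<exists>g\<in>derived B (R v). \<exists>x\<in>U. \<rho> g x \<noteq> x) \<longleftrightarrow> \<not> derived B (R v) \<subseteq> pointwise_stab U" for U
    using derived_R_G by (auto simp: pointwise_stab_def subset_iff)
  then show ?thesis
    unfolding sp_def supp_in_iff by simp
qed

lemma rist_level_fixes_level:
  assumes "g \<in> rist_level V G n" "v \<in> level V n"
  shows "g v = v"
proof -
  obtain a c where ac: "a \<in> R v" "c \<in> fixing v" "g = a \<otimes> c"
    using rist_level_decomp [OF assms(2,1)] by blast
  have v: "v \<in> V" using assms(2) by (simp add: level_def)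
  then show ?thesis
    using ac R_app_self below_refl R_carrier fixing_carrier [OF ac(2)] by (simp add: mult_app fixing_def)
qed

text \<open>Rigid stabilisers of distinct vertices of a level commute, so only commutators within
  one of them survive. Their span is normalised because the level group fixes each vertex of its
  level.\<close>

lemma derived_rist_level:
  "derived B (rist_level V G n) \<subseteq> generate B (\<Union>v\<in>level V n. derived B (R v))"
proof -
  let ?W = "\<Union>v\<in>level V n. derived B (R v)"
  have W: "?W \<subseteq> carrier B" using derived_R_G G_carrier by blast
  show ?thesis
    unfolding rist_level_generate
  proof (rule derived_generate_subset [OF rist_union_carrier generate_is_subgroup [OF W]])
    fix g d assume g: "g \<in> generate B (\<Union>v\<in>level V n. R v)" and d: "d \<in> generate B ?W"
    then have gL: "g \<in> rist_level V G n" by (simp add: rist_level_generate)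
    then have gG: "g \<in> G" "g \<in> carrier B" using rist_level_subset_G G_carrier by blast+
    have W': "g \<otimes> h \<otimes> inv g \<in> ?W" if "h \<in> ?W" for h
    proof -
      obtain v where v: "v \<in> level V n" "h \<in> derived B (R v)" using \<open>h \<in> ?W\<close> by blast
      then have "g \<otimes> h \<otimes> inv g \<in> derived B (R (g v))"
        using gG by (intro derived_R_conj) (auto simp: level_def)
      then show ?thesis using v(1) rist_level_fixes_level [OF gL v(1)] by auto
    qed
    show "g \<otimes> d \<otimes> inv g \<in> generate B ?W"
      using d
    proof (induction d rule: generate.induct)
      case one
      then show ?case using gG by (simp add: generate.one)
    next
      case (incl h)
      then show ?case using W' by (blast intro: generate.incl)
    next
      case (inv h)
      have "inv (g \<otimes> h \<otimes> inv g) \<in> generate B ?W" using W' [OF inv] by (rule generate.inv)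
      moreover have "h \<in> carrier B" using inv W by blast
      ultimately show ?case using gG by (simp add: group_norm)
    next
      case (eng h1 h2)
      have "h1 \<in> carrier B" "h2 \<in> carrier B" using eng generate_in_carrier [OF W] by blast+
      then have "g \<otimes> (h1 \<otimes> h2) \<otimes> inv g = (g \<otimes> h1 \<otimes> inv g) \<otimes> (g \<otimes> h2 \<otimes> inv g)"
        using gG by (simp add: group_norm)
      then show ?case using generate.eng [OF eng.IH] by simp
    qed
  next
    fix s t assume "s \<in> (\<Union>v\<in>level V n. R v)" "t \<in> (\<Union>v\<in>level V n. R v)"
    then obtain u v where u: "u \<in> level V n" "s \<in> R u" and v: "v \<in> level V n" "t \<in> R v" by blast
    show "s \<otimes> t \<otimes> inv s \<otimes> inv t \<in> generate B ?W"
    proof (cases "u = v")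
      case True
      then have "s \<otimes> t \<otimes> inv s \<otimes> inv t \<in> derived B (R v)"
        unfolding derived_def using u v by (intro generate.incl) auto
      then show ?thesis using v(1) by (blast intro: generate.incl)
    next
      case False
      then have "R v \<subseteq> fixing u"
        using u v by (intro incomparable_R_fixing incomparable_same_length) (auto simp: level_def)
      then have "s \<otimes> t = t \<otimes> s" using R_fixing_commute u v by blast
      then have "s \<otimes> t \<otimes> inv s \<otimes> inv t = \<one>"
        using u v R_carrier by (simp add: m_assoc)
      then show ?thesis by (simp add: generate.one)
    qed
  qed
qed

text \<open>The sets \<open>sp v\<close> of one level form a finite union of closed sets, outside of
  which all generators of the derived level group act trivially.\<close>

lemma supp_rist_level:
  assumes "y \<in> supp_in X \<rho> (derived B (rist_level V G n))"
  obtains v where "v \<in> level V n" "y \<in> sp v"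
proof (rule ccontr)
  assume "\<not> thesis"
  then have no: "\<And>v. v \<in> level V n \<Longrightarrow> y \<notin> sp v" using that by blast
  define U where "U = topspace X - (\<Union>v\<in>level V n. sp v)"
  have "openin X U"
    unfolding U_def using finite_level closedin_sp by (intro openin_diff closedin_Union) auto
  moreover have "y \<in> U" using assms no by (auto simp: U_def supp_in_iff)
  ultimately obtain g x where gx: "g \<in> derived B (rist_level V G n)" "x \<in> U" "\<rho> g x \<noteq> x"
    using assms unfolding supp_in_iff by blast
  have x: "x \<in> topspace X" using gx(2) by (simp add: U_def)
  have "derived B (R v) \<subseteq> pointwise_stab {x}" if v: "v \<in> level V n" for v
  proof
    fix h assume h: "h \<in> derived B (R v)"
    have "\<rho> h x = x"
    proof (rule ccontr)
      assume "\<rho> h x \<noteq> x"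
      then have "x \<in> sp v"
        unfolding sp_def supp_in_iff using h x by blast
      then show False using gx(2) v by (simp add: U_def)
    qed
    then show "h \<in> pointwise_stab {x}" using h derived_R_G by (auto simp: pointwise_stab_def)
  qed
  then have "generate B (\<Union>v\<in>level V n. derived B (R v)) \<subseteq> pointwise_stab {x}"
    using subgroup_pointwise_stab [of "{x}"] x by (intro generate_subgroup_incl) auto
  then show False using gx derived_rist_level by (auto simp: pointwise_stab_def)
qed

lemma ess_support_iff:
  "ess_support V G X \<rho> = (\<Inter>n\<in>{1..}. supp_in X \<rho> (derived B (rist_level V G n)))"
  by (simp add: ess_support_def B_eq)

lemma ess_support_level:
  assumes "y \<in> ess_support V G X \<rho>"
  shows "\<exists>v\<in>level V n. y \<in> sp v"
proof (cases "1 \<le> n")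
  case True
  then have "y \<in> supp_in X \<rho> (derived B (rist_level V G n))"
    using assms by (auto simp: ess_support_iff)
  then show ?thesis by (rule supp_rist_level) blast
next
  case False
  \<comment> \<open>The essential support only constrains levels from 1 on; the root is handled by
    monotonicity from level 1.\<close>
  have "y \<in> supp_in X \<rho> (derived B (rist_level V G 1))"
    using assms by (auto simp: ess_support_iff)
  then obtain v where v: "v \<in> level V 1" "y \<in> sp v" by (rule supp_rist_level)
  have "below [] v" using v by (simp add: below_def level_def)
  then have "y \<in> sp []" using sp_mono v(2) by blast
  then show ?thesis using False Nil_V by (auto simp: level_def)
qed

lemma ess_support_topspace: "y \<in> ess_support V G X \<rho> \<Longrightarrow> y \<in> topspace X"
  using ess_support_level [of y 0] sp_topspace by blast

lemma sp_butlast: "v \<in> V \<Longrightarrow> y \<in> sp v \<Longrightarrow> y \<in> sp (butlast v)"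
  using sp_mono [of "butlast v" v] by (auto simp: below_def butlast_conv_take)

lemma q_nonempty:
  assumes "y \<in> ess_support V G X \<rho>"
  shows "q y \<noteq> {}"
proof -
  obtain \<xi> where "\<xi> \<in> boundary V" "\<And>n. y \<in> sp (map \<xi> [0..<n])"
    using ex_boundary_point [of "\<lambda>v. y \<in> sp v"] ess_support_level [OF assms] sp_butlast by blast
  then show ?thesis by (auto simp: q_def)
qed

lemma closedin_q: "closedin (boundary_top V) (q y)"
proof -
  have "boundary V - q y = \<Union> {cylinder V v | v. v \<in> V \<and> y \<notin> sp v}"
  proof (intro equalityI subsetI)
    fix \<xi> assume "\<xi> \<in> boundary V - q y"
    then obtain n where n: "\<xi> \<in> boundary V" "y \<notin> sp (map \<xi> [0..<n])" by (auto simp: q_def)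
    then have "\<xi> \<in> cylinder V (map \<xi> [0..<n])" by (simp add: cylinder_def)
    then show "\<xi> \<in> \<Union> {cylinder V v | v. v \<in> V \<and> y \<notin> sp v}"
      using n boundary_prefix [OF n(1), of n] by blast
  next
    fix \<xi> assume "\<xi> \<in> \<Union> {cylinder V v | v. v \<in> V \<and> y \<notin> sp v}"
    then obtain v where "\<xi> \<in> boundary V" "map \<xi> [0..<length v] = v" "y \<notin> sp v"
      by (auto simp: cylinder_def)
    then show "\<xi> \<in> boundary V - q y" unfolding q_def by (metis (mono_tags, lifting) DiffI mem_Collect_eq)
  qed
  moreover have "openin (boundary_top V) (\<Union> {cylinder V v | v. v \<in> V \<and> y \<notin> sp v})"
    by (intro openin_Union) (auto intro: openin_boundary_top_cylinder)
  ultimately show ?thesis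
    by (auto simp: closedin_def topspace_boundary_top q_def)
qed

text \<open>Disjointness of \<open>q y\<close> from \<open>K\<close> is already witnessed on one
  finite level: no prefix of a point of \<open>K\<close> there has \<open>y\<close> in its support.
  Near \<open>y\<close> it remains to avoid finitely many closed supports.\<close>

lemma q_upper_semicontinuous:
  assumes K: "closedin (boundary_top V) K"
  shows "openin (subtopology X (ess_support V G X \<rho>)) {y \<in> ess_support V G X \<rho>. q y \<inter> K = {}}"
proof (subst openin_subopen, intro ballI)
  let ?Y = "ess_support V G X \<rho>"
  fix y assume "y \<in> {y \<in> ?Y. q y \<inter> K = {}}"
  then have y: "y \<in> ?Y" "q y \<inter> K = {}" by auto
  define inK where "inK = (\<lambda>v. \<exists>\<eta>\<in>K. map \<eta> [0..<length v] = v)"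
  have inK: "inK (butlast v)" if "inK v" for v
  proof -
    obtain \<eta> where \<eta>: "\<eta> \<in> K" "map \<eta> [0..<length v] = v" using \<open>inK v\<close> inK_def by blast
    have "take (length v - 1) (map \<eta> [0..<length v]) = butlast v"
      using \<eta>(2) by (simp add: butlast_conv_take)
    then have "map \<eta> [0..<length (butlast v)] = butlast v"
      by (simp add: take_map)
    then show ?thesis using \<eta>(1) inK_def by blast
  qed
  have "\<exists>n. \<forall>v\<in>level V n. \<not> (y \<in> sp v \<and> inK v)"
  proof (rule ccontr)
    assume "\<not> ?thesis"
    then have "\<And>n. \<exists>v\<in>level V n. y \<in> sp v \<and> inK v" by blast
    then obtain \<xi> where \<xi>: "\<xi> \<in> boundary V" "\<And>n. y \<in> sp (map \<xi> [0..<n]) \<and> inK (map \<xi> [0..<n])"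
      using ex_boundary_point [of "\<lambda>v. y \<in> sp v \<and> inK v"] inK sp_butlast by blast
    have "\<xi> \<in> K"
    proof (rule closedin_boundary_prefix [OF K \<xi>(1)])
      show "\<exists>\<eta>\<in>K. map \<eta> [0..<n] = map \<xi> [0..<n]" for n
        using \<xi>(2) [of n] by (simp add: inK_def)
    qed
    moreover have "\<xi> \<in> q y" using \<xi> by (simp add: q_def)
    ultimately show False using y by blast
  qed
  then obtain n where n: "\<And>v. v \<in> level V n \<Longrightarrow> inK v \<Longrightarrow> y \<notin> sp v" by blast
  define U where "U = topspace X - (\<Union>v\<in>{v \<in> level V n. inK v}. sp v)"
  have "openin X U"
    unfolding U_def using finite_level [of n] closedin_sp by (intro openin_diff closedin_Union) auto
  then have "openin (subtopology X ?Y) (U \<inter> ?Y)"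
    by (auto simp: openin_subtopology)
  moreover have "y \<in> U \<inter> ?Y" using y n ess_support_topspace by (auto simp: U_def)
  moreover have "U \<inter> ?Y \<subseteq> {y \<in> ?Y. q y \<inter> K = {}}"
  proof
    fix z assume z: "z \<in> U \<inter> ?Y"
    have "\<xi> \<notin> K" if "\<xi> \<in> q z" for \<xi>
    proof
      assume "\<xi> \<in> K"
      then have "inK (map \<xi> [0..<n])" by (auto simp: inK_def)
      moreover have "map \<xi> [0..<n] \<in> level V n" "z \<in> sp (map \<xi> [0..<n])"
        using that boundary_prefix by (auto simp: q_def level_def)
      ultimately show False using z by (auto simp: U_def)
    qed
    then show "z \<in> {y \<in> ?Y. q y \<inter> K = {}}" using z by blast
  qed
  ultimately show "\<exists>T. openin (subtopology X ?Y) T \<and> y \<in> T \<and> T \<subseteq> {y \<in> ?Y. q y \<inter> K = {}}"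
    by blast
qed

lemma sp_equivariant:
  assumes "g \<in> G" "v \<in> V" "y \<in> sp v"
  shows "\<rho> g y \<in> sp (g v)"
proof -
  have y: "y \<in> topspace X" using assms(3) sp_topspace by blast
  show ?thesis
    unfolding sp_def supp_in_iff
  proof (intro conjI allI impI)
    show "\<rho> g y \<in> topspace X" using assms(1) y by (rule \<rho>_topspace)
    fix U assume U: "openin X U" "\<rho> g y \<in> U"
    define W where "W = {x \<in> topspace X. \<rho> g x \<in> U}"
    have "openin X W"
      unfolding W_def using \<rho>_homeo [OF assms(1)] U(1)
      by (intro openin_continuous_map_preimage [of X X]) (auto simp: homeomorphic_imp_continuous_map)
    moreover have "y \<in> W" using y U(2) by (simp add: W_def)
    ultimately obtain h x where hx: "h \<in> derived B (R v)" "x \<in> W" "\<rho> h x \<noteq> x"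
      using assms(3) unfolding sp_def supp_in_iff by blast
    have x: "x \<in> topspace X" "\<rho> g x \<in> U" using hx(2) by (auto simp: W_def)
    have h: "h \<in> G" using hx(1) derived_R_G by blast
    have "\<rho> (g \<otimes> h \<otimes> inv g) (\<rho> g x) = \<rho> g (\<rho> h x)"
      using assms(1) h x by (simp add: \<rho>_mult \<rho>_inv \<rho>_topspace G_closed)
    moreover have "\<rho> g (\<rho> h x) \<noteq> \<rho> g x"
      using hx(3) \<rho>_inv(1) [OF assms(1)] x(1) \<rho>_topspace [OF h x(1)] by metis
    ultimately show "\<exists>k\<in>derived B (R (g v)). \<exists>z\<in>U. \<rho> k z \<noteq> z"
      using derived_R_conj [OF assms(1,2) hx(1)] x(2) by (metis)
  qed
qed

lemma q_equivariant_subset: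
  assumes "g \<in> G" "y \<in> topspace X"
  shows "bd_act g ` q y \<subseteq> q (\<rho> g y)"
proof
  fix \<eta> assume "\<eta> \<in> bd_act g ` q y"
  then obtain \<xi> where \<xi>: "\<xi> \<in> boundary V" "\<And>n. y \<in> sp (map \<xi> [0..<n])" "\<eta> = bd_act g \<xi>"
    by (auto simp: q_def)
  have "\<rho> g y \<in> sp (map \<eta> [0..<n])" for n
    using sp_equivariant [OF assms(1) boundary_prefix [OF \<xi>(1)] \<xi>(2), of n]
    by (simp add: \<xi>(3) prefix_bd_act [OF assms(1) \<xi>(1)])
  then show "\<eta> \<in> q (\<rho> g y)"
    using bd_act_boundary [OF assms(1) \<xi>(1)] \<xi>(3) by (simp add: q_def)
qed

lemma q_equivariant:
  assumes "g \<in> G" "y \<in> topspace X"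
  shows "q (\<rho> g y) = bd_act g ` q y"
proof
  show "q (\<rho> g y) \<subseteq> bd_act g ` q y"
  proof
    fix \<eta> assume \<eta>: "\<eta> \<in> q (\<rho> g y)"
    then have "bd_act (inv g) \<eta> \<in> q (\<rho> (inv g) (\<rho> g y))"
      using q_equivariant_subset [of "inv g" "\<rho> g y"] assms by (auto simp: G_closed \<rho>_topspace)
    then have "bd_act (inv g) \<eta> \<in> q y" using \<rho>_inv(1) [OF assms] by simp
    moreover have "\<eta> = bd_act g (bd_act (inv g) \<eta>)"
      using bd_act_inv [OF assms(1)] \<eta> by (simp add: q_def)
    ultimately show "\<eta> \<in> bd_act g ` q y" by blast
  qed
qed (rule q_equivariant_subset [OF assms])

text \<open>By transitivity \<open>R v\<close> is conjugate to \<open>R w\<close> for the prefix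
  \<open>w\<close> of \<open>\<xi>\<close> of the same length. If these groups were abelian, the
  derived subgroup of \<open>R w\<close> would act trivially, contradicting that \<open>y\<close> is
  in its support.\<close>

lemma nonabelian_if_q_nonempty:
  assumes "\<xi> \<in> q y" "v \<in> V"
  shows "\<exists>a\<in>R v. \<exists>b\<in>R v. a \<otimes> b \<noteq> b \<otimes> a"
proof (rule ccontr)
  assume "\<not> ?thesis"
  then have comm: "\<And>a b. a \<in> R v \<Longrightarrow> b \<in> R v \<Longrightarrow> a \<otimes> b = b \<otimes> a" by blast
  define w where "w = map \<xi> [0..<length v]"
  have w: "w \<in> V" "y \<in> sp w"
    using assms(1) boundary_prefix by (auto simp: q_def w_def)
  obtain g where g: "g \<in> G" "g w = v"
    using transitive [OF w(1) assms(2)] by (auto simp: w_def)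
  have gcar: "g \<in> carrier B" using g G_carrier by blast
  have commw: "a \<otimes> b \<otimes> inv a \<otimes> inv b = \<one>" if ab: "a \<in> R w" "b \<in> R w" for a b
  proof -
    have car: "a \<in> carrier B" "b \<in> carrier B" using ab R_carrier by auto
    let ?c = "\<lambda>a. g \<otimes> a \<otimes> inv g"
    have "?c a \<otimes> ?c b = ?c b \<otimes> ?c a"
      using comm R_conj [OF g(1) w(1)] ab g(2) by auto
    then have "inv g \<otimes> (?c a \<otimes> ?c b) \<otimes> g = inv g \<otimes> (?c b \<otimes> ?c a) \<otimes> g" by simp
    then have "a \<otimes> b = b \<otimes> a" using car gcar by (simp add: group_norm)
    then show ?thesis using car by (simp add: m_assoc)
  qed
  have "derived B (R w) \<subseteq> pointwise_stab (topspace X)"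
    unfolding derived_def
    using commw subgroup.one_closed [OF subgroup_pointwise_stab [OF subset_refl]]
    by (intro generate_subgroup_incl subgroup_pointwise_stab) auto
  then show False using w(2) unfolding sp_iff by blast
qed

section \<open>Germ stabilisers and the cardinality bound\<close>

lemma subgroup_germ_stab:
  assumes y: "y \<in> topspace X"
  shows "subgroup (germ_stab X H y) (BijGroup (topspace X))"
proof -
  interpret BX: group "BijGroup (topspace X)" by (rule group_BX)
  have HB: "h \<in> Bij (topspace X)" if "h \<in> H" for h using that H_homeo by (auto simp: Homeo_def)
  show ?thesis
  proof (rule BX.subgroupI)
    show "germ_stab X H y \<subseteq> carrier (BijGroup (topspace X))"
      using HB by (auto simp: germ_stab_def BijGroup_def)
    have "\<one>\<^bsub>BijGroup (topspace X)\<^esub> \<in> germ_stab X H y"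
      using y subgroup.one_closed [OF subgroup_H]
      by (auto simp: germ_stab_def BijGroup_def intro!: exI [of _ "topspace X"])
    then show "germ_stab X H y \<noteq> {}" by blast
  next
    fix a assume "a \<in> germ_stab X H y"
    then obtain U where U: "a \<in> H" "openin X U" "y \<in> U" "\<And>x. x \<in> U \<Longrightarrow> a x = x"
      by (auto simp: germ_stab_def)
    have "(inv\<^bsub>BijGroup (topspace X)\<^esub> a) x = x" if "x \<in> U" for x
    proof -
      have x: "x \<in> topspace X" using openin_subset [OF U(2)] \<open>x \<in> U\<close> by blast
      have "inj_on a (topspace X)" using HB [OF U(1)] by (simp add: Bij_def bij_betw_def)
      then have "inv_into (topspace X) a (a x) = x" using x by (rule inv_into_f_f)
      then show ?thesis using x U(4) [OF \<open>x \<in> U\<close>] by (simp add: inv_BijGroup [OF HB [OF U(1)]])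
    qed
    then show "inv\<^bsub>BijGroup (topspace X)\<^esub> a \<in> germ_stab X H y"
      using U subgroup.m_inv_closed [OF subgroup_H] unfolding germ_stab_def by blast
  next
    fix a b assume "a \<in> germ_stab X H y" "b \<in> germ_stab X H y"
    then obtain U W where U: "a \<in> H" "openin X U" "y \<in> U" "\<And>x. x \<in> U \<Longrightarrow> a x = x"
      and W: "b \<in> H" "openin X W" "y \<in> W" "\<And>x. x \<in> W \<Longrightarrow> b x = x"
      by (auto simp: germ_stab_def)
    have "(a \<otimes>\<^bsub>BijGroup (topspace X)\<^esub> b) x = x" if "x \<in> U \<inter> W" for x
    proof -
      have "x \<in> topspace X" using openin_subset [OF U(2)] that by blast
      then show ?thesis
        using that U W HB by (simp add: BijGroup_def compose_def)
    qed
    moreover have "openin X (U \<inter> W)" using U W by blast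
    ultimately show "a \<otimes>\<^bsub>BijGroup (topspace X)\<^esub> b \<in> germ_stab X H y"
      using U W subgroup.m_closed [OF subgroup_H] unfolding germ_stab_def by blast
  qed
qed

text \<open>Formulated for finite subsets, since finiteness of \<open>q y\<close> is to be derived
  from this bound.\<close>

lemma leud_ge_card_q:
  assumes y: "y \<in> topspace X" and A: "finite A" "A \<subseteq> q y" "A \<noteq> {}"
  shows "enat (card A) \<le> leud (germ_vertices X H y) (germ_edges X H S y)"
proof -
  obtain \<xi>0 where "\<xi>0 \<in> q y" using A by blast
  then interpret nonabelian_branch_tree_group B V G
    by unfold_locales (rule nonabelian_if_q_nonempty)
  define K where "K = {g \<in> G. \<rho> g \<in> germ_stab X H y}"
  \<comment> \<open>Intersecting neighbourhoods enlarges their pointwise stabilisers, which makes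
    this family directed with union \<open>K\<close>.\<close>
  define \<U> where "\<U> = {pointwise_stab U | U. openin X U \<and> y \<in> U}"
  have K_iff: "g \<in> K \<longleftrightarrow> (\<exists>U. openin X U \<and> y \<in> U \<and> g \<in> pointwise_stab U)" for g
    using \<rho>_H by (auto simp: K_def germ_stab_def pointwise_stab_def)
  have \<U>: "subgroup K0 B \<and> K0 \<subseteq> K" if "K0 \<in> \<U>" for K0
    using that K_iff subgroup_pointwise_stab openin_subset unfolding \<U>_def by blast
  have directed: "\<exists>K0\<in>\<U>. F \<subseteq> K0" if "finite F" "F \<subseteq> K" for F
  proof -
    have "\<exists>U. openin X U \<and> y \<in> U \<and> F \<subseteq> pointwise_stab U"
      using that
    proof (induction F rule: finite_induct)
      case empty
      then show ?case using y by blast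
    next
      case (insert g F)
      then obtain U W where "openin X U" "y \<in> U" "F \<subseteq> pointwise_stab U"
        and "openin X W" "y \<in> W" "g \<in> pointwise_stab W"
        using K_iff by auto
      then show ?case
        by (intro exI [of _ "U \<inter> W"]) (auto simp: pointwise_stab_def)
    qed
    then show ?thesis unfolding \<U>_def by blast
  qed
  \<comment> \<open>Each subgroup axiom involves at most two elements, which lie in a common member
    of \<open>\<U>\<close>.\<close>
  have subK: "subgroup K B"
  proof (rule subgroupI)
    show "K \<subseteq> carrier B" using G_carrier by (auto simp: K_def)
    obtain K0 where "K0 \<in> \<U>" using directed [of "{}"] by blast
    then show "K \<noteq> {}" using \<U> [of K0] subgroup.one_closed [of K0 B] by blast
  next
    fix a assume "a \<in> K"
    then obtain K0 where "K0 \<in> \<U>" "a \<in> K0" using directed [of "{a}"] by blast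
    then show "inv a \<in> K" using \<U> [of K0] subgroup.m_inv_closed [of K0 B a] by blast
  next
    fix a b assume "a \<in> K" "b \<in> K"
    then obtain K0 where "K0 \<in> \<U>" "a \<in> K0" "b \<in> K0" using directed [of "{a, b}"] by blast
    then show "a \<otimes> b \<in> K" using \<U> [of K0] subgroup.m_closed [of K0 B a b] by blast
  qed
  obtain h where h: "bij_betw h {0..<card A} A"
    using ex_bij_betw_nat_finite [OF A(1)] by blast
  obtain n where n: "1 \<le> n" "inj_on (\<lambda>\<xi>. map \<xi> [0..<n]) A"
    using ex_separating_level [OF A(1)] by blast
  have hA: "h i \<in> q y" if "i < card A" for i
    using h that A(2) by (auto simp: bij_betw_def)
  have "enat (card A) \<le> leud {h <#\<^bsub>BijGroup (topspace X)\<^esub> germ_stab X H y | h. h \<in> H}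
      {(h <#\<^bsub>BijGroup (topspace X)\<^esub> germ_stab X H y,
        (s \<otimes>\<^bsub>BijGroup (topspace X)\<^esub> h) <#\<^bsub>BijGroup (topspace X)\<^esub> germ_stab X H y) | h s. h \<in> H \<and> s \<in> S}"
  proof (rule leud_ge_ends [OF group_BX subgroup_H S subgroup_germ_stab [OF y] \<rho>_hom K_def subK
          directed \<U> _ _ n(1)])
    show "map (h i) [0..<m] \<in> V" if "i < card A" for i m
      using hA [OF that] boundary_prefix by (simp add: q_def)
    show "\<not> derived B (R (map (h i) [0..<p])) \<subseteq> K0" if "i < card A" "K0 \<in> \<U>" for K0 p i
    proof -
      have "y \<in> sp (map (h i) [0..<p])" using hA [OF that(1)] by (simp add: q_def)
      then show ?thesis using that(2) unfolding sp_iff \<U>_def by blast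
    qed
    have "inj_on h {..<card A}" "h ` {..<card A} = A"
      using h by (auto simp: bij_betw_def lessThan_atLeast0)
    then show "inj_on (\<lambda>i. map (h i) [0..<n]) {..<card A}"
      using n(2) comp_inj_on [of h "{..<card A}" "\<lambda>\<xi>. map \<xi> [0..<n]"] by (simp add: comp_def)
  qed
  then show ?thesis
    by (simp add: germ_vertices_def germ_edges_def)
qed

end

theorem theorem6p24:
  fixes V :: "nat list set" and G :: "(nat list \<Rightarrow> nat list) set"
    and X :: "'x topology" and H :: "('x \<Rightarrow> 'x) set" and S :: "('x \<Rightarrow> 'x) set"
    and \<rho> :: "(nat list \<Rightarrow> nat list) \<Rightarrow> ('x \<Rightarrow> 'x)"
  assumes tree: "rooted_lf_tree V"
    and G_aut: "subgroup G (BijGroup V)" "\<forall>g\<in>G. tree_aut V g"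
    and G_fg: "fin_gen (BijGroup V) G"
    and G_branch: "branch_group V G"
    and X_cpt: "compact_space X"
    and H_homeo: "subgroup H (BijGroup (topspace X))" "H \<subseteq> Homeo X"
    and H_fg: "fin_gen (BijGroup (topspace X)) H"
    and S_gen: "finite S" "S \<subseteq> H" "\<forall>s\<in>S. inv\<^bsub>BijGroup (topspace X)\<^esub> s \<in> S"
               "generate (BijGroup (topspace X)) S = H"
    and d_fin: "(SUP x\<in>topspace X. leud (germ_vertices X H x) (germ_edges X H S x)) \<noteq> \<infinity>"
    and \<rho>_hom: "\<rho> \<in> hom ((BijGroup V)\<lparr>carrier := G\<rparr>) ((BijGroup (topspace X))\<lparr>carrier := H\<rparr>)"
    and \<rho>_inj: "inj_on \<rho> G"
  shows "let d = the_enat (SUP x\<in>topspace X. leud (germ_vertices X H x) (germ_edges X H S x));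
             Y = ess_support V G X \<rho>
         in \<exists>q :: 'x \<Rightarrow> (nat \<Rightarrow> nat) set.
              (\<forall>y\<in>Y. closedin (boundary_top V) (q y) \<and> q y \<noteq> {} \<and> finite (q y) \<and> card (q y) \<le> d)
            \<and> (\<forall>K. closedin (boundary_top V) K \<longrightarrow> openin (subtopology X Y) {y \<in> Y. q y \<inter> K = {}})
            \<and> (\<forall>g\<in>G. \<forall>y\<in>Y. q (\<rho> g y) = bd_act g ` q y)
            \<and> (d = 1 \<longrightarrow> continuous_map (subtopology X Y) (boundary_top V) (\<lambda>y. the_elem (q y)))"
proof -
  interpret tree_action "BijGroup V" V G X H S \<rho>
    by (intro tree_action.intro branch_tree_group.intro tree_group.intro tree_group_axioms.intro
        branch_tree_group_axioms.intro tree_action_axioms.intro group_BijGroup)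
      (use assms in auto)
  define D where "D = (SUP x\<in>topspace X. leud (germ_vertices X H x) (germ_edges X H S x))"
  define d where "d = the_enat D"
  define Y where "Y = ess_support V G X \<rho>"
  have D: "D = enat d" using d_fin unfolding d_def D_def [symmetric] by (cases D) auto
  have bound: "card A \<le> d" if y: "y \<in> Y" and A: "finite A" "A \<subseteq> q y" for y A
  proof (cases "A = {}")
    case False
    have yX: "y \<in> topspace X" using y ess_support_topspace by (simp add: Y_def)
    have "enat (card A) \<le> D"
      using leud_ge_card_q [OF yX A False] yX unfolding D_def by (meson SUP_upper2)
    then show ?thesis by (simp add: D)
  qed simp
  \<comment> \<open>An infinite image would contain \<open>Suc d\<close> ends, already too many for
    the bound on finite subsets.\<close>
  have fin: "finite (q y)" if "y \<in> Y" for y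
  proof (rule ccontr)
    assume "infinite (q y)"
    then obtain A where "A \<subseteq> q y" "finite A" "card A = Suc d"
      using infinite_arbitrarily_large by metis
    then show False using bound [OF that] by force
  qed
  have ne: "q y \<noteq> {}" if "y \<in> Y" for y using that q_nonempty by (simp add: Y_def)
  have Ytop: "topspace (subtopology X Y) = Y"
    using ess_support_topspace by (auto simp: Y_def)
  define e where "e = (\<lambda>y. the_elem (q y))"
  have cont: "continuous_map (subtopology X Y) (boundary_top V) e" if "d = 1"
  proof -
    have single: "q y = {e y}" if "y \<in> Y" for y
    proof -
      have "card (q y) \<noteq> 0" using ne [OF that] fin [OF that] by simp
      then have "card (q y) = 1"
        using bound [OF that fin [OF that] subset_refl] \<open>d = 1\<close> by linarith
      then obtain \<xi> where "q y = {\<xi>}" by (rule card_1_singletonE)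
      then show ?thesis by (simp add: e_def)
    qed
    have e_boundary: "e y \<in> boundary V" if "y \<in> Y" for y
    proof -
      have "e y \<in> q y" using single [OF that] by simp
      then show ?thesis by (simp add: q_def)
    qed
    show ?thesis
      unfolding continuous_map_def
    proof (intro conjI allI impI)
      show "e \<in> topspace (subtopology X Y) \<rightarrow> topspace (boundary_top V)"
        using e_boundary unfolding Ytop topspace_boundary_top by blast
      fix U assume U: "openin (boundary_top V) U"
      \<comment> \<open>For singletons, missing the complement of \<open>U\<close> means lying in
        \<open>U\<close>, so upper semicontinuity becomes continuity.\<close>
      have "{y \<in> Y. q y \<inter> (boundary V - U) = {}} = {y \<in> Y. e y \<in> U}"
        using single e_boundary by auto
      moreover have "closedin (boundary_top V) (boundary V - U)"
        using closedin_diff [OF closedin_topspace U] by (simp only: topspace_boundary_top)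
      ultimately show "openin (subtopology X Y) {y \<in> topspace (subtopology X Y). e y \<in> U}"
        unfolding Ytop using q_upper_semicontinuous [of "boundary V - U", folded Y_def] by simp
    qed
  qed
  have "(\<forall>y\<in>Y. closedin (boundary_top V) (q y) \<and> q y \<noteq> {} \<and> finite (q y) \<and> card (q y) \<le> d)
      \<and> (\<forall>K. closedin (boundary_top V) K \<longrightarrow> openin (subtopology X Y) {y \<in> Y. q y \<inter> K = {}})
      \<and> (\<forall>g\<in>G. \<forall>y\<in>Y. q (\<rho> g y) = bd_act g ` q y)
      \<and> (d = 1 \<longrightarrow> continuous_map (subtopology X Y) (boundary_top V) (\<lambda>y. the_elem (q y)))"
    using closedin_q ne fin bound [OF _ fin subset_refl] cont [unfolded e_def]
      q_upper_semicontinuous [folded Y_def] q_equivariant ess_support_topspace [folded Y_def]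
    by (intro conjI ballI allI impI) simp_all
  then show ?thesis
    unfolding Let_def D_def [symmetric] d_def [symmetric] Y_def [symmetric] by blast
qed

end
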